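(* Let $Q=Q_0\times Q_1$ be an additive abelian group where $Q_0$ is finite, let $\Bbbk$ be a field containing a primitive root of unity of order $|Q_0|$, and let $\mathfrak{g}=\bigoplus_{\alpha\in Q}\mathfrak{g}_\alpha$ be a $Q$-graded simple Lie algebra over $\Bbbk$ (with minimal grading). Assume that every ideal of $\mathfrak{g}$ is $Q_1$-graded. Then there exist a subgroup $P_0\subset Q_0$ and a simple Lie algebra $\mathfrak{a}$ over $\Bbbk$ with a $Q/P_0$-grading such that $\mathfrak{g}\simeq\mathfrak{g}(Q,P_0,\mathfrak{a})$ as $Q$-graded Lie algebras.
   Context: All algebras are over $\Bbbk$ (not necessarily finite-dimensional). A $Q$-graded Lie algebra is a Lie algebra $\mathfrak{g}=\bigoplus_{\alpha\in Q}\mathfrak{g}_\alpha$ with $[\mathfrak{g}_\alpha,\mathfrak{g}_\beta]\subset\mathfrak{g}_{\alpha+\beta}$. It is graded simple if it is not commutative and contains no non-trivial graded ideal (no graded ideal other than $0$ and $\mathfrak{g}$). The grading is minimal if $\{\alpha\in Q:\mathfrak{g}_\alpha\neq0\}$ generates $Q$. An ideal $J$ of $\mathfrak{g}$ is $Q_1$-graded if $J=\bigoplus_{\gamma\in Q_1}\big(J\cap\bigoplus_{\delta\in Q_0}\mathfrak{g}_{(\delta,\gamma)}\big)$. Loop algebra: for a subgroup $P\subset Q$ and a simple Lie algebra $\mathfrak{a}=\bigoplus_{\bar\alpha\in Q/P}\mathfrak{a}_{\bar\alpha}$ with a $Q/P$-grading, let $\Bbbk Q$ be the group algebra with basis $\{t^\alpha:\alpha\in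 Q\}$, $t^\alpha t^\beta=t^{\alpha+\beta}$, and give $\mathfrak{a}\otimes\Bbbk Q$ the bracket $[x\otimes t^\alpha,y\otimes t^\beta]=[x,y]\otimes t^{\alpha+\beta}$. Then $\mathfrak{g}(Q,P,\mathfrak{a}):=\bigoplus_{\alpha\in Q}\mathfrak{a}_{\bar\alpha}\otimes t^\alpha$, where $\bar\alpha=\alpha+P$, is a $Q$-graded Lie subalgebra with $\mathfrak{g}(Q,P,\mathfrak{a})_\alpha=\mathfrak{a}_{\bar\alpha}\otimes t^\alpha$. An isomorphism of $Q$-graded Lie algebras means a Lie algebra isomorphism carrying the degree $\alpha$ component onto the degree $\alpha$ component for all $\alpha\in Q$. *)

theory Defs
  imports "HOL-Algebra.Module" "HOL-Algebra.Generated_Groups" "HOL-Algebra.Multiplicative_Group"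
begin

section \<open>Lie algebras\<close>

text \<open>
  A Lie algebra is a vector space record with an additional bracket.  The fields \<open>mult\<close> and \<open>one\<close>,
  inherited from the ring record through \<open>module\<close>, play no role.
\<close>

record ('k, 'a) lie_algebra = "('k, 'a) module" +
  bracket :: "'a \<Rightarrow> 'a \<Rightarrow> 'a"  (\<open>\<lbrakk>_,_\<rbrakk>\<index>\<close>)

locale lie_algebra = field K + module K L
  for K :: "('k, 'm) ring_scheme" (structure) and L :: "('k, 'a, 'n) lie_algebra_scheme" (structure) +
  assumes bracket_closed:
      "x \<in> carrier L \<Longrightarrow> y \<in> carrier L
        \<Longrightarrow> \<lbrakk>x,y\<rbrakk>\<^bsub>L\<^esub> \<in> carrier L"
    and bracket_add_left:
      "x \<in> carrier L \<Longrightarrow> y \<in> carrier L \<Longrightarrow> z \<in> carrier L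
        \<Longrightarrow> \<lbrakk>x \<oplus>\<^bsub>L\<^esub> y,z\<rbrakk>\<^bsub>L\<^esub> = \<lbrakk>x,z\<rbrakk>\<^bsub>L\<^esub> \<oplus>\<^bsub>L\<^esub> \<lbrakk>y,z\<rbrakk>\<^bsub>L\<^esub>"
    and bracket_add_right:
      "x \<in> carrier L \<Longrightarrow> y \<in> carrier L \<Longrightarrow> z \<in> carrier L
        \<Longrightarrow> \<lbrakk>x,y \<oplus>\<^bsub>L\<^esub> z\<rbrakk>\<^bsub>L\<^esub> = \<lbrakk>x,y\<rbrakk>\<^bsub>L\<^esub> \<oplus>\<^bsub>L\<^esub> \<lbrakk>x,z\<rbrakk>\<^bsub>L\<^esub>"
    and bracket_smult_left:
      "c \<in> carrier K \<Longrightarrow> x \<in> carrier L \<Longrightarrow> y \<in> carrier L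
        \<Longrightarrow> \<lbrakk>c \<odot>\<^bsub>L\<^esub> x,y\<rbrakk>\<^bsub>L\<^esub> = c \<odot>\<^bsub>L\<^esub> \<lbrakk>x,y\<rbrakk>\<^bsub>L\<^esub>"
    and bracket_smult_right:
      "c \<in> carrier K \<Longrightarrow> x \<in> carrier L \<Longrightarrow> y \<in> carrier L
        \<Longrightarrow> \<lbrakk>x,c \<odot>\<^bsub>L\<^esub> y\<rbrakk>\<^bsub>L\<^esub> = c \<odot>\<^bsub>L\<^esub> \<lbrakk>x,y\<rbrakk>\<^bsub>L\<^esub>"
    and bracket_alternating:
      "x \<in> carrier L
        \<Longrightarrow> \<lbrakk>x,x\<rbrakk>\<^bsub>L\<^esub> = \<zero>\<^bsub>L\<^esub>"
    and jacobi:
      "x \<in> carrier L \<Longrightarrow> y \<in> carrier L \<Longrightarrow> z \<in> carrier L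
        \<Longrightarrow> \<lbrakk>x,\<lbrakk>y,z\<rbrakk>\<^bsub>L\<^esub>\<rbrakk>\<^bsub>L\<^esub> \<oplus>\<^bsub>L\<^esub> \<lbrakk>y,\<lbrakk>z,x\<rbrakk>\<^bsub>L\<^esub>\<rbrakk>\<^bsub>L\<^esub> \<oplus>\<^bsub>L\<^esub> \<lbrakk>z,\<lbrakk>x,y\<rbrakk>\<^bsub>L\<^esub>\<rbrakk>\<^bsub>L\<^esub> = \<zero>\<^bsub>L\<^esub>"

definition commutative_lie :: "('k, 'a) lie_algebra \<Rightarrow> bool" where
  "commutative_lie L \<longleftrightarrow> (\<forall>x \<in> carrier L. \<forall>y \<in> carrier L. \<lbrakk>x,y\<rbrakk>\<^bsub>L\<^esub> = \<zero>\<^bsub>L\<^esub>)"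

definition lie_ideal :: "'k ring \<Rightarrow> ('k, 'a) lie_algebra \<Rightarrow> 'a set \<Rightarrow> bool" where
  "lie_ideal K L J \<longleftrightarrow>
     submodule J K L \<and> (\<forall>x \<in> carrier L. \<forall>y \<in> J. \<lbrakk>x,y\<rbrakk>\<^bsub>L\<^esub> \<in> J)"

definition simple_lie_algebra :: "'k ring \<Rightarrow> ('k, 'a) lie_algebra \<Rightarrow> bool" where
  "simple_lie_algebra K L \<longleftrightarrow>
     lie_algebra K L \<and> \<not> commutative_lie L \<and>
     (\<forall>J. lie_ideal K L J \<longrightarrow> J = {\<zero>\<^bsub>L\<^esub>} \<or> J = carrier L)"

definition lie_iso :: "'k ring \<Rightarrow> ('k, 'a) lie_algebra \<Rightarrow> ('k, 'b) lie_algebra \<Rightarrow> ('a \<Rightarrow> 'b) set" where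
  "lie_iso K L M = {h. bij_betw h (carrier L) (carrier M) \<and>
     (\<forall>x \<in> carrier L. \<forall>y \<in> carrier L. h (x \<oplus>\<^bsub>L\<^esub> y) = h x \<oplus>\<^bsub>M\<^esub> h y) \<and>
     (\<forall>c \<in> carrier K. \<forall>x \<in> carrier L. h (c \<odot>\<^bsub>L\<^esub> x) = c \<odot>\<^bsub>M\<^esub> h x) \<and>
     (\<forall>x \<in> carrier L. \<forall>y \<in> carrier L. h \<lbrakk>x,y\<rbrakk>\<^bsub>L\<^esub> = \<lbrakk>h x,h y\<rbrakk>\<^bsub>M\<^esub>)}"


section \<open>Gradings\<close>

definition sum_of :: "('k, 'a) lie_algebra \<Rightarrow> 'i set \<Rightarrow> ('i \<Rightarrow> 'a set) \<Rightarrow> 'a set" where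
  "sum_of L I N = {finsum L f S | f S. finite S \<and> S \<subseteq> I \<and> f \<in> (\<Pi> i\<in>S. N i)}"

text \<open>\<open>W\<close> is the internal direct sum of the subspaces \<open>N i\<close>, \<open>i \<in> I\<close>.\<close>

definition is_direct_sum :: "('k, 'a) lie_algebra \<Rightarrow> 'i set \<Rightarrow> ('i \<Rightarrow> 'a set) \<Rightarrow> 'a set \<Rightarrow> bool" where
  "is_direct_sum L I N W \<longleftrightarrow>
     W = sum_of L I N \<and>
     (\<forall>S f. finite S \<and> S \<subseteq> I \<and> f \<in> (\<Pi> i\<in>S. N i) \<and> finsum L f S = \<zero>\<^bsub>L\<^esub>
        \<longrightarrow> (\<forall>i \<in> S. f i = \<zero>\<^bsub>L\<^esub>))"

text \<open>
  Abelian grading groups are written multiplicatively, as groups are throughout HOL-Algebra.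
  The function \<open>A\<close> gives the homogeneous components; its values off \<open>carrier Q\<close> are irrelevant.
\<close>

definition graded_lie_algebra ::
    "'k ring \<Rightarrow> 'q monoid \<Rightarrow> ('k, 'a) lie_algebra \<Rightarrow> ('q \<Rightarrow> 'a set) \<Rightarrow> bool" where
  "graded_lie_algebra K Q L A \<longleftrightarrow>
     comm_group Q \<and> lie_algebra K L \<and>
     (\<forall>\<alpha> \<in> carrier Q. submodule (A \<alpha>) K L) \<and>
     is_direct_sum L (carrier Q) A (carrier L) \<and>
     (\<forall>\<alpha> \<in> carrier Q. \<forall>\<beta> \<in> carrier Q. \<forall>x \<in> A \<alpha>. \<forall>y \<in> A \<beta>. \<lbrakk>x,y\<rbrakk>\<^bsub>L\<^esub> \<in> A (\<alpha> \<otimes>\<^bsub>Q\<^esub> \<beta>))"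

definition graded_ideal ::
    "'k ring \<Rightarrow> 'q monoid \<Rightarrow> ('k, 'a) lie_algebra \<Rightarrow> ('q \<Rightarrow> 'a set) \<Rightarrow> 'a set \<Rightarrow> bool" where
  "graded_ideal K Q L A J \<longleftrightarrow>
     lie_ideal K L J \<and> is_direct_sum L (carrier Q) (\<lambda>\<alpha>. J \<inter> A \<alpha>) J"

definition graded_simple ::
    "'k ring \<Rightarrow> 'q monoid \<Rightarrow> ('k, 'a) lie_algebra \<Rightarrow> ('q \<Rightarrow> 'a set) \<Rightarrow> bool" where
  "graded_simple K Q L A \<longleftrightarrow>
     graded_lie_algebra K Q L A \<and> \<not> commutative_lie L \<and>
     (\<forall>J. graded_ideal K Q L A J \<longrightarrow> J = {\<zero>\<^bsub>L\<^esub>} \<or> J = carrier L)"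

definition minimal_grading :: "'q monoid \<Rightarrow> ('k, 'a) lie_algebra \<Rightarrow> ('q \<Rightarrow> 'a set) \<Rightarrow> bool" where
  "minimal_grading Q L A \<longleftrightarrow>
     generate Q {\<alpha> \<in> carrier Q. A \<alpha> \<noteq> {\<zero>\<^bsub>L\<^esub>}} = carrier Q"

definition snd_graded ::
    "'q0 monoid \<Rightarrow> 'q1 monoid \<Rightarrow> ('k, 'a) lie_algebra \<Rightarrow> ('q0 \<times> 'q1 \<Rightarrow> 'a set) \<Rightarrow> 'a set \<Rightarrow> bool"
where
  "snd_graded Q0 Q1 L A J \<longleftrightarrow>
     is_direct_sum L (carrier Q1) (\<lambda>\<gamma>. J \<inter> sum_of L (carrier Q0) (\<lambda>\<delta>. A (\<delta>, \<gamma>))) J"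

definition graded_isomorphic ::
    "'k ring \<Rightarrow> 'q monoid \<Rightarrow> ('k, 'a) lie_algebra \<Rightarrow> ('q \<Rightarrow> 'a set)
      \<Rightarrow> ('k, 'b) lie_algebra \<Rightarrow> ('q \<Rightarrow> 'b set) \<Rightarrow> bool" where
  "graded_isomorphic K Q L A M B \<longleftrightarrow>
     (\<exists>h \<in> lie_iso K L M. \<forall>\<alpha> \<in> carrier Q. h ` A \<alpha> = B \<alpha>)"


section \<open>Loop algebras\<close>

text \<open>
  The tensor product of \<open>L\<close> with the group algebra of \<open>Q\<close> is the space of finitely supported
  functions from \<open>Q\<close> to \<open>L\<close>: the function \<open>f\<close> stands for the sum of the \<open>f \<alpha> \<otimes> t\<^sup>\<alpha>\<close>, and the pure
  tensor \<open>x \<otimes> t\<^sup>\<alpha>\<close> is \<open>loop_monom Q L x \<alpha>\<close>.  The bracket is the bilinear extension of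
  \<open>[x \<otimes> t\<^sup>\<alpha>, y \<otimes> t\<^sup>\<beta>] = [x,y] \<otimes> t\<^sup>\<alpha>\<^sup>+\<^sup>\<beta>\<close>; see \<open>bracket_loop_monom\<close> below.
\<close>

definition loop_support :: "'q monoid \<Rightarrow> ('k, 'a) lie_algebra \<Rightarrow> ('q \<Rightarrow> 'a) \<Rightarrow> 'q set" where
  "loop_support Q L f = {\<alpha> \<in> carrier Q. f \<alpha> \<noteq> \<zero>\<^bsub>L\<^esub>}"

definition loop_monom :: "'q monoid \<Rightarrow> ('k, 'a) lie_algebra \<Rightarrow> 'a \<Rightarrow> 'q \<Rightarrow> ('q \<Rightarrow> 'a)" where
  "loop_monom Q L x \<alpha> = (\<lambda>\<beta> \<in> carrier Q. if \<beta> = \<alpha> then x else \<zero>\<^bsub>L\<^esub>)"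

definition group_algebra_tensor :: "'q monoid \<Rightarrow> ('k, 'a) lie_algebra \<Rightarrow> ('k, 'q \<Rightarrow> 'a) lie_algebra" where
  "group_algebra_tensor Q L =
    \<lparr>carrier = {f \<in> carrier Q \<rightarrow>\<^sub>E carrier L. finite (loop_support Q L f)},
     mult = undefined,
     one = undefined,
     zero = (\<lambda>\<alpha> \<in> carrier Q. \<zero>\<^bsub>L\<^esub>),
     add = (\<lambda>f g. \<lambda>\<alpha> \<in> carrier Q. f \<alpha> \<oplus>\<^bsub>L\<^esub> g \<alpha>),
     smult = (\<lambda>c f. \<lambda>\<alpha> \<in> carrier Q. c \<odot>\<^bsub>L\<^esub> f \<alpha>),
     bracket = (\<lambda>f g. \<lambda>\<gamma> \<in> carrier Q.
        \<Oplus>\<^bsub>L\<^esub>p \<in> {p \<in> loop_support Q L f \<times> loop_support Q L g. fst p \<otimes>\<^bsub>Q\<^esub> snd p = \<gamma>}.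
          \<lbrakk>f (fst p),g (snd p)\<rbrakk>\<^bsub>L\<^esub>)\<rparr>"

text \<open>
  Here \<open>A\<close> is a grading of \<open>L\<close> by \<open>Q Mod P\<close>, whose elements are the cosets \<open>P #> \<alpha>\<close>.
\<close>

definition loop_algebra ::
    "'q monoid \<Rightarrow> 'q set \<Rightarrow> ('k, 'a) lie_algebra \<Rightarrow> ('q set \<Rightarrow> 'a set) \<Rightarrow> ('k, 'q \<Rightarrow> 'a) lie_algebra"
where
  "loop_algebra Q P L A = (group_algebra_tensor Q L)
     \<lparr>carrier := {f \<in> carrier (group_algebra_tensor Q L).
                   \<forall>\<alpha> \<in> carrier Q. f \<alpha> \<in> A (P #>\<^bsub>Q\<^esub> \<alpha>)}\<rparr>"

definition loop_component ::
    "'q monoid \<Rightarrow> 'q set \<Rightarrow> ('k, 'a) lie_algebra \<Rightarrow> ('q set \<Rightarrow> 'a set) \<Rightarrow> 'q \<Rightarrow> ('q \<Rightarrow> 'a) set"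
where
  "loop_component Q P L A \<alpha> = (\<lambda>x. loop_monom Q L x \<alpha>) ` A (P #>\<^bsub>Q\<^esub> \<alpha>)"

lemma (in lie_algebra) bracket_zero:
  assumes x: "x \<in> carrier L"
  shows "\<lbrakk>x,\<zero>\<^bsub>L\<^esub>\<rbrakk>\<^bsub>L\<^esub> = \<zero>\<^bsub>L\<^esub>" "\<lbrakk>\<zero>\<^bsub>L\<^esub>,x\<rbrakk>\<^bsub>L\<^esub> = \<zero>\<^bsub>L\<^esub>"
proof -
  have "\<lbrakk>x,\<zero>\<^bsub>L\<^esub>\<rbrakk>\<^bsub>L\<^esub> \<oplus>\<^bsub>L\<^esub> \<lbrakk>x,\<zero>\<^bsub>L\<^esub>\<rbrakk>\<^bsub>L\<^esub> = \<lbrakk>x,\<zero>\<^bsub>L\<^esub>\<rbrakk>\<^bsub>L\<^esub>"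
    using bracket_add_right[of x "\<zero>\<^bsub>L\<^esub>" "\<zero>\<^bsub>L\<^esub>"] x by simp
  then show "\<lbrakk>x,\<zero>\<^bsub>L\<^esub>\<rbrakk>\<^bsub>L\<^esub> = \<zero>\<^bsub>L\<^esub>"
    using bracket_closed[OF x M.zero_closed] M.add.l_cancel_one by blast
  have "\<lbrakk>\<zero>\<^bsub>L\<^esub>,x\<rbrakk>\<^bsub>L\<^esub> \<oplus>\<^bsub>L\<^esub> \<lbrakk>\<zero>\<^bsub>L\<^esub>,x\<rbrakk>\<^bsub>L\<^esub> = \<lbrakk>\<zero>\<^bsub>L\<^esub>,x\<rbrakk>\<^bsub>L\<^esub>"
    using bracket_add_left[of "\<zero>\<^bsub>L\<^esub>" "\<zero>\<^bsub>L\<^esub>" x] x by simp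
  then show "\<lbrakk>\<zero>\<^bsub>L\<^esub>,x\<rbrakk>\<^bsub>L\<^esub> = \<zero>\<^bsub>L\<^esub>"
    using bracket_closed[OF M.zero_closed x] M.add.l_cancel_one by blast
qed

lemma bracket_loop_monom:
  fixes K :: "'k ring" and L :: "('k, 'a) lie_algebra" and Q :: "'q monoid"
  assumes "lie_algebra K L" and "comm_group Q"
    and x: "x \<in> carrier L" and y: "y \<in> carrier L"
    and \<alpha>: "\<alpha> \<in> carrier Q" and \<beta>: "\<beta> \<in> carrier Q"
  shows "\<lbrakk>loop_monom Q L x \<alpha>,loop_monom Q L y \<beta>\<rbrakk>\<^bsub>group_algebra_tensor Q L\<^esub>
           = loop_monom Q L \<lbrakk>x,y\<rbrakk>\<^bsub>L\<^esub> (\<alpha> \<otimes>\<^bsub>Q\<^esub> \<beta>)"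
proof -
  interpret lie_algebra K L by fact
  let ?f = "loop_monom Q L x \<alpha>" and ?g = "loop_monom Q L y \<beta>"
  have f: "?f \<alpha> = x" and g: "?g \<beta> = y"
    using \<alpha> \<beta> by (simp_all add: loop_monom_def)
  let ?T = "\<lambda>\<gamma>. {p \<in> loop_support Q L ?f \<times> loop_support Q L ?g. fst p \<otimes>\<^bsub>Q\<^esub> snd p = \<gamma>}"
  have sf: "loop_support Q L ?f = (if x = \<zero>\<^bsub>L\<^esub> then {} else {\<alpha>})"
    and sg: "loop_support Q L ?g = (if y = \<zero>\<^bsub>L\<^esub> then {} else {\<beta>})"
    using \<alpha> \<beta> by (auto simp: loop_support_def loop_monom_def)
  have T: "?T \<gamma> = (if x \<noteq> \<zero>\<^bsub>L\<^esub> \<and> y \<noteq> \<zero>\<^bsub>L\<^esub> \<and> \<gamma> = \<alpha> \<otimes>\<^bsub>Q\<^esub> \<beta> then {(\<alpha>, \<beta>)} else {})" for \<gamma>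
    unfolding sf sg by auto
  have "(\<Oplus>\<^bsub>L\<^esub>p \<in> ?T \<gamma>. \<lbrakk>?f (fst p),?g (snd p)\<rbrakk>\<^bsub>L\<^esub>) = (if \<gamma> = \<alpha> \<otimes>\<^bsub>Q\<^esub> \<beta> then \<lbrakk>x,y\<rbrakk>\<^bsub>L\<^esub> else \<zero>\<^bsub>L\<^esub>)" for \<gamma>
    unfolding T using x y bracket_zero
    by (auto simp: f g bracket_closed M.finsum_insert)
  then show ?thesis
    by (simp add: group_algebra_tensor_def loop_monom_def)
qed

end

theory Submission
  imports Defs "HOL-Number_Theory.Cong"
begin

text \<open>
  Let \<open>J\<close> be a maximal ideal of the graded simple Lie algebra \<open>L\<close>.  The simple algebra \<open>\<aa>\<close> is, up to
  isomorphism, \<open>L / J\<close>, and \<open>L\<close> is recovered from \<open>\<aa>\<close> because \<open>J\<close> contains no nonzero homogeneous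
  element: the elements all of whose components lie in \<open>J\<close> form a proper graded ideal
  (\<open>proper_ideal_core_zero\<close>).  This also makes Zorn's lemma applicable, since a union of a chain of
  proper ideals still omits every nonzero homogeneous element (\<open>exists_maximal_ideal\<close>).

  The roots of unity in \<open>K\<close> provide enough characters \<open>\<chi>\<close> of \<open>Q0\<close> with values in \<open>K\<close> to separate the
  points of \<open>Q0\<close> (\<open>characters_separate_points\<close>).  Such a character acts on \<open>L\<close> by the automorphism
  that multiplies the component of degree \<open>(\<delta>, \<gamma>)\<close> by \<open>\<chi> \<delta>\<close>.  As all ideals are graded by \<open>Q1\<close>, an ideal
  that is stable under a set of characters is graded by \<open>Q0 \<times>\<times> Q1\<close> up to the elements of \<open>Q0\<close> which
  those characters cannot tell apart (\<open>class_projection_in_ideal\<close>).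

  Let \<open>stabilizer\<close> be the set of characters that map \<open>J\<close> into itself, and let \<open>complement\<close> consist of the
  elements that every other character moves into \<open>J\<close>.  An element of \<open>J \<inter> complement\<close> is moved into \<open>J\<close>
  by all characters, so its components lie in \<open>J\<close> and it vanishes.  The ideals \<open>\<chi>\<inverse>(J)\<close> for \<open>\<chi>\<close> outside
  the stabilizer are comaximal with \<open>J\<close>, and the Chinese remainder theorem, which holds here because
  \<open>L / J\<close> is not commutative, shows that so is their intersection.  Hence \<open>L\<close> is the direct sum of the
  ideals \<open>complement\<close> and \<open>J\<close>, the former is a copy of \<open>L / J\<close> inside \<open>L\<close>, and this copy serves as \<open>\<aa>\<close>.
  It is stable under the stabilizer, so it is graded by the quotient of \<open>Q0 \<times>\<times> Q1\<close> by the annihilator of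
  the stabilizer in \<open>Q0\<close>.

  The isomorphism sends \<open>x\<close> to the sum of the \<open>proj x\<^sub>\<alpha> \<otimes> t\<^sup>\<alpha>\<close>, where \<open>proj\<close> is the projection onto
  \<open>complement\<close> along \<open>J\<close>.  It is injective because \<open>J\<close> contains no nonzero homogeneous element.  For
  surjectivity, each element of \<open>\<aa>\<close> whose degree is the coset of \<open>\<alpha>\<close> must come from a homogeneous
  element of degree \<open>\<alpha>\<close> itself.  Write the indicator of the neutral element of \<open>Q0\<close> as a linear combination of
  characters.  Translating it by \<open>\<beta>\<close> expresses the projection to degree \<open>\<beta>\<close> through the action of
  the characters.  On an element \<open>z\<close> of \<open>\<aa>\<close> whose degree is the coset of \<open>\<beta>\<close> the characters outside the
  stabilizer contribute elements of \<open>J\<close>, and those in the stabilizer act by scalars that the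
  translation cancels.  So the component of \<open>z\<close> of degree \<open>\<beta>\<close> is congruent to \<open>c z\<close> modulo \<open>J\<close> with a
  scalar \<open>c\<close> that depends on neither \<open>\<beta>\<close> nor \<open>z\<close> (\<open>component_scalar_mod_J\<close>).  If \<open>c\<close> were zero, all
  components of elements of \<open>complement\<close> would lie in \<open>J\<close>, so \<open>complement\<close> would be zero.  Dividing
  by \<open>c\<close> gives the preimage (\<open>homogeneous_lift\<close>).
\<close>

section \<open>Characters of a finite abelian group\<close>

text \<open>
  A homomorphism from the subgroup \<open>H\<close> to \<open>\<int> / n\<close>, given by representatives.  Composed with the powers
  of a primitive \<open>n\<close>-th root of unity it becomes a character; working with exponents turns the
  extraction of roots of character values into division of natural numbers.
\<close>
definition exponent_map :: "('q, 'x) monoid_scheme \<Rightarrow> nat \<Rightarrow> 'q set \<Rightarrow> ('q \<Rightarrow> nat) \<Rightarrow> bool" where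
  "exponent_map Q n H e \<longleftrightarrow> (\<forall>x \<in> H. \<forall>y \<in> H. [e (x \<otimes>\<^bsub>Q\<^esub> y) = e x + e y] (mod n))"

text \<open>
  The condition on \<open>t\<close> says that the prescription \<open>b \<mapsto> t\<close> agrees with \<open>e\<close> wherever a power of \<open>b\<close>
  lies in \<open>H\<close>.  This is what makes \<open>h b\<^sup>k \<mapsto> e h + k t\<close> independent, modulo \<open>n\<close>, of the chosen
  representation of an element of the subgroup generated by \<open>H\<close> and \<open>b\<close>.
\<close>
lemma (in comm_group) exponent_map_extend:
  assumes fin: "finite (carrier G)" and H: "subgroup H G" and e: "exponent_map G n H e"
    and b: "b \<in> carrier G" and t: "\<And>k. b [^] k \<in> H \<Longrightarrow> [e (b [^] k) = k * t] (mod n)"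
  shows "\<exists>H' e'. subgroup H' G \<and> H \<subseteq> H' \<and> b \<in> H' \<and> exponent_map G n H' e' \<and>
           (\<forall>h \<in> H. [e' h = e h] (mod n)) \<and> [e' b = t] (mod n)"
proof -
  interpret H: subgroup H G by fact
  define H' where "H' = {h \<otimes> b [^] k | h k :: nat. h \<in> H} "
  \<comment> \<open>Any representation of \<open>x\<close> may be chosen: the value does not depend on it modulo \<open>n\<close>.\<close>
  define e' where "e' x = (SOME v. \<exists>h k. h \<in> H \<and> x = h \<otimes> b [^] (k::nat) \<and> v = e h + k * t)" for x
  have ord_le: "[e h + k * t = e h' + l * t] (mod n)"
    if "h \<in> H" "h' \<in> H" "h \<otimes> b [^] k = h' \<otimes> b [^] l" "k \<le> l" for h h' and k l :: nat
  proof -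
    have "h \<otimes> b [^] k = h' \<otimes> b [^] (l - k) \<otimes> b [^] k"
      using that b by (simp add: m_assoc nat_pow_mult)
    then have h: "h = h' \<otimes> b [^] (l - k)"
      using that b by simp
    then have "b [^] (l - k) = inv h' \<otimes> h"
      using that b by (simp add: inv_solve_left)
    then have bH: "b [^] (l - k) \<in> H" using that by simp
    have "[e h = e h' + e (b [^] (l - k))] (mod n)"
      using e bH that h by (auto simp: exponent_map_def)
    also have "[e h' + e (b [^] (l - k)) = e h' + (l - k) * t] (mod n)"
      using t[OF bH] by (simp add: cong_add_lcancel_nat)
    finally have "[e h + k * t = e h' + (l - k) * t + k * t] (mod n)"
      by (simp add: cong_add_rcancel_nat)
    moreover have "(l - k) * t + k * t = l * t"
      using that(4) by (simp flip: add_mult_distrib)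
    ultimately show ?thesis by (simp add: add.assoc)
  qed
  have e'_eq: "[e' (h \<otimes> b [^] k) = e h + k * t] (mod n)" if h: "h \<in> H" for h and k :: nat
  proof -
    have "\<exists>v h' l. h' \<in> H \<and> h \<otimes> b [^] k = h' \<otimes> b [^] (l::nat) \<and> v = e h' + l * t"
      using h by blast
    from someI_ex[OF this] obtain h' l where "h' \<in> H" "h \<otimes> b [^] k = h' \<otimes> b [^] (l::nat)"
      "e' (h \<otimes> b [^] k) = e h' + l * t"
      unfolding e'_def by blast
    then show ?thesis
      using ord_le[of h h' k l] ord_le[of h' h l k] h cong_sym by (metis nat_le_linear)
  qed
  have "subgroup H' G"
  proof (rule group.subgroupI)
    show "group G" by (rule group_axioms)
    show "H' \<subseteq> carrier G" using b by (auto simp: H'_def)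
    show "H' \<noteq> {}" using H.one_closed unfolding H'_def by blast
    show "x \<otimes> y \<in> H'" if xy: "x \<in> H'" "y \<in> H'" for x y
    proof -
      obtain h k h' l where x: "x = h \<otimes> b [^] (k::nat)" "h \<in> H"
        and y: "y = h' \<otimes> b [^] (l::nat)" "h' \<in> H"
        using xy by (auto simp: H'_def)
      have "x \<otimes> y = (h \<otimes> h') \<otimes> b [^] (k + l)"
        using x y b by (simp add: m_ac nat_pow_mult flip: nat_pow_mult)
      then show ?thesis using x y unfolding H'_def by blast
    qed
    show "inv x \<in> H'" if xH: "x \<in> H'" for x
    proof -
      obtain h k where x: "x = h \<otimes> b [^] (k::nat)" "h \<in> H"
        using xH by (auto simp: H'_def)
      have "b [^] k \<otimes> b [^] (k * order G - k) = b [^] (k * order G)"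
        using b order_gt_0_iff_finite fin by (subst nat_pow_mult) auto
      also have "\<dots> = \<one>"
        using b pow_order_eq_1[OF b] by (metis nat_pow_pow nat_pow_one mult.commute)
      finally have "inv (b [^] k) = b [^] (k * order G - k)"
        using b by (simp add: inv_equality m_comm)
      then have "inv x = inv h \<otimes> b [^] (k * order G - k)"
        using x b by (simp add: inv_mult)
      then show ?thesis using x unfolding H'_def by blast
    qed
  qed
  moreover have "H \<subseteq> H'"
  proof
    fix h assume "h \<in> H"
    then show "h \<in> H'" unfolding H'_def
      by (auto intro!: exI[of _ h] exI[of _ "0::nat"])
  qed
  moreover have "b \<in> H'"
    unfolding H'_def using b H.one_closed by (auto intro!: exI[of _ \<one>] exI[of _ "1::nat"])
  moreover have "exponent_map G n H' e'"
    unfolding exponent_map_def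
  proof (intro ballI)
    fix x y assume xy: "x \<in> H'" "y \<in> H'"
    obtain h k h' l where x: "x = h \<otimes> b [^] (k::nat)" "h \<in> H"
      and y: "y = h' \<otimes> b [^] (l::nat)" "h' \<in> H"
      using xy by (auto simp: H'_def)
    have "x \<otimes> y = (h \<otimes> h') \<otimes> b [^] (k + l)"
      using x y b by (simp add: m_ac flip: nat_pow_mult)
    then have "[e' (x \<otimes> y) = e (h \<otimes> h') + (k + l) * t] (mod n)"
      using e'_eq x y by simp
    also have "[e (h \<otimes> h') + (k + l) * t = e h + e h' + (k + l) * t] (mod n)"
      using e x y by (simp add: exponent_map_def cong_add_rcancel_nat)
    also have "e h + e h' + (k + l) * t = (e h + k * t) + (e h' + l * t)"
      by (simp add: algebra_simps)
    also have "[(e h + k * t) + (e h' + l * t) = e' x + e' y] (mod n)"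
      using e'_eq x y by (intro cong_add cong_sym[of "e' _"]) auto
    finally show "[e' (x \<otimes> y) = e' x + e' y] (mod n)" .
  qed
  moreover have "[e' h = e h] (mod n)" if "h \<in> H" for h
    using e'_eq[OF that, of 0] that by simp
  moreover have "[e' b = t] (mod n)"
  proof -
    have "[e \<one> = 1 * 0] (mod n)"
      using t[of 0] by simp
    then show ?thesis
      using e'_eq[of \<one> 1] b H.one_closed cong_trans cong_add_rcancel_0_nat[of "e \<one>" t n] by auto
  qed
  ultimately show ?thesis by blast
qed

lemma (in group) subgroup_nat_pow_closed:
  assumes H: "subgroup H G" and x: "x \<in> H"
  shows "x [^] (k::nat) \<in> H"
  using subgroup.one_closed[OF H] subgroup.m_closed[OF H _ x] by (induction k) auto

lemma (in group) least_power_dvd: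
  assumes H: "subgroup H G" and b: "b \<in> carrier G"
    and m: "m > 0" "b [^] m \<in> H" and least: "\<And>k. k > 0 \<Longrightarrow> b [^] k \<in> H \<Longrightarrow> m \<le> k"
    and k: "b [^] k \<in> H"
  shows "m dvd (k::nat)"
proof (rule ccontr)
  interpret H: subgroup H G by fact
  assume "\<not> m dvd k"
  then have pos: "k mod m > 0" by (simp add: mod_greater_zero_iff_not_dvd)
  have q: "b [^] (m * (k div m)) \<in> H"
    using m b by (simp flip: nat_pow_pow add: subgroup_nat_pow_closed[OF H])
  have "b [^] k = b [^] (m * (k div m)) \<otimes> b [^] (k mod m)"
    using b by (simp add: nat_pow_mult)
  then have "b [^] (k mod m) = inv (b [^] (m * (k div m))) \<otimes> b [^] k"
    using b by (simp add: inv_solve_left)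
  then have "b [^] (k mod m) \<in> H" using q k by simp
  then show False using least[OF pos] m(1) by (meson mod_less_divisor not_less)
qed

lemma (in comm_group) exponent_map_pow:
  assumes H: "subgroup H G" and e: "exponent_map G n H e" and x: "x \<in> H"
  shows "[e (x [^] (k::nat)) = k * e x] (mod n)"
proof -
  interpret H: subgroup H G by fact
  have "[e (\<one> \<otimes> \<one>) = e \<one> + e \<one>] (mod n)"
    using e H.one_closed unfolding exponent_map_def by blast
  then have one: "[e \<one> = 0] (mod n)"
    using cong_add_lcancel_0_nat[of "e \<one>" "e \<one>" n] cong_sym by simp blast
  show ?thesis
  proof (induction k)
    case (Suc k)
    have "[e (x [^] k \<otimes> x) = e (x [^] k) + e x] (mod n)"
      using e x by (auto simp: exponent_map_def subgroup_nat_pow_closed[OF H])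
    also have "[e (x [^] k) + e x = k * e x + e x] (mod n)"
      using Suc.IH by (simp add: cong_add_rcancel_nat)
    finally show ?case by (simp add: add.commute)
  qed (use one in simp)
qed

text \<open>
  Let \<open>n\<close> be the order of the group.  The assignment \<open>a \<mapsto> n / ord a\<close> is consistent on the powers of
  \<open>a\<close> and does not kill \<open>a\<close>; it remains to extend it from a subgroup \<open>H\<close> to one more element \<open>b\<close>.  If
  \<open>b\<^sup>m\<close> is the first positive power in \<open>H\<close>, one needs an \<open>m\<close>-th part of \<open>e (b\<^sup>m)\<close> in \<open>\<int> / n\<close>.  It exists
  because \<open>m\<close> divides \<open>n\<close> and \<open>(n / m) e (b\<^sup>m) = e (b\<^sup>n) = 0\<close>, so that \<open>m\<close> divides \<open>e (b\<^sup>m)\<close>.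
\<close>
theorem (in comm_group) exponent_map_separates:
  assumes fin: "finite (carrier G)" and a: "a \<in> carrier G" "a \<noteq> \<one>"
  shows "\<exists>e. exponent_map G (order G) (carrier G) e \<and> \<not> [e a = 0] (mod order G)"
proof -
  let ?n = "order G"
  have n0: "?n > 0" using fin by (simp add: order_gt_0_iff_finite)
  define P where "P H \<longleftrightarrow> subgroup H G \<and> a \<in> H \<and>
      (\<exists>e. exponent_map G ?n H e \<and> \<not> [e a = 0] (mod ?n))" for H
  have "\<exists>H. P H"
  proof -
    have oa: "ord a dvd ?n" using a by (simp add: ord_dvd_group_order)
    have oa1: "ord a > 1"
      using a fin ord_ge_1[OF fin a(1)] ord_eq_1[OF a(1)] by linarith
    \<comment> \<open>an element of order \<open>ord a\<close> in \<open>\<int> / n\<close>\<close>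
    let ?t = "?n div ord a"
    have t: "[0 = k * ?t] (mod ?n)" if "a [^] k \<in> {\<one>}" for k :: nat
    proof -
      have "ord a dvd k" using that a pow_eq_id by auto
      then obtain j where "k = ord a * j" by blast
      then have "k * ?t = ?n * j" using oa by auto
      then show ?thesis by (simp add: cong_def)
    qed
    have "exponent_map G ?n {\<one>} (\<lambda>_. 0)" by (simp add: exponent_map_def)
    from exponent_map_extend[OF fin triv_subgroup this a(1), of ?t] t obtain H' e'
      where "subgroup H' G" "a \<in> H'" "exponent_map G ?n H' e'" "[e' a = ?t] (mod ?n)"
      by blast
    moreover have "\<not> [?t = 0] (mod ?n)"
    proof -
      have "?t < ?n" "?t > 0" using oa oa1 n0 by (auto simp: dvd_div_eq_0_iff)
      then show ?thesis by (simp add: cong_def)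
    qed
    ultimately show ?thesis unfolding P_def by (meson cong_sym cong_trans)
  qed
  moreover have "card H \<le> ?n" if "P H" for H
    using that fin unfolding P_def order_def by (meson card_mono subgroup.subset)
  ultimately obtain H where PH: "P H" and max: "\<And>H'. P H' \<Longrightarrow> card H' \<le> card H"
    using ex_has_greatest_nat[of P _ card "Suc ?n"] by (metis less_Suc_eq_le)
  from PH obtain e where H: "subgroup H G" "a \<in> H" and e: "exponent_map G ?n H e"
    and ea: "\<not> [e a = 0] (mod ?n)" unfolding P_def by blast
  have "b \<in> H" if b: "b \<in> carrier G" for b
  proof -
    define m where "m = (LEAST k::nat. k > 0 \<and> b [^] k \<in> H)"
    have one: "b [^] ?n \<in> H" using b H(1) by (simp add: pow_order_eq_1 subgroup.one_closed)
    have m: "m > 0" "b [^] m \<in> H"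
      using LeastI[of "\<lambda>k. k > 0 \<and> b [^] k \<in> H" ?n] one n0 unfolding m_def by blast+
    have least: "m \<le> k" if "k > 0" "b [^] k \<in> H" for k
      using that unfolding m_def by (auto intro: Least_le)
    have dvd: "m dvd k" if "b [^] k \<in> H" for k
      using least_power_dvd[OF H(1) b m] least that by blast
    obtain q where q: "?n = m * q" using dvd[OF one] by blast
    have "[e ((b [^] m) [^] q) = q * e (b [^] m)] (mod ?n)"
      by (rule exponent_map_pow[OF H(1) e m(2)])
    moreover have "(b [^] m) [^] q = \<one>"
      using b q by (simp add: nat_pow_pow pow_order_eq_1 flip: q)
    moreover have "[e \<one> = 0] (mod ?n)"
      using exponent_map_pow[OF H(1) e H(2), of 0] by simp
    ultimately have "[q * e (b [^] m) = 0] (mod ?n)"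
      by (metis cong_sym cong_trans)
    then have "m * q dvd q * e (b [^] m)" by (simp add: cong_0_iff q)
    then have "m dvd e (b [^] m)" using n0 q by (simp add: mult.commute)
    then obtain t where t: "e (b [^] m) = m * t" by blast
    have "[e (b [^] k) = k * t] (mod ?n)" if k: "b [^] k \<in> H" for k
    proof -
      obtain j where j: "k = m * j" using dvd[OF k] by blast
      then have "[e (b [^] k) = j * (m * t)] (mod ?n)"
        using exponent_map_pow[OF H(1) e m(2), of j] b by (simp add: nat_pow_pow t)
      then show ?thesis by (simp add: j ac_simps)
    qed
    from exponent_map_extend[OF fin H(1) e b this] obtain H' e'
      where H': "subgroup H' G" "H \<subseteq> H'" "b \<in> H'" "exponent_map G ?n H' e'"
        "[e' a = e a] (mod ?n)" using H(2) by blast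
    then have "P H'" using H(2) ea unfolding P_def by (meson cong_sym cong_trans subsetD)
    then have "card H' \<le> card H" by (rule max)
    moreover have "finite H'" using H'(1) fin by (meson finite_subset subgroup.subset)
    ultimately have "H = H'" using H'(2) card_seteq by blast
    then show ?thesis using H'(3) by simp
  qed
  then have "H = carrier G" using H(1) subgroup.subset by blast
  then show ?thesis using e ea by blast
qed


lemma (in group) nat_pow_mod_ord:
  assumes w: "w \<in> carrier G"
  shows "w [^] (k::nat) = w [^] (k mod ord w)"
proof -
  have "w [^] k = w [^] (ord w * (k div ord w)) \<otimes> w [^] (k mod ord w)"
    using w by (simp add: nat_pow_mult)
  then show ?thesis using w pow_ord_eq_1[OF w] by (simp flip: nat_pow_pow)
qed

corollary (in comm_group) characters_separate_points:
  assumes fin: "finite (carrier G)" and a: "a \<in> carrier G" "a \<noteq> \<one>"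
    and W: "group W" and w: "w \<in> carrier W" "group.ord W w = order G"
  shows "\<exists>\<chi> \<in> hom G W. \<chi> ` carrier G \<subseteq> (\<lambda>k. w [^]\<^bsub>W\<^esub> k) ` {..<order G} \<and> \<chi> a \<noteq> \<one>\<^bsub>W\<^esub>"
proof -
  interpret W: group W by fact
  obtain e where e: "exponent_map G (order G) (carrier G) e" and ea: "\<not> [e a = 0] (mod order G)"
    using exponent_map_separates[OF fin a] by blast
  have n0: "order G > 0" using fin by (simp add: order_gt_0_iff_finite)
  note pow_mod = W.nat_pow_mod_ord[OF w(1), unfolded w(2)]
  let ?\<chi> = "\<lambda>x. w [^]\<^bsub>W\<^esub> e x"
  have "?\<chi> (x \<otimes> y) = ?\<chi> x \<otimes>\<^bsub>W\<^esub> ?\<chi> y" if "x \<in> carrier G" "y \<in> carrier G" for x y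
    using e that w pow_mod[of "e (x \<otimes> y)"] pow_mod[of "e x + e y"]
    by (simp add: exponent_map_def cong_def W.nat_pow_mult)
  moreover have "?\<chi> x \<in> (\<lambda>k. w [^]\<^bsub>W\<^esub> k) ` {..<order G}" for x
    by (subst pow_mod) (use n0 in auto)
  moreover have "?\<chi> a \<noteq> \<one>\<^bsub>W\<^esub>"
    using ea w by (simp add: W.pow_eq_id cong_0_iff)
  ultimately show ?thesis
    using w by (intro bexI[of _ ?\<chi>]) (auto simp: hom_def)
qed

section \<open>Spans of functions\<close>

text \<open>
  The functions that agree on \<open>S\<close> with a linear combination of functions in \<open>X\<close>.  The inductive form
  allows properties of linear combinations to be proved term by term, without coefficient families.
\<close>
inductive_set pointwise_span ::
    "('k, 'x) ring_scheme \<Rightarrow> 'q set \<Rightarrow> ('q \<Rightarrow> 'k) set \<Rightarrow> ('q \<Rightarrow> 'k) set"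
  for K :: "('k, 'x) ring_scheme" and S :: "'q set" and X :: "('q \<Rightarrow> 'k) set" where
  zero: "(\<And>x. x \<in> S \<Longrightarrow> f x = \<zero>\<^bsub>K\<^esub>) \<Longrightarrow> f \<in> pointwise_span K S X"
| add: "f \<in> pointwise_span K S X \<Longrightarrow> c \<in> carrier K \<Longrightarrow> \<chi> \<in> X \<Longrightarrow>
    (\<And>x. x \<in> S \<Longrightarrow> g x = f x \<oplus>\<^bsub>K\<^esub> c \<otimes>\<^bsub>K\<^esub> \<chi> x) \<Longrightarrow> g \<in> pointwise_span K S X"

context field
begin

lemma pointwise_span_closed:
  assumes X: "X \<subseteq> S \<rightarrow> carrier R" and f: "f \<in> pointwise_span R S X" and x: "x \<in> S"
  shows "f x \<in> carrier R"
  using f x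
proof (induction f arbitrary: x)
  case (add f c \<chi> g)
  then show ?case using X by (auto simp: Pi_iff subset_iff)
qed auto

lemma pointwise_span_base:
  assumes X: "X \<subseteq> S \<rightarrow> carrier R" and "\<chi> \<in> X" and c: "c \<in> carrier R"
  shows "(\<lambda>x. c \<otimes> \<chi> x) \<in> pointwise_span R S X"
proof (rule pointwise_span.add[OF pointwise_span.zero c \<open>\<chi> \<in> X\<close>])
  show "c \<otimes> \<chi> x = \<zero> \<oplus> c \<otimes> \<chi> x" if "x \<in> S" for x
    using assms that by (auto simp: Pi_iff subset_iff)
qed auto

lemma pointwise_span_cong:
  assumes X: "X \<subseteq> S \<rightarrow> carrier R" and f: "f \<in> pointwise_span R S X"
    and g: "\<And>x. x \<in> S \<Longrightarrow> g x = f x"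
  shows "g \<in> pointwise_span R S X"
  using f g
  by (induction f arbitrary: g) (auto intro: pointwise_span.intros)

lemma pointwise_span_plus:
  assumes X: "X \<subseteq> S \<rightarrow> carrier R" and f: "f \<in> pointwise_span R S X" and g: "g \<in> pointwise_span R S X"
  shows "(\<lambda>x. f x \<oplus> g x) \<in> pointwise_span R S X"
  using g
proof (induction g)
  case (zero g)
  then show ?case
    using pointwise_span_closed[OF X f] by (intro pointwise_span_cong[OF X f]) auto
next
  case (add g c \<chi> g')
  have "f x \<oplus> g' x = f x \<oplus> g x \<oplus> c \<otimes> \<chi> x" if "x \<in> S" for x
    using that add X pointwise_span_closed[OF X f that] pointwise_span_closed[OF X add.hyps(1) that]
    by (auto simp: a_assoc Pi_iff subset_iff)
  then show ?case by (rule pointwise_span.add[OF add.IH add.hyps(2,3)])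
qed

lemma pointwise_span_smult:
  assumes X: "X \<subseteq> S \<rightarrow> carrier R" and a: "a \<in> carrier R" and f: "f \<in> pointwise_span R S X"
  shows "(\<lambda>x. a \<otimes> f x) \<in> pointwise_span R S X"
  using f
proof induction
  case (zero f)
  then show ?case using a by (auto intro: pointwise_span.zero)
next
  case (add f c \<chi> g)
  have "a \<otimes> g x = a \<otimes> f x \<oplus> (a \<otimes> c) \<otimes> \<chi> x" if "x \<in> S" for x
    using that add X a pointwise_span_closed[OF X add.hyps(1) that]
    by (auto simp: r_distr m_assoc Pi_iff subset_iff)
  then show ?case using a add by (intro pointwise_span.add[OF add.IH _ add.hyps(3)]) auto
qed

lemma pointwise_span_mult:
  assumes X: "X \<subseteq> S \<rightarrow> carrier R"
    and mult: "\<And>\<chi> \<psi>. \<chi> \<in> X \<Longrightarrow> \<psi> \<in> X \<Longrightarrow> (\<lambda>x \<in> S. \<chi> x \<otimes> \<psi> x) \<in> X"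
    and \<psi>: "\<psi> \<in> X" and f: "f \<in> pointwise_span R S X"
  shows "(\<lambda>x. \<psi> x \<otimes> f x) \<in> pointwise_span R S X"
  using f
proof induction
  case (zero f)
  then show ?case using \<psi> X by (auto intro!: pointwise_span.zero simp: Pi_iff subset_iff)
next
  case (add f c \<chi> g)
  have "\<psi> x \<otimes> g x = \<psi> x \<otimes> f x \<oplus> c \<otimes> (\<lambda>x \<in> S. \<psi> x \<otimes> \<chi> x) x" if "x \<in> S" for x
    using that add X \<psi> pointwise_span_closed[OF X add.hyps(1) that]
    by (auto simp: r_distr m_ac Pi_iff subset_iff)
  then show ?case
    by (rule pointwise_span.add[OF add.IH add.hyps(2) mult[OF \<psi> add.hyps(3)]])
qed

text \<open>
  The span is closed under multiplication by elements of \<open>X\<close>.  So one may multiply the constant function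
  1, for each point \<open>d\<close> that some \<open>\<chi>\<close> in \<open>X\<close> distinguishes from \<open>a\<close>, by a factor
  \<open>(\<chi> - \<chi> d) / (\<chi> a - \<chi> d)\<close>.  This interpolation involves no division by the number of elements
  of \<open>X\<close>, as averaging over characters would.
\<close>
theorem indicator_in_pointwise_span:
  assumes fin: "finite S" and X: "X \<subseteq> S \<rightarrow> carrier R"
    and one: "(\<lambda>x \<in> S. \<one>) \<in> X"
    and mult: "\<And>\<chi> \<psi>. \<chi> \<in> X \<Longrightarrow> \<psi> \<in> X \<Longrightarrow> (\<lambda>x \<in> S. \<chi> x \<otimes> \<psi> x) \<in> X"
    and a: "a \<in> S"
  shows "(\<lambda>x. if \<forall>\<chi> \<in> X. \<chi> x = \<chi> a then \<one> else \<zero>) \<in> pointwise_span R S X"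
proof -
  let ?eq = "\<lambda>x. \<forall>\<chi> \<in> X. \<chi> x = \<chi> a"
  have "\<exists>f \<in> pointwise_span R S X. (\<forall>x \<in> S. ?eq x \<longrightarrow> f x = \<one>) \<and> (\<forall>x \<in> F. \<not> ?eq x \<longrightarrow> f x = \<zero>)"
    if "F \<subseteq> S" for F
    using finite_subset[OF that fin] that
  proof induction
    case empty
    have "(\<lambda>x. \<one> \<otimes> (\<lambda>x \<in> S. \<one>) x) \<in> pointwise_span R S X"
      by (rule pointwise_span_base[OF X one]) simp
    then show ?case by (intro bexI) auto
  next
    case (insert d F)
    then obtain f where f: "f \<in> pointwise_span R S X" "\<And>x. x \<in> S \<Longrightarrow> ?eq x \<Longrightarrow> f x = \<one>"
      "\<And>x. x \<in> F \<Longrightarrow> \<not> ?eq x \<Longrightarrow> f x = \<zero>" by auto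
    have fc: "f x \<in> carrier R" if "x \<in> S" for x using pointwise_span_closed[OF X f(1) that] .
    show ?case
    proof (cases "?eq d")
      case True
      then show ?thesis using f by blast
    next
      case False
      then obtain \<chi> where \<chi>: "\<chi> \<in> X" "\<chi> d \<noteq> \<chi> a" by blast
      have \<chi>c: "\<chi> x \<in> carrier R" if "x \<in> S" for x using \<chi>(1) X that by auto
      have d: "d \<in> S" using insert by blast
      let ?u = "\<chi> a \<ominus> \<chi> d"
      have u: "?u \<in> carrier R" "?u \<noteq> \<zero>"
        using \<chi>c[OF a] \<chi>c[OF d] \<chi>(2) r_right_minus_eq by auto
      have uU: "inv ?u \<in> carrier R" "inv ?u \<otimes> ?u = \<one>"
        using u field_Units by auto
      \<comment> \<open>this factor is 1 on the class of \<open>a\<close> and vanishes at \<open>d\<close>\<close>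
      let ?g = "\<lambda>x. inv ?u \<otimes> (\<chi> x \<otimes> f x \<oplus> (\<ominus> \<chi> d) \<otimes> f x)"
      have "?g \<in> pointwise_span R S X"
        using uU \<chi>c[OF d]
        by (intro pointwise_span_smult[OF X] pointwise_span_plus[OF X]
              pointwise_span_mult[OF X mult \<chi>(1)] f(1)) auto
      moreover have "?g x = \<one>" if "x \<in> S" "?eq x" for x
      proof -
        have "\<chi> x = \<chi> a" using that \<chi>(1) by blast
        then show ?thesis using f(2)[OF that] uU \<chi>c[OF a] \<chi>c[OF d] by (simp add: minus_eq)
      qed
      moreover have "?g x = \<zero>" if x: "x \<in> insert d F" "\<not> ?eq x" for x
      proof (cases "x = d")
        case True
        then show ?thesis using \<chi>c[OF d] fc[OF d] uU by (simp add: l_minus r_neg)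
      next
        case False
        then have "f x = \<zero>" "x \<in> S" using x f(3) insert.prems by auto
        then show ?thesis using \<chi>c uU d by simp
      qed
      ultimately show ?thesis by (intro bexI[of _ ?g] conjI ballI impI)
    qed
  qed
  from this[of S] obtain f where f: "f \<in> pointwise_span R S X" "\<And>x. x \<in> S \<Longrightarrow> ?eq x \<Longrightarrow> f x = \<one>"
      "\<And>x. x \<in> S \<Longrightarrow> \<not> ?eq x \<Longrightarrow> f x = \<zero>" by auto
  then show ?thesis by (intro pointwise_span_cong[OF X f(1)]) auto
qed

end

section \<open>Brackets, sums and ideals\<close>

lemma (in abelian_group) finsum_additive_map:
  assumes B: "abelian_group B" and h: "h \<in> carrier G \<rightarrow> carrier B"
    and add: "\<And>x y. x \<in> carrier G \<Longrightarrow> y \<in> carrier G \<Longrightarrow> h (x \<oplus> y) = h x \<oplus>\<^bsub>B\<^esub> h y"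
    and fin: "finite S" and f: "f \<in> S \<rightarrow> carrier G"
  shows "h (finsum G f S) = finsum B (\<lambda>i. h (f i)) S"
proof -
  interpret B: abelian_group B by fact
  have "h \<zero> \<oplus>\<^bsub>B\<^esub> h \<zero> = h \<zero>" using add[of \<zero> \<zero>] by simp
  then have zero: "h \<zero> = \<zero>\<^bsub>B\<^esub>" using h B.add.l_cancel_one by blast
  show ?thesis
    using fin f
  proof induction
    case (insert i S)
    then have "finsum G f S \<in> carrier G" "f i \<in> carrier G" by auto
    moreover have "(\<lambda>i. h (f i)) \<in> S \<rightarrow> carrier B" "h (f i) \<in> carrier B"
      using insert h by auto
    ultimately show ?case using insert by (simp add: add)
  qed (simp add: zero)
qed

lemma (in abelian_group) finsum_Times:
  assumes "finite A" "finite B" and f: "f \<in> A \<times> B \<rightarrow> carrier G"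
  shows "finsum G f (A \<times> B) = (\<Oplus>a\<in>A. \<Oplus>b\<in>B. f (a, b))"
  using assms(1) f
proof induction
  case (insert a A)
  have "finsum G f ({a} \<times> B \<union> A \<times> B) = finsum G f ({a} \<times> B) \<oplus> finsum G f (A \<times> B)"
    using insert assms(2) by (intro finsum_Un_disjoint) auto
  moreover have "insert a A \<times> B = {a} \<times> B \<union> A \<times> B" by auto
  moreover have "finsum G f ({a} \<times> B) = (\<Oplus>b\<in>B. f (a, b))"
  proof -
    have "finsum G f ((\<lambda>b. (a, b)) ` B) = (\<Oplus>b\<in>B. f (a, b))"
      using insert by (intro finsum_reindex) (auto simp: inj_on_def)
    moreover have "(\<lambda>b. (a, b)) ` B = {a} \<times> B" by auto
    ultimately show ?thesis by simp
  qed
  moreover have "(\<lambda>a. \<Oplus>b\<in>B. f (a, b)) \<in> insert a A \<rightarrow> carrier G"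
    using insert by (auto intro!: finsum_closed)
  ultimately show ?case using insert by (simp add: Pi_iff)
qed simp

text \<open>
  The predicate \<open>lie_ideal\<close> and its relatives are stated for plain records without extension fields,
  so the types of the Lie algebra locale are specialized accordingly.
\<close>
locale plain_lie_algebra = lie_algebra K L
  for K :: "'k ring" (structure) and L :: "('k, 'a) lie_algebra" (structure)
begin

lemma bracket_swap_zero:
  assumes "x \<in> carrier L" "y \<in> carrier L"
  shows "\<lbrakk>x,y\<rbrakk>\<^bsub>L\<^esub> \<oplus>\<^bsub>L\<^esub> \<lbrakk>y,x\<rbrakk>\<^bsub>L\<^esub> = \<zero>\<^bsub>L\<^esub>"
  using bracket_alternating[of "x \<oplus>\<^bsub>L\<^esub> y"] bracket_alternating[of x] bracket_alternating[of y] assms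
  by (simp add: bracket_add_left bracket_add_right bracket_closed M.add.m_comm)

lemma bracket_swap:
  assumes "x \<in> carrier L" "y \<in> carrier L"
  shows "\<lbrakk>y,x\<rbrakk>\<^bsub>L\<^esub> = (\<ominus>\<one>) \<odot>\<^bsub>L\<^esub> \<lbrakk>x,y\<rbrakk>\<^bsub>L\<^esub>"
  using bracket_swap_zero[OF assms(2,1)] assms bracket_closed
  by (simp add: smult_l_minus M.minus_equality)

lemma lie_idealI:
  assumes "J \<subseteq> carrier L" "\<zero>\<^bsub>L\<^esub> \<in> J"
    and "\<And>x y. x \<in> J \<Longrightarrow> y \<in> J \<Longrightarrow> x \<oplus>\<^bsub>L\<^esub> y \<in> J"
    and smult: "\<And>c x. c \<in> carrier K \<Longrightarrow> x \<in> J \<Longrightarrow> c \<odot>\<^bsub>L\<^esub> x \<in> J"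
    and "\<And>x y. x \<in> carrier L \<Longrightarrow> y \<in> J \<Longrightarrow> \<lbrakk>x,y\<rbrakk>\<^bsub>L\<^esub> \<in> J"
  shows "lie_ideal K L J"
proof -
  have "\<ominus>\<^bsub>L\<^esub> x \<in> J" if "x \<in> J" for x
  proof -
    have "(\<ominus>\<one>) \<odot>\<^bsub>L\<^esub> x = \<ominus>\<^bsub>L\<^esub> x" using that assms(1) by (subst smult_l_minus) auto
    then show ?thesis using smult[of "\<ominus>\<one>" x] that by simp
  qed
  then show ?thesis
    unfolding lie_ideal_def using assms by (auto intro!: submoduleI)
qed

lemma lie_idealD:
  assumes "lie_ideal K L J"
  shows "J \<subseteq> carrier L" "\<zero>\<^bsub>L\<^esub> \<in> J"
    and "\<And>x y. x \<in> J \<Longrightarrow> y \<in> J \<Longrightarrow> x \<oplus>\<^bsub>L\<^esub> y \<in> J"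
    and "\<And>c x. c \<in> carrier K \<Longrightarrow> x \<in> J \<Longrightarrow> c \<odot>\<^bsub>L\<^esub> x \<in> J"
    and "\<And>x y. x \<in> carrier L \<Longrightarrow> y \<in> J \<Longrightarrow> \<lbrakk>x,y\<rbrakk>\<^bsub>L\<^esub> \<in> J"
    and "\<And>x y. x \<in> carrier L \<Longrightarrow> y \<in> J \<Longrightarrow> \<lbrakk>y,x\<rbrakk>\<^bsub>L\<^esub> \<in> J"
    and "\<And>x. x \<in> J \<Longrightarrow> \<ominus>\<^bsub>L\<^esub> x \<in> J"
proof -
  have S: "submodule J K L" using assms by (simp add: lie_ideal_def)
  note E = submoduleE[OF S]
  show sub: "J \<subseteq> carrier L" by (rule E)
  show "\<zero>\<^bsub>L\<^esub> \<in> J" using S subgroup.one_closed[of J "add_monoid L"] by (simp add: submodule_def)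
  show "x \<oplus>\<^bsub>L\<^esub> y \<in> J" if "x \<in> J" "y \<in> J" for x y using that E by blast
  show smult: "c \<odot>\<^bsub>L\<^esub> x \<in> J" if "c \<in> carrier K" "x \<in> J" for c x using that E by blast
  show b: "\<lbrakk>x,y\<rbrakk>\<^bsub>L\<^esub> \<in> J" if "x \<in> carrier L" "y \<in> J" for x y
    using that assms by (simp add: lie_ideal_def)
  show "\<lbrakk>y,x\<rbrakk>\<^bsub>L\<^esub> \<in> J" if "x \<in> carrier L" "y \<in> J" for x y
    using that sub b smult by (subst bracket_swap) auto
  show "\<ominus>\<^bsub>L\<^esub> x \<in> J" if "x \<in> J" for x using that E by blast
qed

lemma submodule_finsum:
  assumes J: "submodule J K L" and "finite S" "f \<in> S \<rightarrow> J"
  shows "finsum L f S \<in> J"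
  using assms(2,3)
proof induction
  case empty
  then show ?case using J subgroup.one_closed[of J "add_monoid L"] by (simp add: submodule_def)
next
  case (insert i S)
  then show ?case using submoduleE(1)[OF J] submoduleE(5)[OF J] by (auto simp: Pi_iff subset_iff)
qed

lemma bracket_finsum:
  assumes "finite S" "finite T" and f: "f \<in> S \<rightarrow> carrier L" and g: "g \<in> T \<rightarrow> carrier L"
  shows "\<lbrakk>finsum L f S,finsum L g T\<rbrakk>\<^bsub>L\<^esub> = (\<Oplus>\<^bsub>L\<^esub>p\<in>S \<times> T. \<lbrakk>f (fst p),g (snd p)\<rbrakk>\<^bsub>L\<^esub>)"
proof -
  have "\<lbrakk>finsum L f S,finsum L g T\<rbrakk>\<^bsub>L\<^esub> = (\<Oplus>\<^bsub>L\<^esub>i\<in>S. \<lbrakk>f i,finsum L g T\<rbrakk>\<^bsub>L\<^esub>)"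
    using assms by (intro M.finsum_additive_map[where h = "\<lambda>x. \<lbrakk>x,finsum L g T\<rbrakk>\<^bsub>L\<^esub>"])
      (auto simp: bracket_add_left M.abelian_group_axioms intro!: bracket_closed)
  also have "\<dots> = (\<Oplus>\<^bsub>L\<^esub>i\<in>S. \<Oplus>\<^bsub>L\<^esub>j\<in>T. \<lbrakk>f i,g j\<rbrakk>\<^bsub>L\<^esub>)"
  proof (rule M.finsum_cong')
    show "\<lbrakk>f i,finsum L g T\<rbrakk>\<^bsub>L\<^esub> = (\<Oplus>\<^bsub>L\<^esub>j\<in>T. \<lbrakk>f i,g j\<rbrakk>\<^bsub>L\<^esub>)" if "i \<in> S" for i
      using assms that by (intro M.finsum_additive_map[where h = "\<lambda>x. \<lbrakk>f i,x\<rbrakk>\<^bsub>L\<^esub>"])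
        (auto simp: bracket_add_right M.abelian_group_axioms Pi_iff intro!: bracket_closed)
  qed (use assms in \<open>auto intro!: M.finsum_closed bracket_closed\<close>)
  also have "\<dots> = (\<Oplus>\<^bsub>L\<^esub>p\<in>S \<times> T. \<lbrakk>f (fst p),g (snd p)\<rbrakk>\<^bsub>L\<^esub>)"
    using assms by (subst M.finsum_Times) (auto intro!: bracket_closed)
  finally show ?thesis .
qed

end

section \<open>Homogeneous components and diagonal operators\<close>

locale graded_lie = plain_lie_algebra K L + Q: comm_group Q
  for K :: "'k ring" (structure) and L :: "('k, 'a) lie_algebra" (structure)
    and Q :: "'q monoid" (structure) +
  fixes G :: "'q \<Rightarrow> 'a set"
  assumes grading: "graded_lie_algebra K Q L G"
begin

lemma comp_submodule: "\<alpha> \<in> carrier Q \<Longrightarrow> submodule (G \<alpha>) K L"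
  and direct: "is_direct_sum L (carrier Q) G (carrier L)"
  and bracket_comp: "\<alpha> \<in> carrier Q \<Longrightarrow> \<beta> \<in> carrier Q \<Longrightarrow> x \<in> G \<alpha> \<Longrightarrow> y \<in> G \<beta>
    \<Longrightarrow> \<lbrakk>x,y\<rbrakk>\<^bsub>L\<^esub> \<in> G (\<alpha> \<otimes>\<^bsub>Q\<^esub> \<beta>)"
  using grading by (auto simp: graded_lie_algebra_def)

lemma comp_closed: "\<alpha> \<in> carrier Q \<Longrightarrow> x \<in> G \<alpha> \<Longrightarrow> x \<in> carrier L"
  using submoduleE(1)[OF comp_submodule] by blast

lemma comp_zero: "\<alpha> \<in> carrier Q \<Longrightarrow> \<zero>\<^bsub>L\<^esub> \<in> G \<alpha>"
  using subgroup.one_closed[of "G \<alpha>" "add_monoid L"] comp_submodule by (simp add: submodule_def)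

lemma comp_add: "\<alpha> \<in> carrier Q \<Longrightarrow> x \<in> G \<alpha> \<Longrightarrow> y \<in> G \<alpha> \<Longrightarrow> x \<oplus>\<^bsub>L\<^esub> y \<in> G \<alpha>"
  using submoduleE(5)[OF comp_submodule] by blast

lemma comp_smult: "\<alpha> \<in> carrier Q \<Longrightarrow> c \<in> carrier K \<Longrightarrow> x \<in> G \<alpha> \<Longrightarrow> c \<odot>\<^bsub>L\<^esub> x \<in> G \<alpha>"
  using submoduleE(4)[OF comp_submodule] by blast

text \<open>
  A family of homogeneous summands of \<open>x\<close> indexed by all degrees.  The set \<open>S\<close> is any finite set outside
  which the family vanishes, so that two families can be compared over the union of their index sets.
\<close>
definition decomposition :: "('q \<Rightarrow> 'a) \<Rightarrow> 'a \<Rightarrow> bool" where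
  "decomposition c x \<longleftrightarrow> c \<in> (\<Pi> \<alpha>\<in>carrier Q. G \<alpha>) \<and>
     (\<exists>S. finite S \<and> S \<subseteq> carrier Q \<and> (\<forall>\<alpha> \<in> carrier Q - S. c \<alpha> = \<zero>\<^bsub>L\<^esub>) \<and> x = finsum L c S)"

lemma decomposition_finsum:
  assumes c: "c \<in> (\<Pi> \<alpha>\<in>carrier Q. G \<alpha>)" and S: "finite S" "S \<subseteq> carrier Q"
    and T: "finite T" "T \<subseteq> carrier Q"
    and z: "\<forall>\<alpha> \<in> carrier Q - S. c \<alpha> = \<zero>\<^bsub>L\<^esub>" "\<forall>\<alpha> \<in> carrier Q - T. c \<alpha> = \<zero>\<^bsub>L\<^esub>"
  shows "finsum L c S = finsum L c T"
proof -
  have "c \<in> A \<rightarrow> carrier L" if "A \<subseteq> carrier Q" for A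
    using c that comp_closed by (auto simp: Pi_iff)
  then show ?thesis using assms by (intro M.add.finprod_mono_neutral_cong) auto
qed

lemma decomposition_add:
  assumes "decomposition c x" "decomposition d y"
  shows "decomposition (\<lambda>\<alpha>. c \<alpha> \<oplus>\<^bsub>L\<^esub> d \<alpha>) (x \<oplus>\<^bsub>L\<^esub> y)"
proof -
  obtain S where c: "c \<in> (\<Pi> \<alpha>\<in>carrier Q. G \<alpha>)" and S: "finite S" "S \<subseteq> carrier Q"
    "\<forall>\<alpha> \<in> carrier Q - S. c \<alpha> = \<zero>\<^bsub>L\<^esub>" "x = finsum L c S"
    using assms by (auto simp: decomposition_def)
  obtain T where d: "d \<in> (\<Pi> \<alpha>\<in>carrier Q. G \<alpha>)" and T: "finite T" "T \<subseteq> carrier Q"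
    "\<forall>\<alpha> \<in> carrier Q - T. d \<alpha> = \<zero>\<^bsub>L\<^esub>" "y = finsum L d T"
    using assms by (auto simp: decomposition_def)
  have "x = finsum L c (S \<union> T)"
    unfolding S(4) using c S T by (intro decomposition_finsum) auto
  moreover have "y = finsum L d (S \<union> T)"
    unfolding T(4) using d S T by (intro decomposition_finsum) auto
  moreover have "c \<in> S \<union> T \<rightarrow> carrier L" "d \<in> S \<union> T \<rightarrow> carrier L"
    using c d S T comp_closed by (auto simp: Pi_iff subset_iff)
  ultimately have "x \<oplus>\<^bsub>L\<^esub> y = (\<Oplus>\<^bsub>L\<^esub>\<alpha>\<in>S \<union> T. c \<alpha> \<oplus>\<^bsub>L\<^esub> d \<alpha>)"
    by (simp add: M.finsum_addf)
  then show ?thesis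
    unfolding decomposition_def using c d S T comp_add
    by (intro conjI exI[of _ "S \<union> T"]) (auto simp: Pi_iff)
qed

lemma decomposition_smult:
  assumes "decomposition c x" and a: "a \<in> carrier K"
  shows "decomposition (\<lambda>\<alpha>. a \<odot>\<^bsub>L\<^esub> c \<alpha>) (a \<odot>\<^bsub>L\<^esub> x)"
proof -
  obtain S where c: "c \<in> (\<Pi> \<alpha>\<in>carrier Q. G \<alpha>)" and S: "finite S" "S \<subseteq> carrier Q"
    "\<forall>\<alpha> \<in> carrier Q - S. c \<alpha> = \<zero>\<^bsub>L\<^esub>" "x = finsum L c S"
    using assms by (auto simp: decomposition_def)
  have "c \<in> S \<rightarrow> carrier L" using c S comp_closed by (auto simp: Pi_iff)
  then have "a \<odot>\<^bsub>L\<^esub> x = (\<Oplus>\<^bsub>L\<^esub>\<alpha>\<in>S. a \<odot>\<^bsub>L\<^esub> c \<alpha>)"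
    using S a by (simp add: finsum_smult_ldistr)
  then show ?thesis
    unfolding decomposition_def using c S a comp_smult
    by (intro conjI exI[of _ S]) (auto simp: Pi_iff)
qed

lemma smult_commute:
  assumes "a \<in> carrier K" "b \<in> carrier K" "x \<in> carrier L"
  shows "a \<odot>\<^bsub>L\<^esub> (b \<odot>\<^bsub>L\<^esub> x) = b \<odot>\<^bsub>L\<^esub> (a \<odot>\<^bsub>L\<^esub> x)"
  using assms by (metis smult_assoc1 m_comm)

lemma decomposition_restrict:
  assumes "finite S" "S \<subseteq> carrier Q" "f \<in> (\<Pi> \<alpha>\<in>S. G \<alpha>)"
  shows "decomposition (\<lambda>\<alpha>. if \<alpha> \<in> S then f \<alpha> else \<zero>\<^bsub>L\<^esub>) (finsum L f S)"
proof -
  have "finsum L f S = (\<Oplus>\<^bsub>L\<^esub>\<alpha>\<in>S. if \<alpha> \<in> S then f \<alpha> else \<zero>\<^bsub>L\<^esub>)"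
    using assms comp_closed by (intro M.finsum_cong') (auto simp: Pi_iff subset_iff)
  then show ?thesis
    unfolding decomposition_def using assms comp_zero
    by (intro conjI exI[of _ S]) (auto simp: Pi_iff)
qed

lemma decomposition_unique:
  assumes "decomposition c x" "decomposition d x" and \<alpha>: "\<alpha> \<in> carrier Q" and x: "x \<in> carrier L"
  shows "c \<alpha> = d \<alpha>"
proof -
  have minus: "(\<ominus>\<one>) \<odot>\<^bsub>L\<^esub> y = \<ominus>\<^bsub>L\<^esub> y" if "y \<in> carrier L" for y
    using that by (simp add: smult_l_minus)
  let ?e = "\<lambda>\<alpha>. c \<alpha> \<oplus>\<^bsub>L\<^esub> (\<ominus>\<one>) \<odot>\<^bsub>L\<^esub> d \<alpha>"
  have "decomposition ?e (x \<oplus>\<^bsub>L\<^esub> (\<ominus>\<one>) \<odot>\<^bsub>L\<^esub> x)"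
    using assms by (intro decomposition_add decomposition_smult) auto
  then have "decomposition ?e \<zero>\<^bsub>L\<^esub>"
    using x by (simp add: minus M.r_neg)
  then obtain S where e: "?e \<in> (\<Pi> \<alpha>\<in>carrier Q. G \<alpha>)" and S: "finite S" "S \<subseteq> carrier Q"
    "\<forall>\<alpha> \<in> carrier Q - S. ?e \<alpha> = \<zero>\<^bsub>L\<^esub>" "\<zero>\<^bsub>L\<^esub> = finsum L ?e S"
    by (auto simp: decomposition_def)
  have e': "?e \<in> (\<Pi> \<alpha>\<in>S. G \<alpha>)" using e S(2) by blast
  have "\<forall>i\<in>S. ?e i = \<zero>\<^bsub>L\<^esub>"
    using direct S(1,2) e' S(4)[symmetric] unfolding is_direct_sum_def by blast
  then have "?e \<alpha> = \<zero>\<^bsub>L\<^esub>" using S(3) \<alpha> by blast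
  moreover have "c \<alpha> \<in> carrier L" "d \<alpha> \<in> carrier L"
    using assms comp_closed[OF \<alpha>] by (auto simp: decomposition_def)
  ultimately show ?thesis
    by (metis M.a_inv_closed M.minus_equality M.minus_minus minus)
qed

definition component :: "'q \<Rightarrow> 'a \<Rightarrow> 'a" where
  "component \<alpha> x = (SOME c. decomposition c x) \<alpha>"

definition supp :: "'a \<Rightarrow> 'q set" where
  "supp x = {\<alpha> \<in> carrier Q. component \<alpha> x \<noteq> \<zero>\<^bsub>L\<^esub>}"

lemma decomposition_component:
  assumes "x \<in> carrier L"
  shows "decomposition (\<lambda>\<alpha>. component \<alpha> x) x"
proof -
  have "x \<in> sum_of L (carrier Q) G" using assms direct by (simp add: is_direct_sum_def)
  then have "\<exists>c. decomposition c x"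
    unfolding sum_of_def using decomposition_restrict by blast
  then show ?thesis unfolding component_def by (rule someI_ex)
qed

lemma component_eqI:
  assumes "decomposition c x" "x \<in> carrier L" "\<alpha> \<in> carrier Q"
  shows "component \<alpha> x = c \<alpha>"
  using assms decomposition_component decomposition_unique by blast

lemma component_in: "x \<in> carrier L \<Longrightarrow> \<alpha> \<in> carrier Q \<Longrightarrow> component \<alpha> x \<in> G \<alpha>"
  using decomposition_component by (auto simp: decomposition_def)

lemma component_closed [simp]: "x \<in> carrier L \<Longrightarrow> \<alpha> \<in> carrier Q \<Longrightarrow> component \<alpha> x \<in> carrier L"
  using component_in comp_closed by blast

lemma finite_supp: "x \<in> carrier L \<Longrightarrow> finite (supp x)"
  using decomposition_component[of x] unfolding decomposition_def supp_def
  by (auto elim!: rev_finite_subset)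

lemma supp_subset: "supp x \<subseteq> carrier Q"
  by (auto simp: supp_def)

lemma suppD: "\<alpha> \<in> supp x \<Longrightarrow> \<alpha> \<in> carrier Q"
  by (simp add: supp_def)

lemma sum_components:
  assumes x: "x \<in> carrier L" and S: "finite S" "supp x \<subseteq> S" "S \<subseteq> carrier Q"
  shows "x = (\<Oplus>\<^bsub>L\<^esub>\<alpha>\<in>S. component \<alpha> x)"
proof -
  obtain T where T: "finite T" "T \<subseteq> carrier Q"
    "\<forall>\<alpha> \<in> carrier Q - T. component \<alpha> x = \<zero>\<^bsub>L\<^esub>" "x = (\<Oplus>\<^bsub>L\<^esub>\<alpha>\<in>T. component \<alpha> x)"
    using decomposition_component[OF x] unfolding decomposition_def by blast
  have "(\<Oplus>\<^bsub>L\<^esub>\<alpha>\<in>T. component \<alpha> x) = (\<Oplus>\<^bsub>L\<^esub>\<alpha>\<in>S. component \<alpha> x)"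
    using T S component_in[OF x] by (intro decomposition_finsum) (auto simp: supp_def)
  then show ?thesis using T(4) by simp
qed

lemma component_add:
  "x \<in> carrier L \<Longrightarrow> y \<in> carrier L \<Longrightarrow> \<alpha> \<in> carrier Q
    \<Longrightarrow> component \<alpha> (x \<oplus>\<^bsub>L\<^esub> y) = component \<alpha> x \<oplus>\<^bsub>L\<^esub> component \<alpha> y"
  by (intro component_eqI[where c = "\<lambda>\<alpha>. component \<alpha> x \<oplus>\<^bsub>L\<^esub> component \<alpha> y"]
      decomposition_add decomposition_component) auto

lemma component_smult:
  "x \<in> carrier L \<Longrightarrow> c \<in> carrier K \<Longrightarrow> \<alpha> \<in> carrier Q
    \<Longrightarrow> component \<alpha> (c \<odot>\<^bsub>L\<^esub> x) = c \<odot>\<^bsub>L\<^esub> component \<alpha> x"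
  by (intro component_eqI[where c = "\<lambda>\<alpha>. c \<odot>\<^bsub>L\<^esub> component \<alpha> x"]
      decomposition_smult decomposition_component) auto

lemma component_finsum:
  assumes "finite S" "S \<subseteq> carrier Q" "f \<in> (\<Pi> \<alpha>\<in>S. G \<alpha>)" "\<alpha> \<in> carrier Q"
  shows "component \<alpha> (finsum L f S) = (if \<alpha> \<in> S then f \<alpha> else \<zero>\<^bsub>L\<^esub>)"
  using assms comp_closed
  by (intro component_eqI[OF decomposition_restrict]) (auto intro!: M.finsum_closed)

lemma component_homogeneous:
  assumes "\<beta> \<in> carrier Q" "x \<in> G \<beta>" "\<alpha> \<in> carrier Q"
  shows "component \<alpha> x = (if \<alpha> = \<beta> then x else \<zero>\<^bsub>L\<^esub>)"
  using component_finsum[of "{\<beta>}" "\<lambda>_. x" \<alpha>] assms comp_closed by (auto simp: split: if_splits)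

lemma component_zero: "\<alpha> \<in> carrier Q \<Longrightarrow> component \<alpha> \<zero>\<^bsub>L\<^esub> = \<zero>\<^bsub>L\<^esub>"
  using component_homogeneous[of \<alpha> "\<zero>\<^bsub>L\<^esub>" \<alpha>] comp_zero by simp

lemma component_ext:
  assumes "x \<in> carrier L" "y \<in> carrier L" "\<And>\<alpha>. \<alpha> \<in> carrier Q \<Longrightarrow> component \<alpha> x = component \<alpha> y"
  shows "x = y"
proof -
  have "supp x = supp y" using assms(3) by (auto simp: supp_def)
  then show ?thesis
    using sum_components[OF assms(1) finite_supp[OF assms(1)] order.refl supp_subset]
      sum_components[OF assms(2) finite_supp[OF assms(2)] order.refl supp_subset] assms supp_subset
      component_in[OF assms(1)]
      M.finsum_cong'[of "supp x" "supp y" "\<lambda>\<alpha>. component \<alpha> y" "\<lambda>\<alpha>. component \<alpha> x"]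
    by (auto simp: subset_iff Pi_iff)
qed

lemma component_additive_finsum:
  assumes "finite S" "f \<in> S \<rightarrow> carrier L" "\<alpha> \<in> carrier Q"
  shows "component \<alpha> (finsum L f S) = (\<Oplus>\<^bsub>L\<^esub>i\<in>S. component \<alpha> (f i))"
  using assms by (intro M.finsum_additive_map) (auto simp: component_add M.abelian_group_axioms)

text \<open>
  The index sets may be larger than the supports, so that brackets of elements with different
  supports, such as those of an element and its image under a diagonal operator, can be compared
  summand by summand.
\<close>
lemma component_bracket:
  assumes x: "x \<in> carrier L" and y: "y \<in> carrier L"
    and S: "finite S" "supp x \<subseteq> S" "S \<subseteq> carrier Q" and T: "finite T" "supp y \<subseteq> T" "T \<subseteq> carrier Q"
    and \<gamma>: "\<gamma> \<in> carrier Q"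
  shows "component \<gamma> \<lbrakk>x,y\<rbrakk>\<^bsub>L\<^esub> =
    (\<Oplus>\<^bsub>L\<^esub>p \<in> {p \<in> S \<times> T. fst p \<otimes>\<^bsub>Q\<^esub> snd p = \<gamma>}. \<lbrakk>component (fst p) x,component (snd p) y\<rbrakk>\<^bsub>L\<^esub>)"
proof -
  let ?b = "\<lambda>p. \<lbrakk>component (fst p) x,component (snd p) y\<rbrakk>\<^bsub>L\<^esub>"
  have c: "?b p \<in> carrier L" "component \<gamma> (?b p) = (if fst p \<otimes>\<^bsub>Q\<^esub> snd p = \<gamma> then ?b p else \<zero>\<^bsub>L\<^esub>)"
    if "p \<in> S \<times> T" for p
  proof -
    have p: "fst p \<in> carrier Q" "snd p \<in> carrier Q" using that S T by auto
    then show "?b p \<in> carrier L" using x y by (simp add: bracket_closed)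
    have "?b p \<in> G (fst p \<otimes>\<^bsub>Q\<^esub> snd p)"
      using p x y by (intro bracket_comp component_in)
    then show "component \<gamma> (?b p) = (if fst p \<otimes>\<^bsub>Q\<^esub> snd p = \<gamma> then ?b p else \<zero>\<^bsub>L\<^esub>)"
      using p \<gamma> by (subst component_homogeneous[of "fst p \<otimes>\<^bsub>Q\<^esub> snd p"]) auto
  qed
  have "\<lbrakk>x,y\<rbrakk>\<^bsub>L\<^esub> = finsum L ?b (S \<times> T)"
    using bracket_finsum[of S T "\<lambda>\<alpha>. component \<alpha> x" "\<lambda>\<alpha>. component \<alpha> y"]
      sum_components[OF x S] sum_components[OF y T] S T x y
    by (auto simp: Pi_iff subset_iff)
  then have "component \<gamma> \<lbrakk>x,y\<rbrakk>\<^bsub>L\<^esub> = (\<Oplus>\<^bsub>L\<^esub>p\<in>S \<times> T. component \<gamma> (?b p))"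
    using S T c \<gamma> by (simp add: component_additive_finsum)
  also have "\<dots> = finsum L ?b {p \<in> S \<times> T. fst p \<otimes>\<^bsub>Q\<^esub> snd p = \<gamma>}"
    using S T c by (intro M.add.finprod_mono_neutral_cong_right) auto
  finally show ?thesis .
qed

text \<open>
  The operator that acts on the component of degree \<open>\<alpha>\<close> as the scalar \<open>f \<alpha>\<close>.  Both the automorphisms
  given by characters and the projections onto sums of components are of this form, and identities
  between them reduce to pointwise identities between the functions \<open>f\<close>.
\<close>
definition diag :: "('q \<Rightarrow> 'k) \<Rightarrow> 'a \<Rightarrow> 'a" where
  "diag f x = (\<Oplus>\<^bsub>L\<^esub>\<alpha>\<in>supp x. f \<alpha> \<odot>\<^bsub>L\<^esub> component \<alpha> x)"

lemma diag_summand: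
  assumes "f \<in> carrier Q \<rightarrow> carrier K" "x \<in> carrier L"
  shows "(\<lambda>\<alpha>. f \<alpha> \<odot>\<^bsub>L\<^esub> component \<alpha> x) \<in> (\<Pi> \<alpha>\<in>supp x. G \<alpha>)"
  using assms component_in comp_smult by (auto simp: supp_def Pi_iff)

lemma diag_closed:
  assumes "f \<in> carrier Q \<rightarrow> carrier K" "x \<in> carrier L"
  shows "diag f x \<in> carrier L"
  unfolding diag_def
  using diag_summand[OF assms] comp_closed[OF suppD] by (intro M.finsum_closed) (auto simp: Pi_iff)

lemma component_diag:
  assumes f: "f \<in> carrier Q \<rightarrow> carrier K" and x: "x \<in> carrier L" and \<alpha>: "\<alpha> \<in> carrier Q"
  shows "component \<alpha> (diag f x) = f \<alpha> \<odot>\<^bsub>L\<^esub> component \<alpha> x"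
proof -
  have "f \<alpha> \<in> carrier K" using f \<alpha> by auto
  then show ?thesis
    unfolding diag_def using component_finsum[OF finite_supp[OF x] supp_subset diag_summand[OF f x] \<alpha>] \<alpha>
    by (auto simp: supp_def)
qed

lemma supp_diag:
  assumes f: "f \<in> carrier Q \<rightarrow> carrier K" and x: "x \<in> carrier L"
  shows "supp (diag f x) \<subseteq> supp x"
  using assms by (auto simp: supp_def component_diag Pi_iff)

lemma diag_eqI:
  assumes "f \<in> carrier Q \<rightarrow> carrier K" "x \<in> carrier L" "y \<in> carrier L"
    and "\<And>\<alpha>. \<alpha> \<in> carrier Q \<Longrightarrow> f \<alpha> \<odot>\<^bsub>L\<^esub> component \<alpha> x = component \<alpha> y"
  shows "diag f x = y"
  by (rule component_ext) (simp_all add: component_diag diag_closed assms)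

lemma diag_add:
  assumes f: "f \<in> carrier Q \<rightarrow> carrier K" and "x \<in> carrier L" "y \<in> carrier L"
  shows "diag f (x \<oplus>\<^bsub>L\<^esub> y) = diag f x \<oplus>\<^bsub>L\<^esub> diag f y"
  using assms by (intro diag_eqI)
    (auto simp: component_add component_diag diag_closed smult_r_distr Pi_iff)

lemma diag_smult:
  assumes f: "f \<in> carrier Q \<rightarrow> carrier K" and "x \<in> carrier L" "c \<in> carrier K"
  shows "diag f (c \<odot>\<^bsub>L\<^esub> x) = c \<odot>\<^bsub>L\<^esub> diag f x"
proof (rule diag_eqI[OF f])
  fix \<alpha> assume \<alpha>: "\<alpha> \<in> carrier Q"
  then have "f \<alpha> \<in> carrier K" using f by auto
  then show "f \<alpha> \<odot>\<^bsub>L\<^esub> component \<alpha> (c \<odot>\<^bsub>L\<^esub> x) = component \<alpha> (c \<odot>\<^bsub>L\<^esub> diag f x)"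
    using assms(2,3) \<alpha>
    by (simp add: component_smult[OF _ assms(3)] component_diag[OF f] diag_closed[OF f]
        smult_commute[OF assms(3)])
qed (use assms diag_closed in auto)

lemma diag_diag:
  assumes f: "f \<in> carrier Q \<rightarrow> carrier K" and g: "g \<in> carrier Q \<rightarrow> carrier K" and "x \<in> carrier L"
  shows "diag f (diag g x) = diag (\<lambda>\<alpha>. f \<alpha> \<otimes> g \<alpha>) x"
  using assms by (intro diag_eqI)
    (auto simp: component_diag diag_closed Pi_iff smult_assoc1)

lemma diag_cong:
  assumes "f \<in> carrier Q \<rightarrow> carrier K" "\<And>\<alpha>. \<alpha> \<in> carrier Q \<Longrightarrow> f \<alpha> = g \<alpha>" "x \<in> carrier L"
  shows "diag f x = diag g x"
proof -
  have "g \<in> carrier Q \<rightarrow> carrier K" using assms(1,2) by (auto simp: Pi_iff)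
  then show ?thesis using assms by (intro diag_eqI) (auto simp: component_diag diag_closed)
qed

lemma diag_sum:
  assumes f: "f \<in> carrier Q \<rightarrow> carrier K" and g: "g \<in> carrier Q \<rightarrow> carrier K" and "x \<in> carrier L"
  shows "diag (\<lambda>\<alpha>. f \<alpha> \<oplus> g \<alpha>) x = diag f x \<oplus>\<^bsub>L\<^esub> diag g x"
  using assms by (intro diag_eqI)
    (auto simp: component_diag component_add diag_closed Pi_iff smult_l_distr)

lemma diag_scale:
  assumes f: "f \<in> carrier Q \<rightarrow> carrier K" and "c \<in> carrier K" "x \<in> carrier L"
  shows "diag (\<lambda>\<alpha>. c \<otimes> f \<alpha>) x = c \<odot>\<^bsub>L\<^esub> diag f x"
  using assms by (intro diag_eqI)
    (auto simp: component_diag component_smult diag_closed Pi_iff smult_assoc1)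

lemma diag_zero:
  assumes "\<And>\<alpha>. \<alpha> \<in> carrier Q \<Longrightarrow> f \<alpha> = \<zero>" "x \<in> carrier L"
  shows "diag f x = \<zero>\<^bsub>L\<^esub>"
  using assms by (intro diag_eqI) (auto simp: component_zero)

lemma diag_bracket:
  assumes f: "f \<in> carrier Q \<rightarrow> carrier K"
    and mult: "\<And>\<alpha> \<beta>. \<alpha> \<in> carrier Q \<Longrightarrow> \<beta> \<in> carrier Q \<Longrightarrow> f (\<alpha> \<otimes>\<^bsub>Q\<^esub> \<beta>) = f \<alpha> \<otimes> f \<beta>"
    and x: "x \<in> carrier L" and y: "y \<in> carrier L"
  shows "diag f \<lbrakk>x,y\<rbrakk>\<^bsub>L\<^esub> = \<lbrakk>diag f x,diag f y\<rbrakk>\<^bsub>L\<^esub>"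
proof (rule diag_eqI[OF f])
  fix \<gamma> assume \<gamma>: "\<gamma> \<in> carrier Q"
  let ?P = "{p \<in> supp x \<times> supp y. fst p \<otimes>\<^bsub>Q\<^esub> snd p = \<gamma>}"
  have fin: "finite ?P" using finite_supp x y by simp
  have mem: "fst p \<in> carrier Q" "snd p \<in> carrier Q" "fst p \<otimes>\<^bsub>Q\<^esub> snd p = \<gamma>" if "p \<in> ?P" for p
    using that suppD by auto
  have "component \<gamma> \<lbrakk>diag f x,diag f y\<rbrakk>\<^bsub>L\<^esub> =
      (\<Oplus>\<^bsub>L\<^esub>p\<in>?P. \<lbrakk>component (fst p) (diag f x),component (snd p) (diag f y)\<rbrakk>\<^bsub>L\<^esub>)"
    by (rule component_bracket[OF diag_closed[OF f x] diag_closed[OF f y] finite_supp[OF x]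
          supp_diag[OF f x] supp_subset finite_supp[OF y] supp_diag[OF f y] supp_subset \<gamma>])
  also have "\<dots> = (\<Oplus>\<^bsub>L\<^esub>p\<in>?P. f \<gamma> \<odot>\<^bsub>L\<^esub> \<lbrakk>component (fst p) x,component (snd p) y\<rbrakk>\<^bsub>L\<^esub>)"
  proof (rule M.finsum_cong')
    fix p assume p: "p \<in> ?P"
    have "f (fst p) \<in> carrier K" "f (snd p) \<in> carrier K" using f mem[OF p] by auto
    then show "\<lbrakk>component (fst p) (diag f x),component (snd p) (diag f y)\<rbrakk>\<^bsub>L\<^esub> =
        f \<gamma> \<odot>\<^bsub>L\<^esub> \<lbrakk>component (fst p) x,component (snd p) y\<rbrakk>\<^bsub>L\<^esub>"
      using mem[OF p] mult[OF mem(1,2)[OF p]] f x y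
      by (simp add: component_diag bracket_smult_left bracket_smult_right bracket_closed smult_assoc1
          smult_commute[of "f (snd p)" "f (fst p)"])
  qed (use f x y \<gamma> in \<open>auto simp: Pi_iff dest: suppD intro!: smult_closed bracket_closed\<close>)
  also have "\<dots> = f \<gamma> \<odot>\<^bsub>L\<^esub> (\<Oplus>\<^bsub>L\<^esub>p\<in>?P. \<lbrakk>component (fst p) x,component (snd p) y\<rbrakk>\<^bsub>L\<^esub>)"
    using fin f x y \<gamma> by (intro finsum_smult_ldistr[symmetric])
      (auto simp: Pi_iff dest: suppD intro!: bracket_closed)
  also have "\<dots> = f \<gamma> \<odot>\<^bsub>L\<^esub> component \<gamma> \<lbrakk>x,y\<rbrakk>\<^bsub>L\<^esub>"
    by (subst component_bracket[OF x y finite_supp[OF x] order.refl supp_subset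
          finite_supp[OF y] order.refl supp_subset \<gamma>]) simp
  finally show "f \<gamma> \<odot>\<^bsub>L\<^esub> component \<gamma> \<lbrakk>x,y\<rbrakk>\<^bsub>L\<^esub> = component \<gamma> \<lbrakk>diag f x,diag f y\<rbrakk>\<^bsub>L\<^esub>" by simp
qed (use assms in \<open>auto simp: bracket_closed diag_closed\<close>)

text \<open>The largest graded ideal contained in \<open>J\<close>.\<close>
lemma homogeneous_core_is_graded_ideal:
  assumes J: "lie_ideal K L J"
  shows "graded_ideal K Q L G {x \<in> carrier L. \<forall>\<alpha> \<in> carrier Q. component \<alpha> x \<in> J}"
    (is "graded_ideal K Q L G ?C")
proof -
  note JD = lie_idealD[OF J]
  have ideal: "lie_ideal K L ?C"
  proof (rule lie_idealI)
    fix x y assume x: "x \<in> carrier L" and y: "y \<in> ?C"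
    have "component \<gamma> \<lbrakk>x,y\<rbrakk>\<^bsub>L\<^esub> \<in> J" if \<gamma>: "\<gamma> \<in> carrier Q" for \<gamma>
    proof -
      have "y \<in> carrier L" using y by blast
      note yL = this
      have "(\<Oplus>\<^bsub>L\<^esub>p\<in>{p \<in> supp x \<times> supp y. fst p \<otimes>\<^bsub>Q\<^esub> snd p = \<gamma>}.
          \<lbrakk>component (fst p) x,component (snd p) y\<rbrakk>\<^bsub>L\<^esub>) \<in> J"
        using J x y finite_supp[OF x] finite_supp[OF yL] suppD
        by (intro submodule_finsum) (auto simp: lie_ideal_def)
      then show ?thesis
        using component_bracket[OF x yL finite_supp[OF x] order.refl supp_subset
          finite_supp[OF yL] order.refl supp_subset \<gamma>] by simp
    qed
    then show "\<lbrakk>x,y\<rbrakk>\<^bsub>L\<^esub> \<in> ?C" using x y by (simp add: bracket_closed)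
  qed (use JD in \<open>auto simp: component_zero component_add component_smult\<close>)
  have "is_direct_sum L (carrier Q) (\<lambda>\<alpha>. ?C \<inter> G \<alpha>) ?C"
    unfolding is_direct_sum_def
  proof (intro conjI allI impI)
    show "?C = sum_of L (carrier Q) (\<lambda>\<alpha>. ?C \<inter> G \<alpha>)"
    proof
      show "?C \<subseteq> sum_of L (carrier Q) (\<lambda>\<alpha>. ?C \<inter> G \<alpha>)"
      proof
        fix x assume x: "x \<in> ?C"
        then have xL: "x \<in> carrier L" by blast
        have "(\<lambda>\<alpha>. component \<alpha> x) \<in> (\<Pi> \<alpha>\<in>supp x. ?C \<inter> G \<alpha>)"
          using x xL JD(2) component_in[OF xL] suppD
          by (auto simp: component_homogeneous[OF _ component_in[OF xL]])
        then show "x \<in> sum_of L (carrier Q) (\<lambda>\<alpha>. ?C \<inter> G \<alpha>)"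
          unfolding sum_of_def
          using sum_components[OF xL finite_supp[OF xL] order.refl supp_subset] finite_supp[OF xL] supp_subset
          by blast
      qed
      show "sum_of L (carrier Q) (\<lambda>\<alpha>. ?C \<inter> G \<alpha>) \<subseteq> ?C"
      proof
        fix x assume "x \<in> sum_of L (carrier Q) (\<lambda>\<alpha>. ?C \<inter> G \<alpha>)"
        then obtain f S where "x = finsum L f S" "finite S" "f \<in> (\<Pi> \<alpha>\<in>S. ?C \<inter> G \<alpha>)"
          unfolding sum_of_def by blast
        moreover from this(3) have "f \<in> S \<rightarrow> ?C" by blast
        ultimately show "x \<in> ?C"
          using submodule_finsum[of ?C S f] ideal by (simp add: lie_ideal_def)
      qed
    qed
    fix S f assume "finite S \<and> S \<subseteq> carrier Q \<and> f \<in> (\<Pi> \<alpha>\<in>S. ?C \<inter> G \<alpha>) \<and> finsum L f S = \<zero>\<^bsub>L\<^esub>"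
    then have "finite S" "S \<subseteq> carrier Q" "f \<in> (\<Pi> \<alpha>\<in>S. G \<alpha>)" "finsum L f S = \<zero>\<^bsub>L\<^esub>" by auto
    then show "\<forall>\<alpha>\<in>S. f \<alpha> = \<zero>\<^bsub>L\<^esub>"
      using direct unfolding is_direct_sum_def by blast
  qed
  then show ?thesis using ideal by (simp add: graded_ideal_def)
qed

lemma homogeneous_induct:
  assumes "x \<in> carrier L" "P \<zero>\<^bsub>L\<^esub>" "\<And>\<alpha> y. \<alpha> \<in> carrier Q \<Longrightarrow> y \<in> G \<alpha> \<Longrightarrow> P y"
    and "\<And>y z. y \<in> carrier L \<Longrightarrow> z \<in> carrier L \<Longrightarrow> P y \<Longrightarrow> P z \<Longrightarrow> P (y \<oplus>\<^bsub>L\<^esub> z)"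
  shows "P x"
proof -
  have "P (finsum L f S)" if "finite S" "S \<subseteq> carrier Q" "f \<in> (\<Pi> \<alpha>\<in>S. G \<alpha>)" for S f
    using that
  proof induction
    case (insert \<alpha> S)
    have "f \<in> insert \<alpha> S \<rightarrow> carrier L" using insert comp_closed by (auto simp: Pi_iff subset_iff)
    then show ?case using insert assms by (auto intro!: assms(4) M.finsum_closed)
  qed (use assms in auto)
  then show ?thesis
    using sum_components[OF assms(1) finite_supp[OF assms(1)] order.refl supp_subset]
      finite_supp[OF assms(1)] supp_subset component_in[OF assms(1)] by (metis (no_types, lifting) Pi_I subsetD)
qed

end

section \<open>Comaximal and maximal ideals\<close>

context plain_lie_algebra
begin

definition ideal_sum :: "'a set \<Rightarrow> 'a set \<Rightarrow> 'a set" where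
  "ideal_sum A B = {a \<oplus>\<^bsub>L\<^esub> b | a b. a \<in> A \<and> b \<in> B}"

lemma ideal_sumI: "a \<in> A \<Longrightarrow> b \<in> B \<Longrightarrow> a \<oplus>\<^bsub>L\<^esub> b \<in> ideal_sum A B"
  by (auto simp: ideal_sum_def)

lemma ideal_sumE: "x \<in> ideal_sum A B \<Longrightarrow> \<exists>a \<in> A. \<exists>b \<in> B. x = a \<oplus>\<^bsub>L\<^esub> b"
  by (auto simp: ideal_sum_def)

lemma lie_ideal_sum:
  assumes A: "lie_ideal K L A" and B: "lie_ideal K L B"
  shows "lie_ideal K L (ideal_sum A B)"
proof (rule lie_idealI)
  note AD = lie_idealD[OF A] and BD = lie_idealD[OF B]
  show "ideal_sum A B \<subseteq> carrier L" using AD(1) BD(1) by (auto simp: ideal_sum_def)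
  show "\<zero>\<^bsub>L\<^esub> \<in> ideal_sum A B" using ideal_sumI[OF AD(2) BD(2)] by simp
  show "x \<oplus>\<^bsub>L\<^esub> y \<in> ideal_sum A B" if xy: "x \<in> ideal_sum A B" "y \<in> ideal_sum A B" for x y
  proof -
    obtain a b a' b' where x: "x = a \<oplus>\<^bsub>L\<^esub> b" "a \<in> A" "b \<in> B" and y: "y = a' \<oplus>\<^bsub>L\<^esub> b'" "a' \<in> A" "b' \<in> B"
      using xy by (auto simp: ideal_sum_def)
    have "a \<in> carrier L" "b \<in> carrier L" "a' \<in> carrier L" "b' \<in> carrier L"
      using x y AD(1) BD(1) by auto
    then have "x \<oplus>\<^bsub>L\<^esub> y = (a \<oplus>\<^bsub>L\<^esub> a') \<oplus>\<^bsub>L\<^esub> (b \<oplus>\<^bsub>L\<^esub> b')"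
      using x y by (simp add: M.add.m_ac)
    then show ?thesis using ideal_sumI AD(3) BD(3) x y by simp
  qed
  show "c \<odot>\<^bsub>L\<^esub> x \<in> ideal_sum A B" if c: "c \<in> carrier K" and x: "x \<in> ideal_sum A B" for c x
  proof -
    obtain a b where x: "x = a \<oplus>\<^bsub>L\<^esub> b" "a \<in> A" "b \<in> B"
      using x by (auto simp: ideal_sum_def)
    then have "c \<odot>\<^bsub>L\<^esub> x = c \<odot>\<^bsub>L\<^esub> a \<oplus>\<^bsub>L\<^esub> c \<odot>\<^bsub>L\<^esub> b"
      using c AD(1) BD(1) by (simp add: smult_r_distr subset_iff)
    then show ?thesis using ideal_sumI AD(4) BD(4) c x by simp
  qed
  show "\<lbrakk>y,x\<rbrakk>\<^bsub>L\<^esub> \<in> ideal_sum A B" if y: "y \<in> carrier L" and x: "x \<in> ideal_sum A B" for x y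
  proof -
    obtain a b where x: "x = a \<oplus>\<^bsub>L\<^esub> b" "a \<in> A" "b \<in> B"
      using x by (auto simp: ideal_sum_def)
    then have "\<lbrakk>y,x\<rbrakk>\<^bsub>L\<^esub> = \<lbrakk>y,a\<rbrakk>\<^bsub>L\<^esub> \<oplus>\<^bsub>L\<^esub> \<lbrakk>y,b\<rbrakk>\<^bsub>L\<^esub>"
      using y AD(1) BD(1) by (simp add: bracket_add_right subset_iff)
    then show ?thesis using ideal_sumI AD(5) BD(5) x y by simp
  qed
qed

lemma ideal_sum_upper:
  assumes A: "lie_ideal K L A" and B: "lie_ideal K L B"
  shows "A \<subseteq> ideal_sum A B" "B \<subseteq> ideal_sum A B"
proof -
  note AD = lie_idealD[OF A] and BD = lie_idealD[OF B]
  have "x \<in> ideal_sum A B" if "x \<in> A" for x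
    using ideal_sumI[OF that BD(2)] that AD(1) by auto
  then show "A \<subseteq> ideal_sum A B" by blast
  have "x \<in> ideal_sum A B" if "x \<in> B" for x
    using ideal_sumI[OF AD(2) that] that BD(1) by auto
  then show "B \<subseteq> ideal_sum A B" by blast
qed

lemma lie_ideal_Int:
  assumes A: "lie_ideal K L A" and B: "lie_ideal K L B"
  shows "lie_ideal K L (A \<inter> B)"
  using lie_idealD[OF A] lie_idealD[OF B] by (intro lie_idealI) auto

lemma lie_ideal_carrier: "lie_ideal K L (carrier L)"
  by (intro lie_idealI) (auto simp: bracket_closed)

definition maximal_ideal :: "'a set \<Rightarrow> bool" where
  "maximal_ideal J \<longleftrightarrow> lie_ideal K L J \<and> J \<noteq> carrier L \<and>
     (\<forall>I. lie_ideal K L I \<and> J \<subseteq> I \<longrightarrow> I = J \<or> I = carrier L)"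

lemma maximal_ideal_sum:
  assumes J: "maximal_ideal J" and A: "lie_ideal K L A" and "\<not> A \<subseteq> J"
  shows "ideal_sum A J = carrier L"
proof -
  have J': "lie_ideal K L J" using J by (simp add: maximal_ideal_def)
  have "ideal_sum A J \<noteq> J" using ideal_sum_upper(1)[OF A J'] assms(3) by blast
  then show ?thesis
    using J lie_ideal_sum[OF A J'] ideal_sum_upper(2)[OF A J'] unfolding maximal_ideal_def by blast
qed

lemma bracket_mod_ideal:
  assumes J: "lie_ideal K L J" and "a \<in> carrier L" "b \<in> carrier L" "j \<in> J" "k \<in> J"
  shows "\<exists>l \<in> J. \<lbrakk>a \<oplus>\<^bsub>L\<^esub> j,b \<oplus>\<^bsub>L\<^esub> k\<rbrakk>\<^bsub>L\<^esub> = \<lbrakk>a,b\<rbrakk>\<^bsub>L\<^esub> \<oplus>\<^bsub>L\<^esub> l"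
proof
  note JD = lie_idealD[OF J]
  let ?l = "\<lbrakk>a,k\<rbrakk>\<^bsub>L\<^esub> \<oplus>\<^bsub>L\<^esub> \<lbrakk>j,b \<oplus>\<^bsub>L\<^esub> k\<rbrakk>\<^bsub>L\<^esub>"
  have jk: "j \<in> carrier L" "k \<in> carrier L" using assms JD(1) by auto
  then show "\<lbrakk>a \<oplus>\<^bsub>L\<^esub> j,b \<oplus>\<^bsub>L\<^esub> k\<rbrakk>\<^bsub>L\<^esub> = \<lbrakk>a,b\<rbrakk>\<^bsub>L\<^esub> \<oplus>\<^bsub>L\<^esub> ?l"
    using assms by (simp add: bracket_add_left bracket_add_right bracket_closed M.a_ac)
  show "?l \<in> J" using assms jk by (intro JD(3) JD(5) JD(6)) auto
qed

text \<open>
  The step of the Chinese remainder theorem.  In a ring one would multiply decompositions of 1; here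
  one takes two elements whose bracket is not in \<open>J\<close> and replaces the first by an element of \<open>A\<close> and the
  second by an element of \<open>B\<close>, modulo \<open>J\<close>.  Their bracket lies in both ideals and still not in \<open>J\<close>.
\<close>
lemma comaximal_Int:
  assumes J: "maximal_ideal J" and nc: "x \<in> carrier L" "y \<in> carrier L" "\<lbrakk>x,y\<rbrakk>\<^bsub>L\<^esub> \<notin> J"
    and A: "lie_ideal K L A" "ideal_sum A J = carrier L"
    and B: "lie_ideal K L B" "ideal_sum B J = carrier L"
  shows "ideal_sum (A \<inter> B) J = carrier L"
proof (rule maximal_ideal_sum[OF J lie_ideal_Int[OF A(1) B(1)]])
  have J': "lie_ideal K L J" using J by (simp add: maximal_ideal_def)
  obtain a j where x: "x = a \<oplus>\<^bsub>L\<^esub> j" "a \<in> A" "j \<in> J"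
    using nc A(2) ideal_sumE by blast
  obtain b k where y: "y = b \<oplus>\<^bsub>L\<^esub> k" "b \<in> B" "k \<in> J"
    using nc B(2) ideal_sumE by blast
  have ab: "a \<in> carrier L" "b \<in> carrier L" using x y lie_idealD(1)[OF A(1)] lie_idealD(1)[OF B(1)] by auto
  obtain l where "l \<in> J" "\<lbrakk>x,y\<rbrakk>\<^bsub>L\<^esub> = \<lbrakk>a,b\<rbrakk>\<^bsub>L\<^esub> \<oplus>\<^bsub>L\<^esub> l"
    using bracket_mod_ideal[OF J' ab x(3) y(3)] x y by auto
  then have "\<lbrakk>a,b\<rbrakk>\<^bsub>L\<^esub> \<notin> J" using nc(3) lie_idealD(3)[OF J'] by auto
  moreover have "\<lbrakk>a,b\<rbrakk>\<^bsub>L\<^esub> \<in> A \<inter> B"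
    using lie_idealD(6)[OF A(1) ab(2) x(2)] lie_idealD(5)[OF B(1) ab(1) y(2)] by blast
  ultimately show "\<not> A \<inter> B \<subseteq> J" by blast
qed

end

locale graded_simple_lie = graded_lie +
  assumes simple: "graded_simple K Q L G"
begin

text \<open>
  If the largest graded ideal inside \<open>J\<close> were everything, \<open>J\<close> would contain all components of all
  elements, hence all elements.
\<close>
lemma proper_ideal_core_zero:
  assumes J: "lie_ideal K L J" "J \<noteq> carrier L"
    and x: "x \<in> carrier L" "\<And>\<alpha>. \<alpha> \<in> carrier Q \<Longrightarrow> component \<alpha> x \<in> J"
  shows "x = \<zero>\<^bsub>L\<^esub>"
proof -
  let ?C = "{x \<in> carrier L. \<forall>\<alpha> \<in> carrier Q. component \<alpha> x \<in> J}"
  have "?C \<noteq> carrier L"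
  proof
    assume C: "?C = carrier L"
    have "carrier L \<subseteq> J"
    proof
      fix y assume y: "y \<in> carrier L"
      have "(\<lambda>\<alpha>. component \<alpha> y) \<in> supp y \<rightarrow> J" using C y suppD by blast
      then have "(\<Oplus>\<^bsub>L\<^esub>\<alpha>\<in>supp y. component \<alpha> y) \<in> J"
        using J(1) finite_supp[OF y] by (intro submodule_finsum) (auto simp: lie_ideal_def)
      then show "y \<in> J" using sum_components[OF y finite_supp[OF y] order.refl supp_subset] by simp
    qed
    then show False using J(2) lie_idealD(1)[OF J(1)] by blast
  qed
  then have "?C = {\<zero>\<^bsub>L\<^esub>}"
    using homogeneous_core_is_graded_ideal[OF J(1)] simple unfolding graded_simple_def by blast
  then show ?thesis using x by blast
qed

lemma proper_ideal_homogeneous_zero: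
  assumes J: "lie_ideal K L J" "J \<noteq> carrier L" and \<alpha>: "\<alpha> \<in> carrier Q" and x: "x \<in> G \<alpha>" "x \<in> J"
  shows "x = \<zero>\<^bsub>L\<^esub>"
proof (rule proper_ideal_core_zero[OF J])
  show "x \<in> carrier L" using comp_closed[OF \<alpha> x(1)] .
  show "component \<beta> x \<in> J" if "\<beta> \<in> carrier Q" for \<beta>
    using component_homogeneous[OF \<alpha> x(1) that] x lie_idealD(2)[OF J(1)] by simp
qed

text \<open>
  If all brackets were in \<open>J\<close>, those of homogeneous elements would be homogeneous elements of a proper
  ideal, hence zero, and the algebra would be commutative.
\<close>
lemma exists_bracket_not_in_proper_ideal:
  assumes J: "lie_ideal K L J" "J \<noteq> carrier L"
  shows "\<exists>x \<in> carrier L. \<exists>y \<in> carrier L. \<lbrakk>x,y\<rbrakk>\<^bsub>L\<^esub> \<notin> J"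
proof (rule ccontr)
  assume "\<not> ?thesis"
  then have b: "\<lbrakk>x,y\<rbrakk>\<^bsub>L\<^esub> \<in> J" if "x \<in> carrier L" "y \<in> carrier L" for x y using that by blast
  have hom: "\<lbrakk>x,y\<rbrakk>\<^bsub>L\<^esub> = \<zero>\<^bsub>L\<^esub>" if "\<alpha> \<in> carrier Q" "\<beta> \<in> carrier Q" "x \<in> G \<alpha>" "y \<in> G \<beta>" for \<alpha> \<beta> x y
    using that comp_closed
    by (intro proper_ideal_homogeneous_zero[OF J, of "\<alpha> \<otimes>\<^bsub>Q\<^esub> \<beta>"] bracket_comp b) auto
  have hom': "\<lbrakk>x,y\<rbrakk>\<^bsub>L\<^esub> = \<zero>\<^bsub>L\<^esub>" if "\<alpha> \<in> carrier Q" "x \<in> G \<alpha>" "y \<in> carrier L" for \<alpha> x y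
  proof -
    have x: "x \<in> carrier L" using comp_closed that by blast
    show ?thesis
    proof (rule homogeneous_induct[OF that(3), where P = "\<lambda>y. \<lbrakk>x,y\<rbrakk>\<^bsub>L\<^esub> = \<zero>\<^bsub>L\<^esub>"])
    show "\<lbrakk>x,\<zero>\<^bsub>L\<^esub>\<rbrakk>\<^bsub>L\<^esub> = \<zero>\<^bsub>L\<^esub>" using x by (rule bracket_zero)
    show "\<lbrakk>x,z\<rbrakk>\<^bsub>L\<^esub> = \<zero>\<^bsub>L\<^esub>" if "\<beta> \<in> carrier Q" "z \<in> G \<beta>" for \<beta> z
      using hom \<open>\<alpha> \<in> carrier Q\<close> \<open>x \<in> G \<alpha>\<close> that by blast
      show "\<lbrakk>x,z \<oplus>\<^bsub>L\<^esub> z'\<rbrakk>\<^bsub>L\<^esub> = \<zero>\<^bsub>L\<^esub>" if "z \<in> carrier L" "z' \<in> carrier L"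
        "\<lbrakk>x,z\<rbrakk>\<^bsub>L\<^esub> = \<zero>\<^bsub>L\<^esub>" "\<lbrakk>x,z'\<rbrakk>\<^bsub>L\<^esub> = \<zero>\<^bsub>L\<^esub>" for z z'
        using bracket_add_right[OF x that(1,2)] that by simp
    qed
  qed
  have "\<lbrakk>x,y\<rbrakk>\<^bsub>L\<^esub> = \<zero>\<^bsub>L\<^esub>" if "x \<in> carrier L" and y: "y \<in> carrier L" for x y
  proof (rule homogeneous_induct[OF that(1), where P = "\<lambda>x. \<lbrakk>x,y\<rbrakk>\<^bsub>L\<^esub> = \<zero>\<^bsub>L\<^esub>"])
    show "\<lbrakk>\<zero>\<^bsub>L\<^esub>,y\<rbrakk>\<^bsub>L\<^esub> = \<zero>\<^bsub>L\<^esub>" using that(2) by (rule bracket_zero)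
    show "\<lbrakk>z,y\<rbrakk>\<^bsub>L\<^esub> = \<zero>\<^bsub>L\<^esub>" if "\<beta> \<in> carrier Q" "z \<in> G \<beta>" for \<beta> z
      using hom' \<open>y \<in> carrier L\<close> that by blast
    show "\<lbrakk>z \<oplus>\<^bsub>L\<^esub> z',y\<rbrakk>\<^bsub>L\<^esub> = \<zero>\<^bsub>L\<^esub>" if z: "z \<in> carrier L" "z' \<in> carrier L"
      "\<lbrakk>z,y\<rbrakk>\<^bsub>L\<^esub> = \<zero>\<^bsub>L\<^esub>" "\<lbrakk>z',y\<rbrakk>\<^bsub>L\<^esub> = \<zero>\<^bsub>L\<^esub>" for z z'
      using bracket_add_left[OF z(1,2) y] z by simp
  qed
  then show False using simple by (simp add: graded_simple_def commutative_lie_def)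
qed

lemma exists_nonzero_homogeneous: "\<exists>\<alpha> \<in> carrier Q. \<exists>x \<in> G \<alpha>. x \<noteq> \<zero>\<^bsub>L\<^esub>"
proof (rule ccontr)
  assume "\<not> ?thesis"
  then have z: "x = \<zero>\<^bsub>L\<^esub>" if "\<alpha> \<in> carrier Q" "x \<in> G \<alpha>" for \<alpha> x using that by blast
  have all: "x = \<zero>\<^bsub>L\<^esub>" if "x \<in> carrier L" for x
  proof (rule homogeneous_induct[OF that, where P = "\<lambda>x. x = \<zero>\<^bsub>L\<^esub>"])
    show "y \<oplus>\<^bsub>L\<^esub> y' = \<zero>\<^bsub>L\<^esub>" if "y = \<zero>\<^bsub>L\<^esub>" "y' = \<zero>\<^bsub>L\<^esub>" for y y'
      using that by simp
  qed (rule refl, rule z)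
  then have "\<lbrakk>x,y\<rbrakk>\<^bsub>L\<^esub> = \<zero>\<^bsub>L\<^esub>" if "x \<in> carrier L" "y \<in> carrier L" for x y
    using that all[OF bracket_closed] by blast
  then show False using simple by (simp add: graded_simple_def commutative_lie_def)
qed

lemma lie_ideal_zero: "lie_ideal K L {\<zero>\<^bsub>L\<^esub>}"
  by (rule lie_idealI) (auto simp: bracket_zero)

text \<open>
  Proper ideals are not characterized by missing a unit as in a ring; a fixed nonzero homogeneous
  element takes over this role in Zorn's lemma.
\<close>
lemma exists_maximal_ideal: "\<exists>J. maximal_ideal J"
proof -
  obtain \<alpha> x where x: "\<alpha> \<in> carrier Q" "x \<in> G \<alpha>" "x \<noteq> \<zero>\<^bsub>L\<^esub>" using exists_nonzero_homogeneous by blast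
  have xL: "x \<in> carrier L" using comp_closed x by blast
  let ?A = "{J. lie_ideal K L J \<and> J \<noteq> carrier L}"
  have "{\<zero>\<^bsub>L\<^esub>} \<in> ?A" using lie_ideal_zero xL x(3) by auto
  then have "?A \<noteq> {}" by blast
  moreover have "\<Union>C \<in> ?A" if C: "C \<noteq> {}" "subset.chain ?A C" for C
  proof -
    have CA: "lie_ideal K L J" "J \<noteq> carrier L" if "J \<in> C" for J
      using C(2) that unfolding subset.chain_def by auto
    have chain: "J \<subseteq> J' \<or> J' \<subseteq> J" if "J \<in> C" "J' \<in> C" for J J'
      using C(2) that unfolding subset_chain_def by blast
    note D = lie_idealD[OF CA(1)]
    have "lie_ideal K L (\<Union>C)"
    proof (rule lie_idealI)
      show "\<zero>\<^bsub>L\<^esub> \<in> \<Union>C" using C(1) D(2) by blast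
      show "y \<oplus>\<^bsub>L\<^esub> z \<in> \<Union>C" if yz: "y \<in> \<Union>C" "z \<in> \<Union>C" for y z
      proof -
        obtain J where "J \<in> C" "y \<in> J" "z \<in> J" using yz chain by (meson UnionE subsetD)
        then show ?thesis using D(3) by blast
      qed
      show "\<Union>C \<subseteq> carrier L" using D(1) by blast
      show "c \<odot>\<^bsub>L\<^esub> y \<in> \<Union>C" if "c \<in> carrier K" "y \<in> \<Union>C" for c y using that D(4) by blast
      show "\<lbrakk>z,y\<rbrakk>\<^bsub>L\<^esub> \<in> \<Union>C" if "z \<in> carrier L" "y \<in> \<Union>C" for z y using that D(5) by blast
    qed
    moreover have "x \<notin> \<Union>C"
      using proper_ideal_homogeneous_zero[OF CA x(1,2)] x(3) by blast
    ultimately show ?thesis using xL by blast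
  qed
  ultimately obtain J where "J \<in> ?A" "\<forall>I \<in> ?A. J \<subseteq> I \<longrightarrow> I = J"
    using subset_Zorn_nonempty[of ?A] by blast
  then show ?thesis unfolding maximal_ideal_def by blast
qed

end

section \<open>The action of the characters\<close>

text \<open>
  The set \<open>X\<close> plays the role of the dual group of \<open>Q0\<close>.  Products of characters are restricted to
  the carrier, so that a finite set of functions can be closed under them.
\<close>
locale dual_graded_lie = graded_simple_lie K L "Q0 \<times>\<times> Q1" G + Q0: comm_group Q0 + Q1: comm_group Q1
  for K :: "'k ring" (structure) and L :: "('k, 'a) lie_algebra" (structure)
    and Q0 :: "'q0 monoid" and Q1 :: "'q1 monoid" and G +
  fixes X :: "('q0 \<Rightarrow> 'k) set"
  assumes finite_Q0: "finite (carrier Q0)" and finite_X: "finite X"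
    and X_hom: "X \<subseteq> hom Q0 (mult_of K)"
    and X_one: "(\<lambda>a \<in> carrier Q0. \<one>) \<in> X"
    and X_mult: "\<And>\<chi> \<psi>. \<chi> \<in> X \<Longrightarrow> \<psi> \<in> X \<Longrightarrow> (\<lambda>a \<in> carrier Q0. \<chi> a \<otimes> \<psi> a) \<in> X"
    and X_separates: "\<And>a. a \<in> carrier Q0 \<Longrightarrow> a \<noteq> \<one>\<^bsub>Q0\<^esub> \<Longrightarrow> \<exists>\<chi> \<in> X. \<chi> a \<noteq> \<one>"
    and ideals_snd_graded: "\<And>J. lie_ideal K L J \<Longrightarrow> snd_graded Q0 Q1 L G J"
begin

text \<open>Degrees are kept as single variables; the simplifier would split them into pairs.\<close>
declare carrier_DirProd [simp del]

abbreviation "QQ \<equiv> Q0 \<times>\<times> Q1"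

lemma fst_closed: "\<alpha> \<in> carrier QQ \<Longrightarrow> fst \<alpha> \<in> carrier Q0"
  and snd_closed: "\<alpha> \<in> carrier QQ \<Longrightarrow> snd \<alpha> \<in> carrier Q1"
  by (auto simp: DirProd_def)

lemma X_closed: "\<chi> \<in> X \<Longrightarrow> a \<in> carrier Q0 \<Longrightarrow> \<chi> a \<in> carrier K"
  and X_nonzero: "\<chi> \<in> X \<Longrightarrow> a \<in> carrier Q0 \<Longrightarrow> \<chi> a \<noteq> \<zero>"
  and X_mult_eq: "\<chi> \<in> X \<Longrightarrow> a \<in> carrier Q0 \<Longrightarrow> b \<in> carrier Q0 \<Longrightarrow> \<chi> (a \<otimes>\<^bsub>Q0\<^esub> b) = \<chi> a \<otimes> \<chi> b"
  using X_hom by (auto simp: hom_def Pi_iff subset_iff)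

lemma X_one_eq: "\<chi> \<in> X \<Longrightarrow> \<chi> \<one>\<^bsub>Q0\<^esub> = \<one>"
  using X_mult_eq[of \<chi> "\<one>\<^bsub>Q0\<^esub>" "\<one>\<^bsub>Q0\<^esub>"] X_closed[of \<chi> "\<one>\<^bsub>Q0\<^esub>"] X_nonzero[of \<chi> "\<one>\<^bsub>Q0\<^esub>"]
    m_lcancel[of "\<chi> \<one>\<^bsub>Q0\<^esub>" "\<chi> \<one>\<^bsub>Q0\<^esub>" \<one>]
  by simp

lemma X_eq_iff:
  assumes "\<chi> \<in> X" "a \<in> carrier Q0" "b \<in> carrier Q0"
  shows "\<chi> (a \<otimes>\<^bsub>Q0\<^esub> inv\<^bsub>Q0\<^esub> b) = \<one> \<longleftrightarrow> \<chi> a = \<chi> b"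
proof -
  have "\<chi> (a \<otimes>\<^bsub>Q0\<^esub> inv\<^bsub>Q0\<^esub> b) \<otimes> \<chi> b = \<chi> a"
    using assms by (simp add: Q0.m_assoc flip: X_mult_eq)
  moreover have "c = \<one> \<longleftrightarrow> c \<otimes> \<chi> b = \<chi> b" if "c \<in> carrier K" for c
    using m_rcancel[of "\<chi> b" c \<one>] that X_closed[OF assms(1,3)] X_nonzero[OF assms(1,3)] by simp
  ultimately show ?thesis using X_closed[OF assms(1)] assms by (metis Q0.inv_closed Q0.m_closed)
qed

lemma X_separates_eq:
  assumes "a \<in> carrier Q0" "b \<in> carrier Q0" "\<And>\<chi>. \<chi> \<in> X \<Longrightarrow> \<chi> a = \<chi> b"
  shows "a = b"
proof -
  have "a \<otimes>\<^bsub>Q0\<^esub> inv\<^bsub>Q0\<^esub> b = \<one>\<^bsub>Q0\<^esub>"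
    using X_separates[of "a \<otimes>\<^bsub>Q0\<^esub> inv\<^bsub>Q0\<^esub> b"] X_eq_iff assms by (meson Q0.inv_closed Q0.m_closed)
  then show ?thesis
    using assms by (metis Q0.inv_closed Q0.inv_equality Q0.inv_inv)
qed

lemma X_Pi: "X \<subseteq> carrier Q0 \<rightarrow> carrier K"
  using X_closed by blast

definition twist :: "('q0 \<Rightarrow> 'k) \<Rightarrow> 'a \<Rightarrow> 'a" where
  "twist \<chi> = diag (\<lambda>\<alpha>. \<chi> (fst \<alpha>))"

lemma X_fst: "\<chi> \<in> X \<Longrightarrow> (\<lambda>\<alpha>. \<chi> (fst \<alpha>)) \<in> carrier QQ \<rightarrow> carrier K"
  using X_closed fst_closed by blast

lemma twist_closed: "\<chi> \<in> X \<Longrightarrow> x \<in> carrier L \<Longrightarrow> twist \<chi> x \<in> carrier L"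
  by (simp add: twist_def diag_closed X_fst)

lemma twist_add: "\<chi> \<in> X \<Longrightarrow> x \<in> carrier L \<Longrightarrow> y \<in> carrier L
    \<Longrightarrow> twist \<chi> (x \<oplus>\<^bsub>L\<^esub> y) = twist \<chi> x \<oplus>\<^bsub>L\<^esub> twist \<chi> y"
  by (simp add: twist_def diag_add X_fst)

lemma twist_smult: "\<chi> \<in> X \<Longrightarrow> x \<in> carrier L \<Longrightarrow> c \<in> carrier K
    \<Longrightarrow> twist \<chi> (c \<odot>\<^bsub>L\<^esub> x) = c \<odot>\<^bsub>L\<^esub> twist \<chi> x"
  by (simp add: twist_def diag_smult X_fst)

lemma twist_bracket: "\<chi> \<in> X \<Longrightarrow> x \<in> carrier L \<Longrightarrow> y \<in> carrier L
    \<Longrightarrow> twist \<chi> \<lbrakk>x,y\<rbrakk>\<^bsub>L\<^esub> = \<lbrakk>twist \<chi> x,twist \<chi> y\<rbrakk>\<^bsub>L\<^esub>"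
  unfolding twist_def
  by (rule diag_bracket[OF X_fst]) (simp_all add: X_mult_eq fst_closed mult_DirProd')

lemma twist_zero: "\<chi> \<in> X \<Longrightarrow> twist \<chi> \<zero>\<^bsub>L\<^esub> = \<zero>\<^bsub>L\<^esub>"
  unfolding twist_def
  by (rule diag_eqI[OF X_fst]) (simp_all add: component_zero X_closed fst_closed)

lemma twist_twist:
  assumes "\<chi> \<in> X" "\<psi> \<in> X" "x \<in> carrier L"
  shows "twist \<chi> (twist \<psi> x) = twist (\<lambda>a \<in> carrier Q0. \<chi> a \<otimes> \<psi> a) x"
proof -
  have "twist \<chi> (twist \<psi> x) = diag (\<lambda>\<alpha>. \<chi> (fst \<alpha>) \<otimes> \<psi> (fst \<alpha>)) x"
    unfolding twist_def using assms by (simp add: diag_diag X_fst)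
  also have "\<dots> = twist (\<lambda>a \<in> carrier Q0. \<chi> a \<otimes> \<psi> a) x"
    unfolding twist_def using assms X_closed fst_closed by (intro diag_cong) auto
  finally show ?thesis .
qed

lemma twist_commute:
  assumes "\<chi> \<in> X" "\<psi> \<in> X" "x \<in> carrier L"
  shows "twist \<chi> (twist \<psi> x) = twist \<psi> (twist \<chi> x)"
proof -
  have "(\<lambda>a \<in> carrier Q0. \<chi> a \<otimes> \<psi> a) = (\<lambda>a \<in> carrier Q0. \<psi> a \<otimes> \<chi> a)"
    using assms by (intro restrict_ext) (simp add: m_comm X_closed)
  then show ?thesis using assms by (simp add: twist_twist)
qed

lemma twist_surj:
  assumes \<chi>: "\<chi> \<in> X" and x: "x \<in> carrier L"
  obtains y where "y \<in> carrier L" "twist \<chi> y = x"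
proof
  let ?f = "\<lambda>\<alpha>. \<chi> (inv\<^bsub>Q0\<^esub> (fst \<alpha>))"
  have f: "?f \<in> carrier QQ \<rightarrow> carrier K" using X_closed[OF \<chi>] fst_closed by auto
  show "diag ?f x \<in> carrier L" using f x by (rule diag_closed)
  have one: "\<chi> (fst \<alpha>) \<otimes> ?f \<alpha> = \<one>" if "\<alpha> \<in> carrier QQ" for \<alpha>
    using that fst_closed[OF that] X_one_eq[OF \<chi>] \<chi> by (simp flip: X_mult_eq)
  have "twist \<chi> (diag ?f x) = diag (\<lambda>\<alpha>. \<chi> (fst \<alpha>) \<otimes> ?f \<alpha>) x"
    unfolding twist_def by (rule diag_diag[OF X_fst[OF \<chi>] f x])
  also have "\<dots> = x"
  proof (rule diag_eqI)
    show "(\<chi> (fst \<alpha>) \<otimes> ?f \<alpha>) \<odot>\<^bsub>L\<^esub> component \<alpha> x = component \<alpha> x" if "\<alpha> \<in> carrier QQ" for \<alpha>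
      using one[OF that] component_closed[OF x that] by simp
    show "(\<lambda>\<alpha>. \<chi> (fst \<alpha>) \<otimes> ?f \<alpha>) \<in> carrier QQ \<rightarrow> carrier K" using one by auto
  qed (rule x)+
  finally show "twist \<chi> (diag ?f x) = x" .
qed

lemma lie_ideal_twist_vimage:
  assumes \<chi>: "\<chi> \<in> X" and J: "lie_ideal K L J"
  shows "lie_ideal K L {x \<in> carrier L. twist \<chi> x \<in> J}"
  using lie_idealD[OF J] \<chi>
  by (intro lie_idealI) (auto simp: twist_zero twist_add twist_smult twist_bracket twist_closed bracket_closed)

lemma lie_ideal_twist_image:
  assumes \<chi>: "\<chi> \<in> X" and J: "lie_ideal K L J"
  shows "lie_ideal K L (twist \<chi> ` J)"
proof (rule lie_idealI)
  note JD = lie_idealD[OF J]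
  have JL: "x \<in> carrier L" if "x \<in> J" for x using that JD(1) by blast
  show "twist \<chi> ` J \<subseteq> carrier L" using JL twist_closed[OF \<chi>] by blast
  show "\<zero>\<^bsub>L\<^esub> \<in> twist \<chi> ` J" using JD(2) twist_zero[OF \<chi>] by (metis image_eqI)
  show "x \<oplus>\<^bsub>L\<^esub> y \<in> twist \<chi> ` J" if "x \<in> twist \<chi> ` J" "y \<in> twist \<chi> ` J" for x y
    using that JD(3) JL by (auto simp: simp flip: twist_add[OF \<chi>])
  show "c \<odot>\<^bsub>L\<^esub> x \<in> twist \<chi> ` J" if "c \<in> carrier K" "x \<in> twist \<chi> ` J" for c x
    using that JD(4) JL by (auto simp: simp flip: twist_smult[OF \<chi>])
  show "\<lbrakk>y,x\<rbrakk>\<^bsub>L\<^esub> \<in> twist \<chi> ` J" if y: "y \<in> carrier L" and x: "x \<in> twist \<chi> ` J" for x y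
  proof -
    obtain z where z: "z \<in> carrier L" "twist \<chi> z = y" using twist_surj[OF \<chi> y] .
    obtain j where j: "j \<in> J" "x = twist \<chi> j" using x by blast
    have "\<lbrakk>y,x\<rbrakk>\<^bsub>L\<^esub> = twist \<chi> \<lbrakk>z,j\<rbrakk>\<^bsub>L\<^esub>" using z j JL \<chi> by (simp add: twist_bracket)
    then show ?thesis using JD(5) z(1) j(1) by blast
  qed
qed

lemma component_zero_of_sum_of:
  assumes y: "y \<in> sum_of L (carrier Q0) (\<lambda>\<delta>. G (\<delta>, \<gamma>))" and \<gamma>: "\<gamma> \<in> carrier Q1"
  shows "y \<in> carrier L" "\<And>\<alpha>. \<alpha> \<in> carrier QQ \<Longrightarrow> snd \<alpha> \<noteq> \<gamma> \<Longrightarrow> component \<alpha> y = \<zero>\<^bsub>L\<^esub>"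
proof -
  obtain f S where yf: "y = finsum L f S" and S: "finite S" "S \<subseteq> carrier Q0"
    and f: "f \<in> (\<Pi> \<delta>\<in>S. G (\<delta>, \<gamma>))"
    using y unfolding sum_of_def by blast
  have Q: "(\<delta>, \<gamma>) \<in> carrier QQ" if "\<delta> \<in> S" for \<delta> using that S \<gamma> by (auto simp: DirProd_def)
  have fc: "f \<in> S \<rightarrow> carrier L" using f comp_closed[OF Q] by blast
  then show "y \<in> carrier L" unfolding yf by simp
  fix \<alpha> assume \<alpha>: "\<alpha> \<in> carrier QQ" "snd \<alpha> \<noteq> \<gamma>"
  have "component \<alpha> y = (\<Oplus>\<^bsub>L\<^esub>\<delta>\<in>S. component \<alpha> (f \<delta>))"
    unfolding yf by (rule component_additive_finsum[OF S(1) fc \<alpha>(1)])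
  also have "\<dots> = \<zero>\<^bsub>L\<^esub>"
  proof (rule M.add.finprod_one_eqI)
    fix \<delta> assume \<delta>: "\<delta> \<in> S"
    then have "f \<delta> \<in> G (\<delta>, \<gamma>)" using f by blast
    then show "component \<alpha> (f \<delta>) = \<zero>\<^bsub>L\<^esub>"
      using component_homogeneous[OF Q[OF \<delta>] _ \<alpha>(1)] \<alpha>(2) by auto
  qed
  finally show "component \<alpha> y = \<zero>\<^bsub>L\<^esub>" .
qed

lemma indicator_Pi: "(\<lambda>\<alpha>. if R \<alpha> then \<one> else \<zero>) \<in> A \<rightarrow> carrier K"
  by simp

text \<open>
  The components of an element of the ideal in its \<open>Q1\<close>-grading are its images under the projections to
  the degrees \<open>Q0 \<times> {\<gamma>}\<close>, since their own degrees have second coordinate \<open>\<gamma>\<close>.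
\<close>
lemma snd_projection_in_ideal:
  assumes J: "lie_ideal K L J" and x: "x \<in> J" and \<gamma>: "\<gamma> \<in> carrier Q1"
  shows "diag (\<lambda>\<alpha>. if snd \<alpha> = \<gamma> then \<one> else \<zero>) x \<in> J"
proof -
  note JD = lie_idealD[OF J]
  have "x \<in> sum_of L (carrier Q1) (\<lambda>\<gamma>. J \<inter> sum_of L (carrier Q0) (\<lambda>\<delta>. G (\<delta>, \<gamma>)))"
    using ideals_snd_graded[OF J] x unfolding snd_graded_def is_direct_sum_def by blast
  then obtain f S where xf: "x = finsum L f S" and S: "finite S" "S \<subseteq> carrier Q1"
    and f: "f \<in> (\<Pi> \<gamma>\<in>S. J \<inter> sum_of L (carrier Q0) (\<lambda>\<delta>. G (\<delta>, \<gamma>)))"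
    unfolding sum_of_def by blast
  have fJ: "f \<in> S \<rightarrow> J" using f by blast
  have fL: "f \<in> S \<rightarrow> carrier L" using fJ JD(1) by blast
  have fs: "component \<alpha> (f \<gamma>') = \<zero>\<^bsub>L\<^esub>" if "\<gamma>' \<in> S" "\<alpha> \<in> carrier QQ" "snd \<alpha> \<noteq> \<gamma>'" for \<gamma>' \<alpha>
    using component_zero_of_sum_of(2)[of "f \<gamma>'" \<gamma>' \<alpha>] f that S(2) by blast
  let ?y = "if \<gamma> \<in> S then f \<gamma> else \<zero>\<^bsub>L\<^esub>"
  have yJ: "?y \<in> J" using fJ JD(2) by auto
  have "diag (\<lambda>\<alpha>. if snd \<alpha> = \<gamma> then \<one> else \<zero>) x = ?y"
  proof (rule diag_eqI[OF indicator_Pi])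
    show "x \<in> carrier L" "?y \<in> carrier L" using x yJ JD(1) by blast+
    fix \<alpha> assume \<alpha>: "\<alpha> \<in> carrier QQ"
    have c: "component \<alpha> x = (\<Oplus>\<^bsub>L\<^esub>\<gamma>'\<in>S. component \<alpha> (f \<gamma>'))"
      unfolding xf by (rule component_additive_finsum[OF S(1) fL \<alpha>])
    show "(if snd \<alpha> = \<gamma> then \<one> else \<zero>) \<odot>\<^bsub>L\<^esub> component \<alpha> x = component \<alpha> ?y"
    proof (cases "snd \<alpha> = \<gamma>")
      case True
      have "component \<alpha> x = (\<Oplus>\<^bsub>L\<^esub>\<gamma>'\<in>S. if \<gamma> = \<gamma>' then component \<alpha> (f \<gamma>') else \<zero>\<^bsub>L\<^esub>)"
        unfolding c using fs[OF _ \<alpha>] True fL component_closed[OF _ \<alpha>]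
        by (intro M.finsum_cong') (auto simp: Pi_iff)
      also have "\<dots> = component \<alpha> ?y"
      proof (cases "\<gamma> \<in> S")
        case True
        then show ?thesis
          using M.finsum_singleton[OF True S(1), of "\<lambda>\<gamma>'. component \<alpha> (f \<gamma>')"] fL component_closed[OF _ \<alpha>]
          by (auto simp: Pi_iff)
      next
        case False
        then show ?thesis using component_zero[OF \<alpha>] by (auto intro!: M.add.finprod_one_eqI)
      qed
      finally have "component \<alpha> x = component \<alpha> ?y" .
      moreover have "component \<alpha> x \<in> carrier L" using x JD(1) component_closed[OF _ \<alpha>] by blast
      ultimately show ?thesis using True smult_one[of "component \<alpha> x"] by (simp del: smult_one)
    next
      case False
      then show ?thesis
        using x JD(1) component_closed[OF _ \<alpha>] component_zero[OF \<alpha>] fs[OF _ \<alpha>] by auto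
    qed
  qed
  then show ?thesis using yJ by simp
qed

lemma diag_span_in_ideal:
  assumes V: "lie_ideal K L V" and T: "T \<subseteq> X" and x: "x \<in> carrier L"
    and tw: "\<And>\<chi>. \<chi> \<in> T \<Longrightarrow> twist \<chi> x \<in> V" and f: "f \<in> pointwise_span K (carrier Q0) T"
  shows "diag (\<lambda>\<alpha>. f (fst \<alpha>)) x \<in> V"
  using f
proof induction
  case (zero f)
  then have "diag (\<lambda>\<alpha>. f (fst \<alpha>)) x = \<zero>\<^bsub>L\<^esub>" using x fst_closed by (intro diag_zero) auto
  then show ?case using lie_idealD(2)[OF V] by simp
next
  case (add f c \<chi> g)
  have \<chi>: "\<chi> \<in> X" using add.hyps T by blast
  have TPi: "T \<subseteq> carrier Q0 \<rightarrow> carrier K" using T X_Pi by blast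
  have f: "(\<lambda>\<alpha>. f (fst \<alpha>)) \<in> carrier QQ \<rightarrow> carrier K"
    using pointwise_span_closed[OF TPi add.hyps(1)] fst_closed by blast
  have g: "(\<lambda>\<alpha>. c \<otimes> \<chi> (fst \<alpha>)) \<in> carrier QQ \<rightarrow> carrier K"
    using X_fst[OF \<chi>] add.hyps by blast
  have "diag (\<lambda>\<alpha>. g (fst \<alpha>)) x = diag (\<lambda>\<alpha>. f (fst \<alpha>) \<oplus> c \<otimes> \<chi> (fst \<alpha>)) x"
    using f g add.hyps fst_closed x by (intro diag_cong[symmetric]) (auto simp: Pi_iff)
  also have "\<dots> = diag (\<lambda>\<alpha>. f (fst \<alpha>)) x \<oplus>\<^bsub>L\<^esub> c \<odot>\<^bsub>L\<^esub> twist \<chi> x"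
    unfolding twist_def using diag_sum[OF f g x] diag_scale[OF X_fst[OF \<chi>] add.hyps(2) x] by simp
  finally show ?case using add.IH tw[OF add.hyps(3)] add.hyps(2) lie_idealD(3,4)[OF V] by simp
qed

text \<open>
  The set of \<open>\<beta>\<close> with \<open>snd \<beta> = snd \<alpha>\<close> whose first coordinate \<open>T\<close> does not distinguish from that of
  \<open>\<alpha>\<close> is cut out by two conditions.  The indicator of the first is handled by the \<open>Q1\<close>-grading
  of the ideal, that of the second is a combination of characters in \<open>T\<close>.
\<close>
lemma class_projection_in_ideal:
  assumes V: "lie_ideal K L V" and T: "T \<subseteq> X" "(\<lambda>a \<in> carrier Q0. \<one>) \<in> T"
    and Tm: "\<And>\<chi> \<psi>. \<chi> \<in> T \<Longrightarrow> \<psi> \<in> T \<Longrightarrow> (\<lambda>a \<in> carrier Q0. \<chi> a \<otimes> \<psi> a) \<in> T"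
    and x: "x \<in> carrier L" and tw: "\<And>\<chi>. \<chi> \<in> T \<Longrightarrow> twist \<chi> x \<in> V" and \<alpha>: "\<alpha> \<in> carrier QQ"
  shows "diag (\<lambda>\<beta>. if snd \<beta> = snd \<alpha> \<and> (\<forall>\<chi> \<in> T. \<chi> (fst \<beta>) = \<chi> (fst \<alpha>)) then \<one> else \<zero>) x \<in> V"
    (is "diag ?h x \<in> V")
proof -
  let ?f = "\<lambda>a. if \<forall>\<chi> \<in> T. \<chi> a = \<chi> (fst \<alpha>) then \<one> else \<zero>"
  let ?g = "\<lambda>\<beta>. if snd \<beta> = snd \<alpha> then \<one> else \<zero>"
  have f: "?f \<in> pointwise_span K (carrier Q0) T"
    using T X_Pi by (intro indicator_in_pointwise_span[OF finite_Q0 _ T(2) Tm fst_closed[OF \<alpha>]]) auto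
  have "diag (\<lambda>\<beta>. ?f (fst \<beta>)) x \<in> V" by (rule diag_span_in_ideal[OF V T(1) x tw f])
  then have "diag ?g (diag (\<lambda>\<beta>. ?f (fst \<beta>)) x) \<in> V"
    by (rule snd_projection_in_ideal[OF V _ snd_closed[OF \<alpha>]])
  also have "diag ?g (diag (\<lambda>\<beta>. ?f (fst \<beta>)) x) = diag (\<lambda>\<beta>. ?g \<beta> \<otimes> ?f (fst \<beta>)) x"
    by (rule diag_diag[OF indicator_Pi indicator_Pi x])
  also have "\<dots> = diag ?h x"
    by (rule diag_cong) (use x in auto)
  finally show ?thesis .
qed

text \<open>The full set of characters separates the points of \<open>Q0\<close>, so the classes are singletons.\<close>
lemma component_in_ideal_of_twists:
  assumes V: "lie_ideal K L V" and x: "x \<in> carrier L" "\<And>\<chi>. \<chi> \<in> X \<Longrightarrow> twist \<chi> x \<in> V"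
    and \<alpha>: "\<alpha> \<in> carrier QQ"
  shows "component \<alpha> x \<in> V"
proof -
  let ?h = "\<lambda>\<beta>. if snd \<beta> = snd \<alpha> \<and> (\<forall>\<chi> \<in> X. \<chi> (fst \<beta>) = \<chi> (fst \<alpha>)) then \<one> else \<zero>"
  have "diag ?h x \<in> V" by (rule class_projection_in_ideal[OF V order.refl X_one X_mult x \<alpha>])
  moreover have "diag ?h x = component \<alpha> x"
  proof (rule diag_eqI[OF indicator_Pi x(1) component_closed[OF x(1) \<alpha>]])
    fix \<beta> assume \<beta>: "\<beta> \<in> carrier QQ"
    have "snd \<beta> = snd \<alpha> \<and> (\<forall>\<chi> \<in> X. \<chi> (fst \<beta>) = \<chi> (fst \<alpha>)) \<longleftrightarrow> \<beta> = \<alpha>"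
      using X_separates_eq[OF fst_closed[OF \<beta>] fst_closed[OF \<alpha>]] by (auto simp: prod_eq_iff)
    then show "?h \<beta> \<odot>\<^bsub>L\<^esub> component \<beta> x = component \<beta> (component \<alpha> x)"
      using component_homogeneous[OF \<alpha> component_in[OF x(1) \<alpha>] \<beta>]
        component_closed[OF x(1) \<alpha>] component_closed[OF x(1) \<beta>] by simp
  qed
  ultimately show ?thesis by simp
qed

end

section \<open>The complement of a maximal ideal\<close>

locale complement_of_maximal_ideal = dual_graded_lie K L Q0 Q1 G X
  for K :: "'k ring" (structure) and L :: "('k, 'a) lie_algebra" (structure)
    and Q0 :: "'q0 monoid" and Q1 :: "'q1 monoid" and G and X :: "('q0 \<Rightarrow> 'k) set" +
  fixes J assumes J: "maximal_ideal J"
begin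

lemma J_ideal: "lie_ideal K L J" and J_proper: "J \<noteq> carrier L"
  using J by (auto simp: maximal_ideal_def)

lemmas J_simps = lie_idealD[OF J_ideal]

lemma J_carrier: "x \<in> J \<Longrightarrow> x \<in> carrier L"
  using J_simps(1) by blast

definition stabilizer :: "('q0 \<Rightarrow> 'k) set" where
  "stabilizer = {\<chi> \<in> X. \<forall>x \<in> J. twist \<chi> x \<in> J}"

text \<open>
  The intersection of the ideals \<open>\<chi>\<inverse>(J)\<close> for the characters outside the stabilizer.  If there are none,
  it is all of \<open>L\<close>, and then \<open>J\<close> is zero.
\<close>
definition complement :: "'a set" where
  "complement = {x \<in> carrier L. \<forall>\<chi> \<in> X - stabilizer. twist \<chi> x \<in> J}"

lemma ideal_complement: "lie_ideal K L complement"
  using J_simps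
  by (intro lie_idealI)
    (auto simp: complement_def twist_zero twist_add twist_smult twist_bracket twist_closed bracket_closed)

lemmas complement_simps = lie_idealD[OF ideal_complement]

lemma complement_carrier: "x \<in> complement \<Longrightarrow> x \<in> carrier L"
  using complement_simps(1) by blast

lemma stabilizer_X: "stabilizer \<subseteq> X"
  by (auto simp: stabilizer_def)

lemma stabilizer_one: "(\<lambda>a \<in> carrier Q0. \<one>) \<in> stabilizer"
proof -
  have "twist (\<lambda>a \<in> carrier Q0. \<one>) x = x" if "x \<in> J" for x
    unfolding twist_def
    by (rule diag_eqI[OF X_fst[OF X_one]]) (simp_all add: J_carrier[OF that] fst_closed)
  then show ?thesis using X_one by (simp add: stabilizer_def)
qed

lemma stabilizer_mult:
  assumes "\<chi> \<in> stabilizer" "\<psi> \<in> stabilizer"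
  shows "(\<lambda>a \<in> carrier Q0. \<chi> a \<otimes> \<psi> a) \<in> stabilizer"
  using assms J_carrier by (simp add: stabilizer_def X_mult flip: twist_twist)

text \<open>
  Elements of the intersection are moved into \<open>J\<close> by all characters: by those in the stabilizer because
  they lie in \<open>J\<close>, by the others because they lie in the complement.
\<close>
lemma complement_Int_J:
  assumes "x \<in> complement" "x \<in> J"
  shows "x = \<zero>\<^bsub>L\<^esub>"
proof (rule proper_ideal_core_zero[OF J_ideal J_proper J_carrier[OF assms(2)]])
  have "twist \<chi> x \<in> J" if "\<chi> \<in> X" for \<chi>
    using assms that by (cases "\<chi> \<in> stabilizer") (auto simp: complement_def stabilizer_def)
  then show "component \<alpha> x \<in> J" if "\<alpha> \<in> carrier QQ" for \<alpha>
    using component_in_ideal_of_twists[OF J_ideal J_carrier[OF assms(2)] _ that] by blast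
qed

text \<open>
  By maximality of \<open>J\<close> it suffices that \<open>\<chi>\<inverse>(J)\<close> is not contained in \<open>J\<close>.  As \<open>\<chi>\<close> does not stabilize
  \<open>J\<close>, the image \<open>\<chi>(J)\<close> is comaximal with \<open>J\<close>; applying \<open>\<chi>\<inverse>\<close> to this, every element is the sum of an
  element of \<open>J\<close> and one of \<open>\<chi>\<inverse>(J)\<close>, which rules out the inclusion.
\<close>
lemma comaximal_conjugate:
  assumes \<chi>: "\<chi> \<in> X - stabilizer"
  shows "ideal_sum {x \<in> carrier L. twist \<chi> x \<in> J} J = carrier L"
proof (rule maximal_ideal_sum[OF J lie_ideal_twist_vimage[OF _ J_ideal]])
  show X: "\<chi> \<in> X" using \<chi> by blast
  have "\<not> twist \<chi> ` J \<subseteq> J" using \<chi> by (auto simp: stabilizer_def)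
  then have sum: "ideal_sum (twist \<chi> ` J) J = carrier L"
    by (rule maximal_ideal_sum[OF J lie_ideal_twist_image[OF X J_ideal]])
  show "\<not> {x \<in> carrier L. twist \<chi> x \<in> J} \<subseteq> J"
  proof
    assume sub: "{x \<in> carrier L. twist \<chi> x \<in> J} \<subseteq> J"
    have "y \<in> J" if y: "y \<in> carrier L" for y
    proof -
      have "twist \<chi> y \<in> ideal_sum (twist \<chi> ` J) J" using sum twist_closed[OF X y] by simp
      then obtain j k where jk: "j \<in> J" "k \<in> J" "twist \<chi> y = twist \<chi> j \<oplus>\<^bsub>L\<^esub> k"
        using ideal_sumE by blast
      have L: "j \<in> carrier L" "k \<in> carrier L" "twist \<chi> j \<in> carrier L"
        using jk J_carrier twist_closed[OF X] by auto
      let ?z = "y \<oplus>\<^bsub>L\<^esub> (\<ominus>\<one>) \<odot>\<^bsub>L\<^esub> j"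
      have "twist \<chi> ?z = (twist \<chi> j \<oplus>\<^bsub>L\<^esub> k) \<oplus>\<^bsub>L\<^esub> (\<ominus>\<one>) \<odot>\<^bsub>L\<^esub> twist \<chi> j"
        using X y L jk(3) by (simp add: twist_add twist_smult)
      also have "\<dots> = k"
        using L by (simp add: smult_l_minus M.a_comm[of "twist \<chi> j" k] M.a_assoc M.r_neg)
      finally have "twist \<chi> ?z = k" .
      then have "?z \<in> J" using sub jk(2) y L by auto
      then have "?z \<oplus>\<^bsub>L\<^esub> j \<in> J" using jk(1) J_simps(3) by blast
      then show ?thesis using y L by (simp add: smult_l_minus M.a_assoc M.l_neg)
    qed
    then show False using J_proper J_simps(1) by blast
  qed
qed

lemma complement_plus_J: "ideal_sum complement J = carrier L"
proof -
  obtain x y where nc: "x \<in> carrier L" "y \<in> carrier L" "\<lbrakk>x,y\<rbrakk>\<^bsub>L\<^esub> \<notin> J"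
    using exists_bracket_not_in_proper_ideal[OF J_ideal J_proper] by blast
  have "lie_ideal K L {x \<in> carrier L. \<forall>\<chi> \<in> F. twist \<chi> x \<in> J} \<and>
      ideal_sum {x \<in> carrier L. \<forall>\<chi> \<in> F. twist \<chi> x \<in> J} J = carrier L"
    if "finite F" "F \<subseteq> X - stabilizer" for F
    using that
  proof induction
    case empty
    show ?case
      using lie_ideal_carrier ideal_sum_upper(1)[OF lie_ideal_carrier J_ideal]
        lie_idealD(1)[OF lie_ideal_sum[OF lie_ideal_carrier J_ideal]] by auto
  next
    case (insert \<chi> F)
    let ?V = "{x \<in> carrier L. \<forall>\<chi> \<in> F. twist \<chi> x \<in> J}" and ?W = "{x \<in> carrier L. twist \<chi> x \<in> J}"
    have \<chi>: "\<chi> \<in> X - stabilizer" using insert.prems by blast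
    have V: "lie_ideal K L ?V" "ideal_sum ?V J = carrier L" using insert by auto
    have W: "lie_ideal K L ?W" using lie_ideal_twist_vimage[OF _ J_ideal] \<chi> by blast
    have eq: "{x \<in> carrier L. \<forall>\<psi> \<in> insert \<chi> F. twist \<psi> x \<in> J} = ?V \<inter> ?W" by blast
    show ?case unfolding eq
      using lie_ideal_Int[OF V(1) W] comaximal_Int[OF J nc V W comaximal_conjugate[OF \<chi>]] by blast
  qed
  from this[of "X - stabilizer"] show ?thesis using finite_X by (simp add: complement_def)
qed

definition proj :: "'a \<Rightarrow> 'a" where
  "proj x = (THE i. i \<in> complement \<and> (\<exists>j \<in> J. x = i \<oplus>\<^bsub>L\<^esub> j))"

lemma proj_eqI:
  assumes i: "i \<in> complement" and j: "j \<in> J" and x: "x = i \<oplus>\<^bsub>L\<^esub> j"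
  shows "proj x = i"
  unfolding proj_def
proof (rule the_equality)
  fix i' assume "i' \<in> complement \<and> (\<exists>j \<in> J. x = i' \<oplus>\<^bsub>L\<^esub> j)"
  then obtain j' where i': "i' \<in> complement" "j' \<in> J" "x = i' \<oplus>\<^bsub>L\<^esub> j'" by blast
  have L: "i \<in> carrier L" "j \<in> carrier L" "i' \<in> carrier L" "j' \<in> carrier L"
    using i j i' complement_carrier J_carrier by auto
  have "i' \<oplus>\<^bsub>L\<^esub> \<ominus>\<^bsub>L\<^esub> i = j \<oplus>\<^bsub>L\<^esub> \<ominus>\<^bsub>L\<^esub> j'"
    using x i'(3) L
    by (metis M.a_assoc M.a_comm M.a_inv_closed M.l_neg M.r_neg1 M.r_zero M.add.m_closed)
  moreover have "i' \<oplus>\<^bsub>L\<^esub> \<ominus>\<^bsub>L\<^esub> i \<in> complement" using i i' complement_simps(3,7) by blast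
  moreover have "j \<oplus>\<^bsub>L\<^esub> \<ominus>\<^bsub>L\<^esub> j' \<in> J" using j i' J_simps(3,7) by blast
  ultimately have "i' \<oplus>\<^bsub>L\<^esub> \<ominus>\<^bsub>L\<^esub> i = \<zero>\<^bsub>L\<^esub>" using complement_Int_J by simp
  then show "i' = i" using L by (metis M.a_inv_closed M.minus_equality M.minus_minus)
qed (use assms in blast)

lemma proj_decomposition:
  assumes "x \<in> carrier L"
  obtains j where "proj x \<in> complement" "j \<in> J" "x = proj x \<oplus>\<^bsub>L\<^esub> j"
proof -
  obtain i j where "i \<in> complement" "j \<in> J" "x = i \<oplus>\<^bsub>L\<^esub> j"
    using assms complement_plus_J ideal_sumE by blast
  then show ?thesis using that proj_eqI by metis
qed

lemma proj_in_complement: "x \<in> carrier L \<Longrightarrow> proj x \<in> complement"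
  using proj_decomposition by blast

lemma proj_closed: "x \<in> carrier L \<Longrightarrow> proj x \<in> carrier L"
  using proj_in_complement complement_carrier by blast

lemma proj_of_J: "j \<in> J \<Longrightarrow> proj j = \<zero>\<^bsub>L\<^esub>"
  using complement_simps(2) J_carrier by (intro proj_eqI[of _ j]) auto

lemma proj_zero: "proj \<zero>\<^bsub>L\<^esub> = \<zero>\<^bsub>L\<^esub>"
  using proj_of_J J_simps(2) by blast

lemma proj_eq_zeroD:
  assumes "x \<in> carrier L" "proj x = \<zero>\<^bsub>L\<^esub>"
  shows "x \<in> J"
  using proj_decomposition[OF assms(1)] assms(2) J_carrier by (metis M.l_zero)

lemma proj_add:
  assumes "x \<in> carrier L" "y \<in> carrier L"
  shows "proj (x \<oplus>\<^bsub>L\<^esub> y) = proj x \<oplus>\<^bsub>L\<^esub> proj y"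
proof -
  obtain j where j: "proj x \<in> complement" "j \<in> J" "x = proj x \<oplus>\<^bsub>L\<^esub> j" using proj_decomposition[OF assms(1)] .
  obtain k where k: "proj y \<in> complement" "k \<in> J" "y = proj y \<oplus>\<^bsub>L\<^esub> k" using proj_decomposition[OF assms(2)] .
  have L: "proj x \<in> carrier L" "proj y \<in> carrier L" "j \<in> carrier L" "k \<in> carrier L"
    using j k complement_carrier J_carrier by auto
  have "(proj x \<oplus>\<^bsub>L\<^esub> j) \<oplus>\<^bsub>L\<^esub> (proj y \<oplus>\<^bsub>L\<^esub> k) = (proj x \<oplus>\<^bsub>L\<^esub> proj y) \<oplus>\<^bsub>L\<^esub> (j \<oplus>\<^bsub>L\<^esub> k)"
    using L by (simp add: M.a_ac)
  then show ?thesis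
    using j k by (intro proj_eqI[OF complement_simps(3) J_simps(3)]) auto
qed

lemma proj_smult:
  assumes "x \<in> carrier L" "c \<in> carrier K"
  shows "proj (c \<odot>\<^bsub>L\<^esub> x) = c \<odot>\<^bsub>L\<^esub> proj x"
proof -
  obtain j where j: "proj x \<in> complement" "j \<in> J" "x = proj x \<oplus>\<^bsub>L\<^esub> j" using proj_decomposition[OF assms(1)] .
  have "c \<odot>\<^bsub>L\<^esub> (proj x \<oplus>\<^bsub>L\<^esub> j) = c \<odot>\<^bsub>L\<^esub> proj x \<oplus>\<^bsub>L\<^esub> c \<odot>\<^bsub>L\<^esub> j"
    by (rule smult_r_distr[OF assms(2) complement_carrier[OF j(1)] J_carrier[OF j(2)]])
  then show ?thesis
    using j assms by (intro proj_eqI[OF complement_simps(4) J_simps(4)]) auto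
qed

lemma proj_bracket:
  assumes "x \<in> carrier L" "y \<in> carrier L"
  shows "proj \<lbrakk>x,y\<rbrakk>\<^bsub>L\<^esub> = \<lbrakk>proj x,proj y\<rbrakk>\<^bsub>L\<^esub>"
proof -
  obtain j where j: "proj x \<in> complement" "j \<in> J" "x = proj x \<oplus>\<^bsub>L\<^esub> j" using proj_decomposition[OF assms(1)] .
  obtain k where k: "proj y \<in> complement" "k \<in> J" "y = proj y \<oplus>\<^bsub>L\<^esub> k" using proj_decomposition[OF assms(2)] .
  obtain l where "l \<in> J" "\<lbrakk>x,y\<rbrakk>\<^bsub>L\<^esub> = \<lbrakk>proj x,proj y\<rbrakk>\<^bsub>L\<^esub> \<oplus>\<^bsub>L\<^esub> l"
    using bracket_mod_ideal[OF J_ideal complement_carrier[OF j(1)] complement_carrier[OF k(1)] j(2) k(2)] j(3) k(3) by auto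
  then show ?thesis
    using complement_simps(5)[OF complement_carrier[OF j(1)] k(1)] by (intro proj_eqI) auto
qed

lemma proj_ident: "x \<in> complement \<Longrightarrow> proj x = x"
  using J_simps(2) complement_carrier by (intro proj_eqI[of x "\<zero>\<^bsub>L\<^esub>"]) auto

lemma proj_finsum:
  assumes "finite S" "f \<in> S \<rightarrow> carrier L"
  shows "proj (finsum L f S) = (\<Oplus>\<^bsub>L\<^esub>i\<in>S. proj (f i))"
  using assms by (intro M.finsum_additive_map) (auto simp: proj_add proj_closed M.abelian_group_axioms)

lemma proj_inj_homogeneous:
  assumes \<alpha>: "\<alpha> \<in> carrier QQ" and x: "x \<in> G \<alpha>" "y \<in> G \<alpha>" and eq: "proj x = proj y"
  shows "x = y"
proof -
  have L: "x \<in> carrier L" "y \<in> carrier L" using x comp_closed[OF \<alpha>] by auto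
  let ?z = "x \<oplus>\<^bsub>L\<^esub> (\<ominus>\<one>) \<odot>\<^bsub>L\<^esub> y"
  have "proj ?z = proj y \<oplus>\<^bsub>L\<^esub> (\<ominus>\<one>) \<odot>\<^bsub>L\<^esub> proj y"
    using L eq by (simp add: proj_add proj_smult)
  then have "proj ?z = \<zero>\<^bsub>L\<^esub>"
    using proj_closed[OF L(2)] by (simp add: smult_l_minus M.r_neg)
  then have "?z \<in> J" using L by (intro proj_eq_zeroD) auto
  moreover have "?z \<in> G \<alpha>" using x \<alpha> by (intro comp_add comp_smult) auto
  ultimately have "?z = \<zero>\<^bsub>L\<^esub>" using proper_ideal_homogeneous_zero[OF J_ideal J_proper \<alpha>] by blast
  then have "x \<oplus>\<^bsub>L\<^esub> \<ominus>\<^bsub>L\<^esub> y = \<zero>\<^bsub>L\<^esub>" using L by (simp add: smult_l_minus)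
  then show ?thesis using L by (metis M.a_inv_closed M.minus_equality M.minus_minus)
qed

text \<open>
  The coset of \<open>\<alpha>\<close> modulo the annihilator of the stabilizer, described by the characters themselves
  because this is the form in which \<open>class_projection_in_ideal\<close> provides the projections; see
  \<open>r_coset_eq\<close>.
\<close>
definition coset_of :: "'q0 \<times> 'q1 \<Rightarrow> ('q0 \<times> 'q1) set" where
  "coset_of \<alpha> = {\<beta> \<in> carrier QQ. snd \<beta> = snd \<alpha> \<and> (\<forall>\<chi> \<in> stabilizer. \<chi> (fst \<beta>) = \<chi> (fst \<alpha>))}"

definition block :: "('q0 \<times> 'q1) set \<Rightarrow> 'a \<Rightarrow> 'a" where
  "block C = diag (\<lambda>\<alpha>. if \<alpha> \<in> C then \<one> else \<zero>)"

text \<open>The grading of the complement by cosets.\<close>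
definition coset_part :: "('q0 \<times> 'q1) set \<Rightarrow> 'a set" where
  "coset_part C = {x \<in> complement. \<forall>\<alpha> \<in> carrier QQ - C. component \<alpha> x = \<zero>\<^bsub>L\<^esub>}"

lemma block_closed: "x \<in> carrier L \<Longrightarrow> block C x \<in> carrier L"
  unfolding block_def by (rule diag_closed[OF indicator_Pi])

lemma component_block:
  "x \<in> carrier L \<Longrightarrow> \<alpha> \<in> carrier QQ
    \<Longrightarrow> component \<alpha> (block C x) = (if \<alpha> \<in> C then component \<alpha> x else \<zero>\<^bsub>L\<^esub>)"
  unfolding block_def by (simp add: component_diag[OF indicator_Pi])

lemma block_ideal:
  assumes V: "lie_ideal K L V" and x: "x \<in> V" "\<And>\<chi>. \<chi> \<in> stabilizer \<Longrightarrow> twist \<chi> x \<in> V"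
    and \<alpha>: "\<alpha> \<in> carrier QQ"
  shows "block (coset_of \<alpha>) x \<in> V"
proof -
  have xL: "x \<in> carrier L" using x lie_idealD(1)[OF V] by blast
  have "diag (\<lambda>\<beta>. if snd \<beta> = snd \<alpha> \<and> (\<forall>\<chi> \<in> stabilizer. \<chi> (fst \<beta>) = \<chi> (fst \<alpha>)) then \<one> else \<zero>) x \<in> V"
    by (rule class_projection_in_ideal[OF V stabilizer_X stabilizer_one stabilizer_mult xL x(2) \<alpha>])
  also have "diag (\<lambda>\<beta>. if snd \<beta> = snd \<alpha> \<and> (\<forall>\<chi> \<in> stabilizer. \<chi> (fst \<beta>) = \<chi> (fst \<alpha>)) then \<one> else \<zero>) x
      = block (coset_of \<alpha>) x"
    unfolding block_def coset_of_def by (rule diag_cong[OF indicator_Pi _ xL]) simp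
  finally show ?thesis .
qed

lemma block_J: "x \<in> J \<Longrightarrow> \<alpha> \<in> carrier QQ \<Longrightarrow> block (coset_of \<alpha>) x \<in> J"
  by (rule block_ideal[OF J_ideal]) (auto simp: stabilizer_def)

lemma block_complement:
  assumes x: "x \<in> complement" and \<alpha>: "\<alpha> \<in> carrier QQ"
  shows "block (coset_of \<alpha>) x \<in> complement"
proof (rule block_ideal[OF ideal_complement x _ \<alpha>])
  fix \<chi> assume \<chi>: "\<chi> \<in> stabilizer"
  then have X: "\<chi> \<in> X" using stabilizer_X by blast
  have "twist \<psi> (twist \<chi> x) \<in> J" if \<psi>: "\<psi> \<in> X - stabilizer" for \<psi>
  proof -
    have "twist \<psi> x \<in> J" using x \<psi> by (simp add: complement_def)
    then have "twist \<chi> (twist \<psi> x) \<in> J" using \<chi> by (simp add: stabilizer_def)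
    then show ?thesis using twist_commute[OF X _ complement_carrier[OF x], of \<psi>] \<psi> by simp
  qed
  then show "twist \<chi> x \<in> complement" using twist_closed[OF X complement_carrier[OF x]] by (simp add: complement_def)
qed

lemma block_in_coset_part:
  assumes x: "x \<in> complement" and \<alpha>: "\<alpha> \<in> carrier QQ"
  shows "block (coset_of \<alpha>) x \<in> coset_part (coset_of \<alpha>)"
  using block_complement[OF assms] component_block[OF complement_carrier[OF x]] by (simp add: coset_part_def)

lemma coset_of_self: "\<alpha> \<in> carrier QQ \<Longrightarrow> \<alpha> \<in> coset_of \<alpha>"
  by (simp add: coset_of_def)

lemma coset_of_eq: "\<beta> \<in> coset_of \<alpha> \<Longrightarrow> coset_of \<beta> = coset_of \<alpha>"
  by (auto simp: coset_of_def)

lemma coset_part_in_complement: "x \<in> coset_part C \<Longrightarrow> x \<in> complement"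
  by (simp add: coset_part_def)

text \<open>
  The projection to the degrees in a coset preserves both the complement and \<open>J\<close>, so it commutes with
  \<open>proj\<close>.
\<close>
lemma proj_homogeneous:
  assumes \<alpha>: "\<alpha> \<in> carrier QQ" and x: "x \<in> G \<alpha>"
  shows "proj x \<in> coset_part (coset_of \<alpha>)"
proof -
  have xL: "x \<in> carrier L" using comp_closed[OF \<alpha> x] .
  let ?b = "block (coset_of \<alpha>)"
  have bx: "?b x = x"
    by (rule component_ext[OF block_closed[OF xL] xL])
      (auto simp: component_block[OF xL] component_homogeneous[OF \<alpha> x] coset_of_self[OF \<alpha>])
  obtain j where j: "proj x \<in> complement" "j \<in> J" "x = proj x \<oplus>\<^bsub>L\<^esub> j" using proj_decomposition[OF xL] .
  have "?b x = ?b (proj x) \<oplus>\<^bsub>L\<^esub> ?b j"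
    using diag_add[OF indicator_Pi complement_carrier[OF j(1)] J_carrier[OF j(2)], of "\<lambda>\<beta>. \<beta> \<in> coset_of \<alpha>"] j(3)
    unfolding block_def by simp
  then have "proj x = ?b (proj x)"
    using bx block_complement[OF j(1) \<alpha>] block_J[OF j(2) \<alpha>] by (intro proj_eqI) auto
  then show ?thesis using block_in_coset_part[OF j(1) \<alpha>] by simp
qed

text \<open>
  A single character translated by \<open>\<beta>\<close> acts on an element whose degree is the coset of \<open>\<beta>\<close> as the
  identity if it belongs to the stabilizer, and otherwise moves it into \<open>J\<close>.  So the scalar \<open>c\<close> is the
  sum of the coefficients of \<open>f\<close> at the characters in the stabilizer, whatever \<open>\<beta>\<close> and \<open>z\<close> are.
\<close>
lemma span_translate_scalar:
  assumes "f \<in> pointwise_span K (carrier Q0) X"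
  shows "\<exists>c \<in> carrier K. \<forall>\<beta> \<in> carrier QQ. \<forall>z \<in> coset_part (coset_of \<beta>). \<exists>j \<in> J.
    diag (\<lambda>\<alpha>. f (fst \<alpha> \<otimes>\<^bsub>Q0\<^esub> inv\<^bsub>Q0\<^esub> fst \<beta>)) z = c \<odot>\<^bsub>L\<^esub> z \<oplus>\<^bsub>L\<^esub> j"
  using assms
proof induction
  case (zero f)
  have "diag (\<lambda>\<alpha>. f (fst \<alpha> \<otimes>\<^bsub>Q0\<^esub> inv\<^bsub>Q0\<^esub> fst \<beta>)) z = \<zero> \<odot>\<^bsub>L\<^esub> z \<oplus>\<^bsub>L\<^esub> \<zero>\<^bsub>L\<^esub>"
    if "\<beta> \<in> carrier QQ" "z \<in> coset_part (coset_of \<beta>)" for \<beta> z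
    using zero that complement_carrier[OF coset_part_in_complement[OF that(2)]] fst_closed by (subst diag_zero) auto
  then show ?case using J_simps(2) zero_closed by blast
next
  case (add f a \<chi> g)
  obtain c where c: "c \<in> carrier K" and IH: "\<And>\<beta> z. \<beta> \<in> carrier QQ \<Longrightarrow> z \<in> coset_part (coset_of \<beta>) \<Longrightarrow>
    \<exists>j \<in> J. diag (\<lambda>\<alpha>. f (fst \<alpha> \<otimes>\<^bsub>Q0\<^esub> inv\<^bsub>Q0\<^esub> fst \<beta>)) z = c \<odot>\<^bsub>L\<^esub> z \<oplus>\<^bsub>L\<^esub> j"
    using add.IH by blast
  have \<chi>: "\<chi> \<in> X" and a: "a \<in> carrier K" using add.hyps by auto
  \<comment> \<open>Only characters in the stabilizer contribute to the scalar.\<close>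
  define c' where "c' = (if \<chi> \<in> stabilizer then c \<oplus> a else c)"
  have "\<exists>j \<in> J. diag (\<lambda>\<alpha>. g (fst \<alpha> \<otimes>\<^bsub>Q0\<^esub> inv\<^bsub>Q0\<^esub> fst \<beta>)) z = c' \<odot>\<^bsub>L\<^esub> z \<oplus>\<^bsub>L\<^esub> j"
    if \<beta>: "\<beta> \<in> carrier QQ" and z: "z \<in> coset_part (coset_of \<beta>)" for \<beta> z
  proof -
    have zL: "z \<in> carrier L" using complement_carrier[OF coset_part_in_complement[OF z]] .
    let ?d = "\<lambda>\<alpha>. fst \<alpha> \<otimes>\<^bsub>Q0\<^esub> inv\<^bsub>Q0\<^esub> fst \<beta>"
    have d: "?d \<alpha> \<in> carrier Q0" if "\<alpha> \<in> carrier QQ" for \<alpha>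
      using that \<beta> fst_closed by simp
    have fd: "(\<lambda>\<alpha>. f (?d \<alpha>)) \<in> carrier QQ \<rightarrow> carrier K"
      using pointwise_span_closed[OF X_Pi add.hyps(1) d] by blast
    have \<chi>d: "(\<lambda>\<alpha>. \<chi> (?d \<alpha>)) \<in> carrier QQ \<rightarrow> carrier K" using X_closed[OF \<chi> d] by blast
    have "diag (\<lambda>\<alpha>. g (?d \<alpha>)) z = diag (\<lambda>\<alpha>. f (?d \<alpha>) \<oplus> a \<otimes> \<chi> (?d \<alpha>)) z"
    proof (rule diag_cong[symmetric, OF _ _ zL])
      show "(\<lambda>\<alpha>. f (?d \<alpha>) \<oplus> a \<otimes> \<chi> (?d \<alpha>)) \<in> carrier QQ \<rightarrow> carrier K"
        using fd \<chi>d a by (auto simp: Pi_iff)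
    qed (use add.hyps(4) d in simp)
    also have "\<dots> = diag (\<lambda>\<alpha>. f (?d \<alpha>)) z \<oplus>\<^bsub>L\<^esub> a \<odot>\<^bsub>L\<^esub> diag (\<lambda>\<alpha>. \<chi> (?d \<alpha>)) z"
      using diag_sum[OF fd _ zL, of "\<lambda>\<alpha>. a \<otimes> \<chi> (?d \<alpha>)"] diag_scale[OF \<chi>d a zL] \<chi>d a
      by (auto simp: Pi_iff)
    finally have g: "diag (\<lambda>\<alpha>. g (?d \<alpha>)) z = \<dots>" .
    obtain j where j: "j \<in> J" "diag (\<lambda>\<alpha>. f (?d \<alpha>)) z = c \<odot>\<^bsub>L\<^esub> z \<oplus>\<^bsub>L\<^esub> j" using IH[OF \<beta> z] by blast
    show ?thesis
    proof (cases "\<chi> \<in> stabilizer")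
      case True
      have "diag (\<lambda>\<alpha>. \<chi> (?d \<alpha>)) z = z"
      proof (rule diag_eqI[OF \<chi>d zL zL])
        fix \<alpha> assume \<alpha>: "\<alpha> \<in> carrier QQ"
        show "\<chi> (?d \<alpha>) \<odot>\<^bsub>L\<^esub> component \<alpha> z = component \<alpha> z"
        proof (cases "\<alpha> \<in> coset_of \<beta>")
          case in_coset: True
          then have "\<chi> (?d \<alpha>) = \<one>"
            using X_eq_iff[OF \<chi> fst_closed[OF \<alpha>] fst_closed[OF \<beta>]] True by (simp add: coset_of_def)
          then show ?thesis using zL \<alpha> by simp
        next
          case False
          then show ?thesis using z \<alpha> X_closed[OF \<chi> d[OF \<alpha>]] by (simp add: coset_part_def)
        qed
      qed
      then have "diag (\<lambda>\<alpha>. g (?d \<alpha>)) z = c' \<odot>\<^bsub>L\<^esub> z \<oplus>\<^bsub>L\<^esub> j"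
        using g j True c a zL J_carrier by (simp add: c'_def smult_l_distr M.a_ac)
      then show ?thesis using j(1) by blast
    next
      case False
      have tJ: "twist \<chi> z \<in> J" using coset_part_in_complement[OF z] False \<chi> by (simp add: complement_def)
      have b: "\<chi> (inv\<^bsub>Q0\<^esub> fst \<beta>) \<in> carrier K" using X_closed[OF \<chi>] fst_closed[OF \<beta>] by simp
      have "diag (\<lambda>\<alpha>. \<chi> (?d \<alpha>)) z = diag (\<lambda>\<alpha>. \<chi> (inv\<^bsub>Q0\<^esub> fst \<beta>) \<otimes> \<chi> (fst \<alpha>)) z"
      proof (rule diag_cong[OF \<chi>d _ zL])
        fix \<alpha> assume \<alpha>: "\<alpha> \<in> carrier QQ"
        show "\<chi> (?d \<alpha>) = \<chi> (inv\<^bsub>Q0\<^esub> fst \<beta>) \<otimes> \<chi> (fst \<alpha>)"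
          using X_mult_eq[OF \<chi>] X_closed[OF \<chi>] fst_closed[OF \<alpha>] fst_closed[OF \<beta>] b by (simp add: m_comm)
      qed
      also have "\<dots> = \<chi> (inv\<^bsub>Q0\<^esub> fst \<beta>) \<odot>\<^bsub>L\<^esub> twist \<chi> z"
        unfolding twist_def by (rule diag_scale[OF X_fst[OF \<chi>] b zL])
      finally have "a \<odot>\<^bsub>L\<^esub> diag (\<lambda>\<alpha>. \<chi> (?d \<alpha>)) z \<in> J"
        using tJ b a J_simps(4) by simp
      moreover have "diag (\<lambda>\<alpha>. g (?d \<alpha>)) z = c' \<odot>\<^bsub>L\<^esub> z \<oplus>\<^bsub>L\<^esub> (j \<oplus>\<^bsub>L\<^esub> a \<odot>\<^bsub>L\<^esub> diag (\<lambda>\<alpha>. \<chi> (?d \<alpha>)) z)"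
        using g j False c a zL J_carrier diag_closed[OF \<chi>d zL] by (simp add: c'_def M.a_assoc)
      ultimately show ?thesis using j(1) J_simps(3) by blast
    qed
  qed
  moreover have "c' \<in> carrier K" using a c by (simp add: c'_def)
  ultimately show ?case by blast
qed

text \<open>
  The preceding lemma applied to the indicator of the neutral element, whose translate by \<open>\<beta>\<close> projects
  to degree \<open>\<beta>\<close>.  The scalar does not vanish, for otherwise all components of elements of the
  complement would be in \<open>J\<close> and the complement would be zero.
\<close>
lemma component_scalar_mod_J:
  "\<exists>c \<in> carrier K. c \<noteq> \<zero> \<and> (\<forall>\<beta> \<in> carrier QQ. \<forall>z \<in> coset_part (coset_of \<beta>). \<exists>j \<in> J.
     component \<beta> z = c \<odot>\<^bsub>L\<^esub> z \<oplus>\<^bsub>L\<^esub> j)"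
proof -
  let ?f = "\<lambda>a. if \<forall>\<chi> \<in> X. \<chi> a = \<chi> \<one>\<^bsub>Q0\<^esub> then \<one> else \<zero>"
  have "?f \<in> pointwise_span K (carrier Q0) X"
    by (rule indicator_in_pointwise_span[OF finite_Q0 X_Pi X_one X_mult]) auto
  from span_translate_scalar[OF this] obtain c where c: "c \<in> carrier K"
    and sc: "\<And>\<beta> z. \<beta> \<in> carrier QQ \<Longrightarrow> z \<in> coset_part (coset_of \<beta>) \<Longrightarrow>
      \<exists>j \<in> J. diag (\<lambda>\<alpha>. ?f (fst \<alpha> \<otimes>\<^bsub>Q0\<^esub> inv\<^bsub>Q0\<^esub> fst \<beta>)) z = c \<odot>\<^bsub>L\<^esub> z \<oplus>\<^bsub>L\<^esub> j"
    by blast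
  have comp: "\<exists>j \<in> J. component \<beta> z = c \<odot>\<^bsub>L\<^esub> z \<oplus>\<^bsub>L\<^esub> j"
    if \<beta>: "\<beta> \<in> carrier QQ" and z: "z \<in> coset_part (coset_of \<beta>)" for \<beta> z
  proof -
    have zL: "z \<in> carrier L" using complement_carrier[OF coset_part_in_complement[OF z]] .
    have "diag (\<lambda>\<alpha>. ?f (fst \<alpha> \<otimes>\<^bsub>Q0\<^esub> inv\<^bsub>Q0\<^esub> fst \<beta>)) z = component \<beta> z"
    proof (rule diag_eqI[OF indicator_Pi zL component_closed[OF zL \<beta>]])
      fix \<alpha> assume \<alpha>: "\<alpha> \<in> carrier QQ"
      have cl: "component \<alpha> z \<in> carrier L" using zL \<alpha> by simp
      have ch: "component \<alpha> (component \<beta> z) = (if \<alpha> = \<beta> then component \<beta> z else \<zero>\<^bsub>L\<^esub>)"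
        by (rule component_homogeneous[OF \<beta> component_in[OF zL \<beta>] \<alpha>])
      have "(\<forall>\<chi> \<in> X. \<chi> (fst \<alpha> \<otimes>\<^bsub>Q0\<^esub> inv\<^bsub>Q0\<^esub> fst \<beta>) = \<chi> \<one>\<^bsub>Q0\<^esub>) \<longleftrightarrow> fst \<alpha> = fst \<beta>"
        using X_eq_iff[OF _ fst_closed[OF \<alpha>] fst_closed[OF \<beta>]] X_one_eq
          X_separates_eq[OF fst_closed[OF \<alpha>] fst_closed[OF \<beta>]] by auto
      moreover have "component \<alpha> z = \<zero>\<^bsub>L\<^esub>" if "snd \<alpha> \<noteq> snd \<beta>"
        using z that \<alpha> by (simp add: coset_part_def coset_of_def)
      ultimately show "?f (fst \<alpha> \<otimes>\<^bsub>Q0\<^esub> inv\<^bsub>Q0\<^esub> fst \<beta>) \<odot>\<^bsub>L\<^esub> component \<alpha> z = component \<alpha> (component \<beta> z)"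
        using cl ch prod_eq_iff[of \<alpha> \<beta>] by (cases "\<alpha> = \<beta>") auto
    qed
    then show ?thesis using sc[OF \<beta> z] by simp
  qed
  have "c \<noteq> \<zero>"
  proof
    assume c0: "c = \<zero>"
    have "x = \<zero>\<^bsub>L\<^esub>" if x: "x \<in> complement" for x
    proof (rule proper_ideal_core_zero[OF J_ideal J_proper complement_carrier[OF x]])
      fix \<alpha> assume \<alpha>: "\<alpha> \<in> carrier QQ"
      have b: "block (coset_of \<alpha>) x \<in> coset_part (coset_of \<alpha>)" using block_in_coset_part[OF x \<alpha>] .
      have "component \<alpha> x = component \<alpha> (block (coset_of \<alpha>) x)"
        using component_block[OF complement_carrier[OF x] \<alpha>] coset_of_self[OF \<alpha>] by simp
      moreover obtain j where "j \<in> J" "component \<alpha> (block (coset_of \<alpha>) x) = c \<odot>\<^bsub>L\<^esub> block (coset_of \<alpha>) x \<oplus>\<^bsub>L\<^esub> j"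
        using comp[OF \<alpha> b] by blast
      ultimately show "component \<alpha> x \<in> J"
        using c0 block_closed[OF complement_carrier[OF x]] J_carrier by simp
    qed
    then have "complement \<subseteq> J" using J_simps(2) by blast
    then have "ideal_sum complement J \<subseteq> J" using J_simps(3) by (auto simp: ideal_sum_def)
    then show False using complement_plus_J J_proper J_simps(1) by blast
  qed
  then show ?thesis using c comp by blast
qed

lemma homogeneous_lift:
  assumes \<alpha>: "\<alpha> \<in> carrier QQ" and y: "y \<in> coset_part (coset_of \<alpha>)"
  shows "\<exists>x \<in> G \<alpha>. proj x = y"
proof -
  obtain c where c: "c \<in> carrier K" "c \<noteq> \<zero>"
    and comp: "\<And>\<beta> z. \<beta> \<in> carrier QQ \<Longrightarrow> z \<in> coset_part (coset_of \<beta>) \<Longrightarrow> \<exists>j \<in> J. component \<beta> z = c \<odot>\<^bsub>L\<^esub> z \<oplus>\<^bsub>L\<^esub> j"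
    using component_scalar_mod_J by blast
  have yI: "y \<in> complement" and yL: "y \<in> carrier L" using coset_part_in_complement[OF y] complement_carrier by auto
  obtain j where j: "j \<in> J" "component \<alpha> y = c \<odot>\<^bsub>L\<^esub> y \<oplus>\<^bsub>L\<^esub> j" using comp[OF \<alpha> y] by blast
  have inv: "inv c \<in> carrier K" "inv c \<otimes> c = \<one>" using c field_Units by auto
  have "proj (component \<alpha> y) = c \<odot>\<^bsub>L\<^esub> y"
    using j c yI complement_simps(4) by (intro proj_eqI) auto
  then have "proj (inv c \<odot>\<^bsub>L\<^esub> component \<alpha> y) = y"
    using inv c yL \<alpha> by (simp add: proj_smult flip: smult_assoc1)
  moreover have "inv c \<odot>\<^bsub>L\<^esub> component \<alpha> y \<in> G \<alpha>"
    using inv(1) component_in[OF yL \<alpha>] comp_smult[OF \<alpha>] by blast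
  ultimately show ?thesis by blast
qed

end

section \<open>The loop algebra\<close>

context complement_of_maximal_ideal
begin

definition \<aa> :: "('k, 'a) lie_algebra" where
  "\<aa> = L\<lparr>carrier := complement\<rparr>"

lemma \<aa>_simps [simp]:
  "carrier \<aa> = complement" "zero \<aa> = zero L" "add \<aa> = add L" "smult \<aa> = smult L" "bracket \<aa> = bracket L"
  by (simp_all add: \<aa>_def)

lemma lie_algebra_\<aa>: "lie_algebra K \<aa>"
proof -
  have "submodule complement K L" using ideal_complement by (simp add: lie_ideal_def)
  then have "module K \<aa>"
    unfolding \<aa>_def by (rule submodule.submodule_is_module[OF _ module_axioms])
  then show ?thesis
    by (intro lie_algebra.intro lie_algebra_axioms.intro field_axioms)
      (simp_all add: complement_carrier complement_simps(5) bracket_add_left bracket_add_right bracket_smult_left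
        bracket_smult_right bracket_alternating jacobi)
qed

sublocale \<aa>: plain_lie_algebra K \<aa>
  by (intro plain_lie_algebra.intro lie_algebra_\<aa>)

lemma finsum_\<aa>:
  assumes "finite S" "f \<in> S \<rightarrow> complement"
  shows "finsum \<aa> f S = finsum L f S"
  using assms
proof induction
  case (insert i S)
  have "f \<in> S \<rightarrow> complement" "f i \<in> complement" "f \<in> S \<rightarrow> carrier L" "f i \<in> carrier L"
    using insert.prems complement_carrier by auto
  then show ?case
    using insert \<aa>.M.finsum_insert[OF insert.hyps, of f] M.finsum_insert[OF insert.hyps, of f] by simp
qed simp

text \<open>
  Since \<open>J\<close> and the complement have zero bracket, an ideal of the complement is an ideal of \<open>L\<close>, to which
  the maximality of \<open>J\<close> applies.
\<close>
lemma simple_\<aa>: "simple_lie_algebra K \<aa>"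
proof -
  have "\<not> commutative_lie \<aa>"
  proof
    assume c: "commutative_lie \<aa>"
    obtain x y where nc: "x \<in> carrier L" "y \<in> carrier L" "\<lbrakk>x,y\<rbrakk>\<^bsub>L\<^esub> \<notin> J"
      using exists_bracket_not_in_proper_ideal[OF J_ideal J_proper] by blast
    have "proj \<lbrakk>x,y\<rbrakk>\<^bsub>L\<^esub> = \<zero>\<^bsub>L\<^esub>"
      using c nc proj_in_complement by (simp add: commutative_lie_def proj_bracket)
    then show False using nc proj_eq_zeroD bracket_closed by blast
  qed
  moreover have "N = {\<zero>\<^bsub>L\<^esub>} \<or> N = complement" if N: "lie_ideal K \<aa> N" for N
  proof -
    note ND = \<aa>.lie_idealD[OF N, simplified]
    have NL: "lie_ideal K L N"
    proof (rule lie_idealI)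
      fix x y assume x: "x \<in> carrier L" and y: "y \<in> N"
      have yI: "y \<in> complement" using y ND(1) by blast
      have "\<lbrakk>x,y\<rbrakk>\<^bsub>L\<^esub> = \<lbrakk>proj x,y\<rbrakk>\<^bsub>L\<^esub>"
        using proj_bracket[OF x complement_carrier[OF yI]] proj_ident[OF complement_simps(5)[OF x yI]] proj_ident[OF yI]
        by simp
      then show "\<lbrakk>x,y\<rbrakk>\<^bsub>L\<^esub> \<in> N" using ND(5)[OF proj_in_complement[OF x] y] by simp
    qed (use ND complement_carrier in auto)
    show ?thesis
    proof (cases "N \<subseteq> J")
      case True
      then show ?thesis using ND(1,2) complement_Int_J by blast
    next
      case False
      then have sum: "ideal_sum N J = carrier L" by (rule maximal_ideal_sum[OF J NL])
      have "i \<in> N" if i: "i \<in> complement" for i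
      proof -
        obtain m j where "m \<in> N" "j \<in> J" "i = m \<oplus>\<^bsub>L\<^esub> j"
          using sum complement_carrier[OF i] ideal_sumE by blast
        then show ?thesis using proj_eqI[of m j i] proj_ident[OF i] ND(1) by auto
      qed
      then show ?thesis using ND(1) by blast
    qed
  qed
  ultimately show ?thesis by (simp add: simple_lie_algebra_def lie_algebra_\<aa>)
qed

definition annihilator :: "'q0 set" where
  "annihilator = {a \<in> carrier Q0. \<forall>\<chi> \<in> stabilizer. \<chi> a = \<one>}"

abbreviation "annihilator_Q \<equiv> annihilator \<times> {\<one>\<^bsub>Q1\<^esub>}"

lemma subgroup_annihilator: "subgroup annihilator Q0"
proof
  show "x \<otimes>\<^bsub>Q0\<^esub> y \<in> annihilator" if xy: "x \<in> annihilator" "y \<in> annihilator" for x y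
  proof -
    have "\<chi> (x \<otimes>\<^bsub>Q0\<^esub> y) = \<one>" if "\<chi> \<in> stabilizer" for \<chi>
    proof -
      have "\<chi> x = \<one>" "\<chi> y = \<one>" "\<chi> \<in> X" using that xy stabilizer_X by (auto simp: annihilator_def)
      then show ?thesis using xy X_mult_eq[of \<chi> x y] by (simp add: annihilator_def)
    qed
    then show ?thesis using xy by (simp add: annihilator_def)
  qed
  show "inv\<^bsub>Q0\<^esub> x \<in> annihilator" if "x \<in> annihilator" for x
    using that stabilizer_X X_eq_iff[of _ "\<one>\<^bsub>Q0\<^esub>" x] X_one_eq by (auto simp: annihilator_def subset_iff)
qed (use stabilizer_X X_one_eq in \<open>auto simp: annihilator_def\<close>)

lemma subgroup_annihilator_Q: "subgroup annihilator_Q QQ"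
  by (intro DirProd_subgroups subgroup_annihilator Q1.triv_subgroup Q0.group_axioms Q1.group_axioms)

lemma r_coset_eq:
  assumes \<alpha>: "\<alpha> \<in> carrier QQ"
  shows "annihilator_Q #>\<^bsub>QQ\<^esub> \<alpha> = coset_of \<alpha>"
proof
  have f: "fst \<alpha> \<in> carrier Q0" "snd \<alpha> \<in> carrier Q1" using fst_closed snd_closed \<alpha> by auto
  show "annihilator_Q #>\<^bsub>QQ\<^esub> \<alpha> \<subseteq> coset_of \<alpha>"
  proof
    fix \<beta> assume "\<beta> \<in> annihilator_Q #>\<^bsub>QQ\<^esub> \<alpha>"
    then obtain a where a: "a \<in> annihilator" "\<beta> = (a, \<one>\<^bsub>Q1\<^esub>) \<otimes>\<^bsub>QQ\<^esub> \<alpha>" by (auto simp: r_coset_def)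
    have aQ: "a \<in> carrier Q0" and a1: "\<And>\<chi>. \<chi> \<in> stabilizer \<Longrightarrow> \<chi> a = \<one>"
      using a by (auto simp: annihilator_def)
    have \<beta>: "\<beta> = (a \<otimes>\<^bsub>Q0\<^esub> fst \<alpha>, snd \<alpha>)" using a(2) f by (simp add: mult_DirProd')
    have "\<chi> (a \<otimes>\<^bsub>Q0\<^esub> fst \<alpha>) = \<chi> (fst \<alpha>)" if "\<chi> \<in> stabilizer" for \<chi>
    proof -
      have "\<chi> \<in> X" using that stabilizer_X by blast
      then show ?thesis using X_mult_eq[OF _ aQ f(1), of \<chi>] a1[OF that] X_closed[OF _ f(1), of \<chi>] by simp
    qed
    then show "\<beta> \<in> coset_of \<alpha>" using \<beta> f aQ by (simp add: coset_of_def carrier_DirProd)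
  qed
  show "coset_of \<alpha> \<subseteq> annihilator_Q #>\<^bsub>QQ\<^esub> \<alpha>"
  proof
    fix \<beta> assume \<beta>: "\<beta> \<in> coset_of \<alpha>"
    then have \<beta>Q: "\<beta> \<in> carrier QQ" and s: "snd \<beta> = snd \<alpha>"
      and e: "\<And>\<chi>. \<chi> \<in> stabilizer \<Longrightarrow> \<chi> (fst \<beta>) = \<chi> (fst \<alpha>)"
      by (auto simp: coset_of_def)
    let ?a = "fst \<beta> \<otimes>\<^bsub>Q0\<^esub> inv\<^bsub>Q0\<^esub> fst \<alpha>"
    have "?a \<in> annihilator"
      using e f fst_closed[OF \<beta>Q] X_eq_iff stabilizer_X by (auto simp: annihilator_def subset_iff)
    moreover have "\<beta> = (?a, \<one>\<^bsub>Q1\<^esub>) \<otimes>\<^bsub>QQ\<^esub> \<alpha>"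
      using s f fst_closed[OF \<beta>Q] by (simp add: mult_DirProd' Q0.m_assoc prod_eq_iff)
    ultimately show "\<beta> \<in> annihilator_Q #>\<^bsub>QQ\<^esub> \<alpha>" by (auto simp: r_coset_def)
  qed
qed

lemma carrier_Mod: "carrier (QQ Mod annihilator_Q) = coset_of ` carrier QQ"
  using r_coset_eq by (simp add: carrier_FactGroup cong: image_cong)

lemma coset_part_component_zero: "x \<in> coset_part C \<Longrightarrow> \<alpha> \<in> carrier QQ \<Longrightarrow> \<alpha> \<notin> C \<Longrightarrow> component \<alpha> x = \<zero>\<^bsub>L\<^esub>"
  by (simp add: coset_part_def)

lemma supp_coset_part: "x \<in> coset_part C \<Longrightarrow> supp x \<subseteq> C"
  by (auto simp: coset_part_def supp_def)

lemma component_sum_blocks: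
  assumes S: "finite S" "S \<subseteq> coset_of ` carrier QQ" and f: "f \<in> (\<Pi> C\<in>S. coset_part C)"
    and \<alpha>: "\<alpha> \<in> carrier QQ"
  shows "component \<alpha> (finsum L f S) =
    (if coset_of \<alpha> \<in> S then component \<alpha> (f (coset_of \<alpha>)) else \<zero>\<^bsub>L\<^esub>)"
proof -
  have fL: "f \<in> S \<rightarrow> carrier L" using f coset_part_in_complement complement_carrier by blast
  have z: "component \<alpha> (f C) = \<zero>\<^bsub>L\<^esub>" if C: "C \<in> S" "C \<noteq> coset_of \<alpha>" for C
  proof -
    have "\<alpha> \<notin> C" using C S(2) coset_of_eq by blast
    then show ?thesis using coset_part_component_zero[OF _ \<alpha>] f C(1) by blast
  qed
  have cL: "component \<alpha> (f C) \<in> carrier L" if "C \<in> S" for C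
    using component_closed[OF funcset_mem[OF fL that] \<alpha>] .
  have "component \<alpha> (finsum L f S) = (\<Oplus>\<^bsub>L\<^esub>C\<in>S. component \<alpha> (f C))"
    by (rule component_additive_finsum[OF S(1) fL \<alpha>])
  also have "\<dots> = (\<Oplus>\<^bsub>L\<^esub>C\<in>S. if coset_of \<alpha> = C then component \<alpha> (f C) else \<zero>\<^bsub>L\<^esub>)"
    using z cL by (intro M.finsum_cong') auto
  also have "\<dots> = (if coset_of \<alpha> \<in> S then component \<alpha> (f (coset_of \<alpha>)) else \<zero>\<^bsub>L\<^esub>)"
  proof (cases "coset_of \<alpha> \<in> S")
    case True
    then show ?thesis
      using M.finsum_singleton[OF True S(1), of "\<lambda>C. component \<alpha> (f C)"] cL by simp
  next
    case False
    then show ?thesis by (auto intro!: M.add.finprod_one_eqI)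
  qed
  finally show ?thesis .
qed

lemma submodule_coset_part: "submodule (coset_part C) K \<aa>"
proof (rule \<aa>.submoduleI)
  have minus: "\<ominus>\<^bsub>\<aa>\<^esub> x = (\<ominus>\<one>) \<odot>\<^bsub>L\<^esub> x" if "x \<in> complement" for x
    using \<aa>.smult_l_minus[of \<one> x] that complement_carrier[OF that] by simp
  show "\<ominus>\<^bsub>\<aa>\<^esub> x \<in> coset_part C" if "x \<in> coset_part C" for x
    using that minus[OF coset_part_in_complement[OF that]] complement_simps(4)[of "\<ominus>\<one>" x] complement_carrier component_smult[of x "\<ominus>\<one>"]
    by (simp add: coset_part_def)
  show "x \<oplus>\<^bsub>\<aa>\<^esub> y \<in> coset_part C" if "x \<in> coset_part C" "y \<in> coset_part C" for x y
    using that complement_simps(3)[of x y] complement_carrier by (simp add: coset_part_def component_add)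
  show "c \<odot>\<^bsub>\<aa>\<^esub> x \<in> coset_part C" if "c \<in> carrier K" "x \<in> coset_part C" for c x
    using that complement_simps(4)[of c x] complement_carrier by (simp add: coset_part_def component_smult)
qed (auto simp: coset_part_def component_zero complement_simps(2))

lemma graded_\<aa>: "graded_lie_algebra K (QQ Mod annihilator_Q) \<aa> coset_part"
  unfolding graded_lie_algebra_def carrier_Mod
proof (intro conjI ballI)
  show "comm_group (QQ Mod annihilator_Q)" by (rule Q.abelian_FactGroup[OF subgroup_annihilator_Q])
  show "lie_algebra K \<aa>" by (rule lie_algebra_\<aa>)
  show "submodule (coset_part C) K \<aa>" for C by (rule submodule_coset_part)
  show "\<lbrakk>x,y\<rbrakk>\<^bsub>\<aa>\<^esub> \<in> coset_part (C \<otimes>\<^bsub>QQ Mod annihilator_Q\<^esub> D)"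
    if CD: "C \<in> coset_of ` carrier QQ" "D \<in> coset_of ` carrier QQ" and x: "x \<in> coset_part C" and y: "y \<in> coset_part D"
    for C D x y
  proof -
    have L: "x \<in> carrier L" "y \<in> carrier L" using x y coset_part_in_complement complement_carrier by blast+
    have "component \<gamma> \<lbrakk>x,y\<rbrakk>\<^bsub>L\<^esub> = \<zero>\<^bsub>L\<^esub>" if \<gamma>: "\<gamma> \<in> carrier QQ" "\<gamma> \<notin> C <#>\<^bsub>QQ\<^esub> D" for \<gamma>
    proof -
      have "{p \<in> supp x \<times> supp y. fst p \<otimes>\<^bsub>QQ\<^esub> snd p = \<gamma>} = {}"
      proof -
        have "fst p \<otimes>\<^bsub>QQ\<^esub> snd p \<in> C <#>\<^bsub>QQ\<^esub> D" if "p \<in> supp x \<times> supp y" for p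
        proof -
          have "fst p \<in> C" "snd p \<in> D" using that supp_coset_part[OF x] supp_coset_part[OF y] by auto
          then show ?thesis unfolding set_mult_def by blast
        qed
        then show ?thesis using \<gamma>(2) by blast
      qed
      then show ?thesis
        using component_bracket[OF L(1) L(2) finite_supp[OF L(1)] order.refl supp_subset
          finite_supp[OF L(2)] order.refl supp_subset \<gamma>(1)] by (simp only: M.finsum_empty)
    qed
    moreover have "\<lbrakk>x,y\<rbrakk>\<^bsub>L\<^esub> \<in> complement" using complement_simps(5) L(1) coset_part_in_complement[OF y] by blast
    ultimately show ?thesis by (simp add: coset_part_def)
  qed
  show "is_direct_sum \<aa> (coset_of ` carrier QQ) coset_part (carrier \<aa>)"
    unfolding is_direct_sum_def
  proof (intro conjI allI impI)
    show "carrier \<aa> = sum_of \<aa> (coset_of ` carrier QQ) coset_part"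
    proof
      show "sum_of \<aa> (coset_of ` carrier QQ) coset_part \<subseteq> carrier \<aa>"
        using coset_part_in_complement by (auto simp: sum_of_def Pi_iff intro!: \<aa>.M.finsum_closed[simplified])
      show "carrier \<aa> \<subseteq> sum_of \<aa> (coset_of ` carrier QQ) coset_part"
      proof
        fix x assume "x \<in> carrier \<aa>"
        then have x: "x \<in> complement" by simp
        have xL: "x \<in> carrier L" using complement_carrier[OF x] .
        let ?S = "coset_of ` supp x"
        have S: "finite ?S" "?S \<subseteq> coset_of ` carrier QQ"
          using finite_supp[OF xL] supp_subset by auto
        have f: "(\<lambda>C. block C x) \<in> (\<Pi> C\<in>?S. coset_part C)" using block_in_coset_part[OF x suppD] by auto
        then have fI: "(\<lambda>C. block C x) \<in> ?S \<rightarrow> complement" using coset_part_in_complement by blast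
        have "x = finsum L (\<lambda>C. block C x) ?S"
        proof (rule component_ext[OF xL])
          show "finsum L (\<lambda>C. block C x) ?S \<in> carrier L" using fI complement_carrier by (intro M.finsum_closed) auto
          fix \<alpha> assume \<alpha>: "\<alpha> \<in> carrier QQ"
          show "component \<alpha> x = component \<alpha> (finsum L (\<lambda>C. block C x) ?S)"
            using component_sum_blocks[OF S f \<alpha>] component_block[OF xL \<alpha>] coset_of_self[OF \<alpha>] \<alpha>
            by (auto simp: supp_def)
        qed
        then have "x = finsum \<aa> (\<lambda>C. block C x) ?S" using finsum_\<aa>[OF S(1) fI] by simp
        then show "x \<in> sum_of \<aa> (coset_of ` carrier QQ) coset_part"
          unfolding sum_of_def using S f by blast
      qed
    qed
    fix S f assume as: "finite S \<and> S \<subseteq> coset_of ` carrier QQ \<and> f \<in> Pi S coset_part \<and> finsum \<aa> f S = \<zero>\<^bsub>\<aa>\<^esub>"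
    have fI: "f \<in> S \<rightarrow> complement" using as coset_part_in_complement by blast
    have z: "finsum L f S = \<zero>\<^bsub>L\<^esub>" using as finsum_\<aa>[OF _ fI] by simp
    show "\<forall>C\<in>S. f C = \<zero>\<^bsub>\<aa>\<^esub>"
    proof
      fix C assume C: "C \<in> S"
      have "f C = \<zero>\<^bsub>L\<^esub>"
      proof (rule component_ext)
        show "f C \<in> carrier L" using fI C complement_carrier by blast
        fix \<alpha> assume \<alpha>: "\<alpha> \<in> carrier QQ"
        show "component \<alpha> (f C) = component \<alpha> \<zero>\<^bsub>L\<^esub>"
        proof (cases "\<alpha> \<in> C")
          case True
          then have "coset_of \<alpha> = C" using as C coset_of_eq by blast
          then show ?thesis using component_sum_blocks[of S f \<alpha>] as \<alpha> C z by auto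
        next
          case False
          moreover have "f C \<in> coset_part C" using as C by blast
          ultimately show ?thesis using coset_part_component_zero[OF _ \<alpha>] component_zero[OF \<alpha>] by simp
        qed
      qed simp
      then show "f C = \<zero>\<^bsub>\<aa>\<^esub>" by simp
    qed
  qed
qed

lemma carrier_loop:
  "carrier (loop_algebra QQ annihilator_Q \<aa> coset_part) = {f \<in> carrier QQ \<rightarrow>\<^sub>E complement. finite {\<alpha> \<in> carrier QQ. f \<alpha> \<noteq> \<zero>\<^bsub>L\<^esub>} \<and>
     (\<forall>\<alpha> \<in> carrier QQ. f \<alpha> \<in> coset_part (coset_of \<alpha>))}"
  using r_coset_eq by (auto simp: loop_algebra_def group_algebra_tensor_def loop_support_def)

text \<open>The function \<open>to_loop x\<close> stands for the sum of the \<open>proj x\<^sub>\<alpha> \<otimes> t\<^sup>\<alpha>\<close>.\<close>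
definition to_loop :: "'a \<Rightarrow> 'q0 \<times> 'q1 \<Rightarrow> 'a" where
  "to_loop x = (\<lambda>\<alpha> \<in> carrier QQ. proj (component \<alpha> x))"

lemma to_loop_carrier:
  assumes x: "x \<in> carrier L"
  shows "to_loop x \<in> carrier (loop_algebra QQ annihilator_Q \<aa> coset_part)"
proof -
  have "{\<alpha> \<in> carrier QQ. to_loop x \<alpha> \<noteq> \<zero>\<^bsub>L\<^esub>} \<subseteq> supp x"
    using proj_zero by (auto simp: to_loop_def supp_def)
  then have "finite {\<alpha> \<in> carrier QQ. to_loop x \<alpha> \<noteq> \<zero>\<^bsub>L\<^esub>}" using finite_supp[OF x] finite_subset by blast
  then show ?thesis
    unfolding carrier_loop using x proj_in_complement proj_homogeneous[OF _ component_in[OF x]] by (simp add: to_loop_def)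
qed

lemma to_loop_bij: "bij_betw to_loop (carrier L) (carrier (loop_algebra QQ annihilator_Q \<aa> coset_part))"
  unfolding bij_betw_def
proof
  show "inj_on to_loop (carrier L)"
  proof (rule inj_onI)
    fix x y assume x: "x \<in> carrier L" and y: "y \<in> carrier L" and eq: "to_loop x = to_loop y"
    show "x = y"
    proof (rule component_ext[OF x y])
      fix \<alpha> assume \<alpha>: "\<alpha> \<in> carrier QQ"
      have "proj (component \<alpha> x) = proj (component \<alpha> y)"
        using fun_cong[OF eq, of \<alpha>] \<alpha> by (simp add: to_loop_def)
      then show "component \<alpha> x = component \<alpha> y"
        by (rule proj_inj_homogeneous[OF \<alpha> component_in[OF x \<alpha>] component_in[OF y \<alpha>]])
    qed
  qed
  show "to_loop ` carrier L = carrier (loop_algebra QQ annihilator_Q \<aa> coset_part)"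
  proof
    show "to_loop ` carrier L \<subseteq> carrier (loop_algebra QQ annihilator_Q \<aa> coset_part)" using to_loop_carrier by blast
    show "carrier (loop_algebra QQ annihilator_Q \<aa> coset_part) \<subseteq> to_loop ` carrier L"
    proof
      fix f assume "f \<in> carrier (loop_algebra QQ annihilator_Q \<aa> coset_part)"
      then have f: "f \<in> carrier QQ \<rightarrow>\<^sub>E complement" "finite {\<alpha> \<in> carrier QQ. f \<alpha> \<noteq> \<zero>\<^bsub>L\<^esub>}"
        "\<And>\<alpha>. \<alpha> \<in> carrier QQ \<Longrightarrow> f \<alpha> \<in> coset_part (coset_of \<alpha>)"
        by (auto simp: carrier_loop)
      have "\<forall>\<alpha> \<in> carrier QQ. \<exists>x. x \<in> G \<alpha> \<and> proj x = f \<alpha>" using homogeneous_lift f(3) by blast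
      then obtain g where g: "\<And>\<alpha>. \<alpha> \<in> carrier QQ \<Longrightarrow> g \<alpha> \<in> G \<alpha> \<and> proj (g \<alpha>) = f \<alpha>"
        by metis
      let ?S = "{\<alpha> \<in> carrier QQ. f \<alpha> \<noteq> \<zero>\<^bsub>L\<^esub>}"
      have gG: "g \<in> (\<Pi> \<alpha>\<in>?S. G \<alpha>)" using g by auto
      let ?x = "finsum L g ?S"
      have x: "?x \<in> carrier L" using g comp_closed by (intro M.finsum_closed) auto
      have "to_loop ?x = f"
      proof
        fix \<alpha> show "to_loop ?x \<alpha> = f \<alpha>"
        proof (cases "\<alpha> \<in> carrier QQ")
          case True
          have "component \<alpha> ?x = (if \<alpha> \<in> ?S then g \<alpha> else \<zero>\<^bsub>L\<^esub>)"
            by (rule component_finsum[OF f(2) _ gG True]) auto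
          then show ?thesis using g True proj_zero by (auto simp: to_loop_def)
        next
          case False
          then show ?thesis using PiE_arb[OF f(1) False] by (simp add: to_loop_def)
        qed
      qed
      then show "f \<in> to_loop ` carrier L" using imageI[OF x, of to_loop] by simp
    qed
  qed
qed

text \<open>
  The elements \<open>x\<close> and \<open>to_loop x\<close> have the same support because \<open>proj\<close> is injective on homogeneous
  elements; hence both sides are sums over the same pairs of degrees.
\<close>
lemma to_loop_bracket:
  assumes x: "x \<in> carrier L" and y: "y \<in> carrier L"
  shows "to_loop \<lbrakk>x,y\<rbrakk>\<^bsub>L\<^esub> = \<lbrakk>to_loop x,to_loop y\<rbrakk>\<^bsub>loop_algebra QQ annihilator_Q \<aa> coset_part\<^esub>"
proof -
  have supp: "loop_support QQ \<aa> (to_loop z) = supp z" if z: "z \<in> carrier L" for z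
    using proj_zero proj_inj_homogeneous[OF _ component_in[OF z] comp_zero]
    by (auto simp: loop_support_def to_loop_def supp_def)
  let ?T = "\<lambda>\<gamma>. {p \<in> supp x \<times> supp y. fst p \<otimes>\<^bsub>QQ\<^esub> snd p = \<gamma>}"
  have "proj (component \<gamma> \<lbrakk>x,y\<rbrakk>\<^bsub>L\<^esub>) = (\<Oplus>\<^bsub>\<aa>\<^esub>p\<in>?T \<gamma>. \<lbrakk>to_loop x (fst p),to_loop y (snd p)\<rbrakk>\<^bsub>\<aa>\<^esub>)"
    if \<gamma>: "\<gamma> \<in> carrier QQ" for \<gamma>
  proof -
    have fin: "finite (?T \<gamma>)" using finite_supp x y by simp
    have mem: "fst p \<in> carrier QQ" "snd p \<in> carrier QQ" if "p \<in> ?T \<gamma>" for p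
      using that suppD by auto
    let ?b = "\<lambda>p. \<lbrakk>component (fst p) x,component (snd p) y\<rbrakk>\<^bsub>L\<^esub>"
    have bL: "?b \<in> ?T \<gamma> \<rightarrow> carrier L" using mem x y by (intro Pi_I bracket_closed component_closed)
    have pb: "proj (?b p) = \<lbrakk>to_loop x (fst p),to_loop y (snd p)\<rbrakk>\<^bsub>L\<^esub>" if "p \<in> ?T \<gamma>" for p
      using mem[OF that] x y by (simp add: to_loop_def proj_bracket)
    have "proj (component \<gamma> \<lbrakk>x,y\<rbrakk>\<^bsub>L\<^esub>) = proj (finsum L ?b (?T \<gamma>))"
      by (subst component_bracket[OF x y finite_supp[OF x] order.refl supp_subset
          finite_supp[OF y] order.refl supp_subset \<gamma>]) simp
    also have "\<dots> = (\<Oplus>\<^bsub>L\<^esub>p\<in>?T \<gamma>. proj (?b p))" by (rule proj_finsum[OF fin bL])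
    also have "\<dots> = (\<Oplus>\<^bsub>\<aa>\<^esub>p\<in>?T \<gamma>. proj (?b p))"
      using proj_in_complement bL by (intro finsum_\<aa>[symmetric] fin) auto
    also have "\<dots> = (\<Oplus>\<^bsub>\<aa>\<^esub>p\<in>?T \<gamma>. \<lbrakk>to_loop x (fst p),to_loop y (snd p)\<rbrakk>\<^bsub>\<aa>\<^esub>)"
    proof (rule \<aa>.M.finsum_cong')
      have "proj (?b p) \<in> complement" if "p \<in> ?T \<gamma>" for p using proj_in_complement bL that by blast
      then show "(\<lambda>p. \<lbrakk>to_loop x (fst p),to_loop y (snd p)\<rbrakk>\<^bsub>\<aa>\<^esub>) \<in> ?T \<gamma> \<rightarrow> carrier \<aa>"
        using pb by (intro Pi_I) simp
      show "proj (?b p) = \<lbrakk>to_loop x (fst p),to_loop y (snd p)\<rbrakk>\<^bsub>\<aa>\<^esub>" if "p \<in> ?T \<gamma>" for p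
        using pb[OF that] by simp
    qed simp
    finally show ?thesis .
  qed
  then have "to_loop \<lbrakk>x,y\<rbrakk>\<^bsub>L\<^esub> = (\<lambda>\<gamma> \<in> carrier QQ. \<Oplus>\<^bsub>\<aa>\<^esub>p\<in>?T \<gamma>. \<lbrakk>to_loop x (fst p),to_loop y (snd p)\<rbrakk>\<^bsub>\<aa>\<^esub>)"
    unfolding to_loop_def[of "\<lbrakk>x,y\<rbrakk>\<^bsub>L\<^esub>"] by (rule restrict_ext)
  then show ?thesis
    by (simp add: loop_algebra_def group_algebra_tensor_def supp[OF x] supp[OF y])
qed

lemma to_loop_iso: "to_loop \<in> lie_iso K L (loop_algebra QQ annihilator_Q \<aa> coset_part)"
  unfolding lie_iso_def
proof (intro CollectI conjI ballI to_loop_bij to_loop_bracket)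
  show "to_loop (x \<oplus>\<^bsub>L\<^esub> y) = to_loop x \<oplus>\<^bsub>loop_algebra QQ annihilator_Q \<aa> coset_part\<^esub> to_loop y" if "x \<in> carrier L" "y \<in> carrier L" for x y
  proof -
    have "to_loop (x \<oplus>\<^bsub>L\<^esub> y) = (\<lambda>\<alpha> \<in> carrier QQ. to_loop x \<alpha> \<oplus>\<^bsub>L\<^esub> to_loop y \<alpha>)"
      unfolding to_loop_def by (rule restrict_ext) (simp add: that component_add proj_add)
    then show ?thesis by (simp add: loop_algebra_def group_algebra_tensor_def)
  qed
  show "to_loop (c \<odot>\<^bsub>L\<^esub> x) = c \<odot>\<^bsub>loop_algebra QQ annihilator_Q \<aa> coset_part\<^esub> to_loop x" if "c \<in> carrier K" "x \<in> carrier L" for c x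
  proof -
    have "to_loop (c \<odot>\<^bsub>L\<^esub> x) = (\<lambda>\<alpha> \<in> carrier QQ. c \<odot>\<^bsub>L\<^esub> to_loop x \<alpha>)"
      unfolding to_loop_def by (rule restrict_ext) (simp add: that component_smult proj_smult)
    then show ?thesis by (simp add: loop_algebra_def group_algebra_tensor_def)
  qed
qed

lemma to_loop_component:
  assumes \<alpha>: "\<alpha> \<in> carrier QQ"
  shows "to_loop ` G \<alpha> = loop_component QQ annihilator_Q \<aa> coset_part \<alpha>"
proof -
  have eq: "to_loop x = loop_monom QQ \<aa> (proj x) \<alpha>" if x: "x \<in> G \<alpha>" for x
    unfolding to_loop_def loop_monom_def
    by (rule restrict_ext) (simp add: component_homogeneous[OF \<alpha> x] proj_zero)
  have "proj ` G \<alpha> = coset_part (coset_of \<alpha>)"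
  proof
    show "proj ` G \<alpha> \<subseteq> coset_part (coset_of \<alpha>)" using proj_homogeneous[OF \<alpha>] by (rule image_subsetI)
    show "coset_part (coset_of \<alpha>) \<subseteq> proj ` G \<alpha>"
    proof
      fix y assume "y \<in> coset_part (coset_of \<alpha>)"
      from homogeneous_lift[OF \<alpha> this] show "y \<in> proj ` G \<alpha>" by (auto simp: image_iff)
    qed
  qed
  then have "loop_component QQ annihilator_Q \<aa> coset_part \<alpha> = (\<lambda>x. loop_monom QQ \<aa> (proj x) \<alpha>) ` G \<alpha>"
    unfolding loop_component_def r_coset_eq[OF \<alpha>] by (simp only: image_image flip: \<open>proj ` G \<alpha> = coset_part (coset_of \<alpha>)\<close>)
  also have "\<dots> = to_loop ` G \<alpha>" by (rule image_cong[OF refl]) (rule eq[symmetric])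
  finally show ?thesis by (rule sym)
qed

theorem graded_isomorphic_loop_algebra:
  "graded_isomorphic K QQ L G (loop_algebra QQ annihilator_Q \<aa> coset_part) (loop_component QQ annihilator_Q \<aa> coset_part)"
  unfolding graded_isomorphic_def using to_loop_iso to_loop_component by blast

end

theorem theorem11:
  fixes K :: "'k ring" and Q0 :: "'q0 monoid" and Q1 :: "'q1 monoid"
    and L :: "('k, 'g) lie_algebra" and G :: "'q0 \<times> 'q1 \<Rightarrow> 'g set"
  assumes "comm_group Q0" and "comm_group Q1" and "finite (carrier Q0)"
    and "field K"
    and "\<exists>\<omega> \<in> carrier (mult_of K). group.ord (mult_of K) \<omega> = order Q0"
    and "graded_simple K (Q0 \<times>\<times> Q1) L G"
    and "minimal_grading (Q0 \<times>\<times> Q1) L G"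
    and "\<And>J. lie_ideal K L J \<Longrightarrow> snd_graded Q0 Q1 L G J"
  shows "\<exists>P0 (\<aa> :: ('k, 'g) lie_algebra) A.
           subgroup P0 Q0 \<and>
           simple_lie_algebra K \<aa> \<and>
           graded_lie_algebra K ((Q0 \<times>\<times> Q1) Mod (P0 \<times> {\<one>\<^bsub>Q1\<^esub>})) \<aa> A \<and>
           graded_isomorphic K (Q0 \<times>\<times> Q1) L G
             (loop_algebra (Q0 \<times>\<times> Q1) (P0 \<times> {\<one>\<^bsub>Q1\<^esub>}) \<aa> A)
             (loop_component (Q0 \<times>\<times> Q1) (P0 \<times> {\<one>\<^bsub>Q1\<^esub>}) \<aa> A)"
proof -
  interpret Q0: comm_group Q0 by fact
  interpret K: field K by fact
  interpret W: group "mult_of K" by (rule K.field_mult_group)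
  obtain \<omega> where \<omega>: "\<omega> \<in> carrier (mult_of K)" "W.ord \<omega> = order Q0" using assms(5) by blast
  have grd: "graded_lie_algebra K (Q0 \<times>\<times> Q1) L G" using assms(6) by (simp add: graded_simple_def)
  \<comment> \<open>Values among the powers of \<open>\<omega>\<close> keep the set of characters finite.\<close>
  define U where "U = range (\<lambda>k::nat. \<omega> [^]\<^bsub>mult_of K\<^esub> k)"
  define X where "X = {\<chi> \<in> hom Q0 (mult_of K). \<chi> \<in> carrier Q0 \<rightarrow>\<^sub>E U}"
  have U: "U \<subseteq> carrier (mult_of K)" using \<omega>(1) W.nat_pow_closed by (auto simp: U_def)
  have "finite U"
  proof -
    have "order Q0 > 0" using assms(3) by (simp add: Q0.order_gt_0_iff_finite)
    then have "W.ord \<omega> > 0" using \<omega>(2) by simp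
    have "\<omega> [^]\<^bsub>mult_of K\<^esub> k \<in> (\<lambda>k. \<omega> [^]\<^bsub>mult_of K\<^esub> k) ` {..<W.ord \<omega>}" for k :: nat
    proof
      show "\<omega> [^]\<^bsub>mult_of K\<^esub> k = \<omega> [^]\<^bsub>mult_of K\<^esub> (k mod W.ord \<omega>)"
        by (rule W.nat_pow_mod_ord[OF \<omega>(1)])
    qed (use \<open>W.ord \<omega> > 0\<close> in simp)
    then have "U \<subseteq> (\<lambda>k. \<omega> [^]\<^bsub>mult_of K\<^esub> k) ` {..<W.ord \<omega>}" unfolding U_def by blast
    then show ?thesis by (rule finite_subset) simp
  qed
  have one: "\<one>\<^bsub>K\<^esub> \<in> U" unfolding U_def by (rule range_eqI[of _ _ 0]) simp
  have mult: "a \<otimes>\<^bsub>K\<^esub> b \<in> U" if "a \<in> U" "b \<in> U" for a b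
    using that \<omega>(1) W.nat_pow_mult[OF \<omega>(1)] by (auto simp: U_def)
  interpret dual_graded_lie K L Q0 Q1 G X
  proof (intro dual_graded_lie.intro graded_simple_lie.intro graded_lie.intro plain_lie_algebra.intro
      graded_lie_axioms.intro graded_simple_lie_axioms.intro dual_graded_lie_axioms.intro)
    show "lie_algebra K L" "comm_group (Q0 \<times>\<times> Q1)" using grd by (simp_all add: graded_lie_algebra_def)
    show "finite X"
      using finite_PiE[OF assms(3), of "\<lambda>_. U"] \<open>finite U\<close> by (auto simp: X_def elim!: rev_finite_subset)
    show "(\<lambda>a\<in>carrier Q0. \<one>\<^bsub>K\<^esub>) \<in> X"
      using one by (auto simp: X_def hom_def)
    show "(\<lambda>a\<in>carrier Q0. \<chi> a \<otimes>\<^bsub>K\<^esub> \<psi> a) \<in> X" if \<chi>: "\<chi> \<in> X" and \<psi>: "\<psi> \<in> X" for \<chi> \<psi>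
    proof -
      have v: "\<chi> a \<in> U" "\<psi> a \<in> U" if "a \<in> carrier Q0" for a using \<chi> \<psi> that by (auto simp: X_def)
      have v': "\<chi> a \<in> carrier K" "\<psi> a \<in> carrier K" if "a \<in> carrier Q0" for a using v[OF that] U by auto
      have m: "\<chi> (a \<otimes>\<^bsub>Q0\<^esub> b) = \<chi> a \<otimes>\<^bsub>K\<^esub> \<chi> b" "\<psi> (a \<otimes>\<^bsub>Q0\<^esub> b) = \<psi> a \<otimes>\<^bsub>K\<^esub> \<psi> b"
        if "a \<in> carrier Q0" "b \<in> carrier Q0" for a b using \<chi> \<psi> that by (auto simp: X_def hom_def)
      have "(\<lambda>a\<in>carrier Q0. \<chi> a \<otimes>\<^bsub>K\<^esub> \<psi> a) \<in> carrier Q0 \<rightarrow>\<^sub>E U" using v mult by auto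
      moreover from this have "(\<lambda>a\<in>carrier Q0. \<chi> a \<otimes>\<^bsub>K\<^esub> \<psi> a) \<in> hom Q0 (mult_of K)"
        using U v' m by (auto simp: hom_def K.m_ac)
      ultimately show ?thesis by (simp add: X_def)
    qed
    show "\<exists>\<chi>\<in>X. \<chi> a \<noteq> \<one>\<^bsub>K\<^esub>" if a: "a \<in> carrier Q0" "a \<noteq> \<one>\<^bsub>Q0\<^esub>" for a
    proof -
      obtain \<chi> where \<chi>: "\<chi> \<in> hom Q0 (mult_of K)" "\<chi> ` carrier Q0 \<subseteq> (\<lambda>k. \<omega> [^]\<^bsub>mult_of K\<^esub> k) ` {..<order Q0}"
        "\<chi> a \<noteq> \<one>\<^bsub>mult_of K\<^esub>"
        using Q0.characters_separate_points[OF assms(3) a W.group_axioms \<omega>] by blast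
      have "restrict \<chi> (carrier Q0) \<in> X"
        using \<chi>(1,2) by (auto simp: X_def hom_def U_def)
      then show ?thesis using \<chi>(3) a(1) by (intro bexI[of _ "restrict \<chi> (carrier Q0)"]) auto
    qed
  qed (use assms grd in \<open>auto simp: X_def\<close>)
  obtain J where "maximal_ideal J" using exists_maximal_ideal by blast
  then interpret complement_of_maximal_ideal K L Q0 Q1 G X J
    by unfold_locales
  show ?thesis
    using subgroup_annihilator simple_\<aa> graded_\<aa> graded_isomorphic_loop_algebra by blast
qed

end
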